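(* Let $G$ be a finitely presented group with commutator subgroup $G' = [G,G]$, and let $C_S(G')$ be the Cayley graph of $G'$ with respect to the generating set $S$ of all nontrivial commutators $[g,h]$ with $g,h \in G$, regarded as a path metric space. Then $C_S(G')$ is large scale simply connected (i.e. large scale $1$-connected).
   Context: The Cayley graph $C_S(G')$ has one vertex for every element of $G'$, and two elements $g,h \in G'$ are joined by an edge if and only if $g^{-1}h \in S$. It carries the path metric in which every edge has length $1$. A thickening $Y$ of a metric space $X$ is an isometric (distance-preserving) inclusion $X \to Y$ into a metric space $Y$ for which there is a constant $C$ such that every point of $Y$ is within distance $C$ of some point of $X$. A metric space $X$ is large scale $k$-connected if for every thickening $X \subset Y$ there is a thickening $Y \subset Z$ which is $k$-connected in the usual sense, i.e. $Z$ is path-connected and $\pi_i(Z) = 0$ for $i \le k$. "Large scale simply connected" means large scale $1$-connected. *)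

theory Defs
  imports "HOL-Analysis.Analysis" "HOL-Algebra.Generated_Groups"
begin

section \<open>Free groups and finite presentations\<close>

text \<open>A letter \<open>(b, x)\<close> is the generator \<open>x\<close> if \<open>b\<close> holds and its formal inverse otherwise.\<close>

type_synonym 'g word = "(bool \<times> 'g) list"

definition inv_letter :: "bool \<times> 'g \<Rightarrow> bool \<times> 'g" where
  "inv_letter a = (\<not> fst a, snd a)"

definition reduced_word :: "'g word \<Rightarrow> bool" where
  "reduced_word w \<longleftrightarrow> successively (\<lambda>a b. b \<noteq> inv_letter a) w"

fun push_letter :: "bool \<times> 'g \<Rightarrow> 'g word \<Rightarrow> 'g word" where
  "push_letter a [] = [a]"
| "push_letter a (b # w) = (if b = inv_letter a then w else a # b # w)"

text \<open>Elements are the reduced words over \<open>X\<close>; \<open>foldr push_letter u v\<close> is the reduced form of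
  the concatenation \<open>u @ v\<close>.\<close>

definition free_group :: "'g set \<Rightarrow> 'g word monoid" where
  "free_group X =
     \<lparr>carrier = {w. snd ` set w \<subseteq> X \<and> reduced_word w},
      monoid.mult = (\<lambda>u v. foldr push_letter u v),
      one = []\<rparr>"

definition normal_closure :: "('a, 'b) monoid_scheme \<Rightarrow> 'a set \<Rightarrow> 'a set" where
  "normal_closure F R = \<Inter>{N. N \<lhd> F \<and> R \<subseteq> N}"

definition finitely_presented :: "('a, 'b) monoid_scheme \<Rightarrow> bool" where
  "finitely_presented G \<longleftrightarrow> group G \<and>
     (\<exists>(n::nat) R. finite R \<and> R \<subseteq> carrier (free_group {..<n}) \<and>
        G \<cong> free_group {..<n} Mod normal_closure (free_group {..<n}) R)"

lemma inv_letter_inv_letter [simp]: "inv_letter (inv_letter a) = a"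
  by (simp add: inv_letter_def)

lemma inv_letter_neq [simp]: "inv_letter a \<noteq> a" "a \<noteq> inv_letter a"
  by (auto simp: inv_letter_def prod_eq_iff)

lemma reduced_Nil [simp]: "reduced_word []"
  by (simp add: reduced_word_def)

lemma reduced_Cons:
  "reduced_word (a # w) \<longleftrightarrow> (w = [] \<or> hd w \<noteq> inv_letter a) \<and> reduced_word w"
  by (auto simp: reduced_word_def successively_Cons)

lemma reduced_push_letter: "reduced_word w \<Longrightarrow> reduced_word (push_letter a w)"
  by (cases w) (auto simp: reduced_Cons)

lemma reduced_foldr_push: "reduced_word v \<Longrightarrow> reduced_word (foldr push_letter u v)"
  by (induction u) (auto simp: reduced_push_letter)

lemma set_push_letter: "set (push_letter a w) \<subseteq> insert a (set w)"
  by (cases w) auto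

lemma set_foldr_push: "set (foldr push_letter u v) \<subseteq> set u \<union> set v"
  by (induction u) (use set_push_letter in fastforce)+

lemma push_inv_push: "reduced_word w \<Longrightarrow> push_letter (inv_letter a) (push_letter a w) = w"
proof (cases w)
  case (Cons b w')
  assume "reduced_word w"
  with Cons show ?thesis by (cases w') (auto simp: reduced_Cons)
qed simp

lemma push_push_inv: "reduced_word w \<Longrightarrow> push_letter a (push_letter (inv_letter a) w) = w"
  using push_inv_push[of w "inv_letter a"] by simp

lemma foldr_push_push:
  "reduced_word w \<Longrightarrow>
   foldr push_letter (push_letter a u) w = push_letter a (foldr push_letter u w)"
  by (cases u) (auto simp: push_push_inv reduced_foldr_push)

lemma foldr_push_assoc:
  "reduced_word w \<Longrightarrow>
   foldr push_letter (foldr push_letter u v) w = foldr push_letter u (foldr push_letter v w)"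
  by (induction u) (auto simp: foldr_push_push)

lemma foldr_push_Nil: "reduced_word u \<Longrightarrow> foldr push_letter u [] = u"
proof (induction u)
  case (Cons a u)
  then show ?case by (cases u) (auto simp: reduced_Cons)
qed simp

lemma foldr_push_left_inverse:
  "reduced_word u \<Longrightarrow>
   foldr push_letter (foldr push_letter (rev (map inv_letter u)) []) u = []"
proof (induction u)
  case (Cons a u)
  then have ru: "reduced_word u" "reduced_word (a # u)" by (auto simp: reduced_Cons)
  have "push_letter a u = a # u"
    using ru by (cases u) (auto simp: reduced_Cons)
  then have "push_letter (inv_letter a) (a # u) = u"
    using push_inv_push[OF ru(1), of a] by simp
  then show ?case
    using Cons.IH[OF ru(1)] foldr_push_assoc[OF ru(1)] foldr_push_assoc[OF ru(2)]
      foldr_push_Nil ru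
    by (simp del: push_letter.simps(2))
qed simp

lemma group_free_group: "group (free_group X)"
proof (rule groupI)
  fix x assume "x \<in> carrier (free_group X)"
  then have x: "snd ` set x \<subseteq> X" "reduced_word x" by (auto simp: free_group_def)
  let ?y = "foldr push_letter (rev (map inv_letter x)) []"
  have "snd ` set ?y \<subseteq> X"
    using set_foldr_push[of "rev (map inv_letter x)" "[]"] x(1)
    by (fastforce simp: inv_letter_def)
  then show "\<exists>y\<in>carrier (free_group X). y \<otimes>\<^bsub>free_group X\<^esub> x = \<one>\<^bsub>free_group X\<^esub>"
    using foldr_push_left_inverse[OF x(2)] reduced_foldr_push[of "[]"]
    by (intro bexI[of _ ?y]) (auto simp: free_group_def)
next
  fix x y assume "x \<in> carrier (free_group X)" "y \<in> carrier (free_group X)"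
  then show "x \<otimes>\<^bsub>free_group X\<^esub> y \<in> carrier (free_group X)"
    using set_foldr_push[of x y] by (fastforce simp: free_group_def reduced_foldr_push)
qed (simp_all add: free_group_def foldr_push_assoc)


section \<open>Metric graphs\<close>

text \<open>Points of the geometric realization of a graph without multiple edges, in barycentric
  coordinates: \<open>edge_point u v t\<close> is the point at parameter \<open>t\<close> of the edge from \<open>u\<close> to \<open>v\<close>.
  In particular \<open>edge_point u u 0\<close> is the vertex \<open>u\<close>, and \<open>edge_point u v t\<close> is the same point as
  \<open>edge_point v u (1 - t)\<close>.\<close>

definition edge_point :: "'v \<Rightarrow> 'v \<Rightarrow> real \<Rightarrow> ('v \<Rightarrow> real)" where
  "edge_point u v t = (\<lambda>x. (1 - t) * of_bool (x = u) + t * of_bool (x = v))"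

definition graph_points :: "'v set \<Rightarrow> ('v \<Rightarrow> 'v \<Rightarrow> bool) \<Rightarrow> ('v \<Rightarrow> real) set" where
  "graph_points V E =
     {edge_point u u 0 | u. u \<in> V} \<union>
     {edge_point u v t | u v t. u \<in> V \<and> v \<in> V \<and> E u v \<and> 0 \<le> t \<and> t \<le> 1}"

text \<open>\<open>pl_path V E p q l\<close>: there is a piecewise linear path of length \<open>l\<close> from \<open>p\<close> to \<open>q\<close>, each
  linear piece of which lies in one closed edge.\<close>

inductive pl_path :: "'v set \<Rightarrow> ('v \<Rightarrow> 'v \<Rightarrow> bool) \<Rightarrow> ('v \<Rightarrow> real) \<Rightarrow> ('v \<Rightarrow> real) \<Rightarrow> real \<Rightarrow> bool"
  for V E where
  refl: "p \<in> graph_points V E \<Longrightarrow> pl_path V E p p 0"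
| step: "pl_path V E p (edge_point u v s) l \<Longrightarrow> u \<in> V \<Longrightarrow> v \<in> V \<Longrightarrow> E u v \<Longrightarrow>
         0 \<le> s \<Longrightarrow> s \<le> 1 \<Longrightarrow> 0 \<le> t \<Longrightarrow> t \<le> 1 \<Longrightarrow>
         pl_path V E p (edge_point u v t) (l + \<bar>s - t\<bar>)"

definition graph_dist :: "'v set \<Rightarrow> ('v \<Rightarrow> 'v \<Rightarrow> bool) \<Rightarrow> ('v \<Rightarrow> real) \<Rightarrow> ('v \<Rightarrow> real) \<Rightarrow> real" where
  "graph_dist V E p q =
     (if p \<in> graph_points V E \<and> q \<in> graph_points V E then Inf {l. pl_path V E p q l} else 0)"

text \<open>The abstraction \<open>metric\<close> is meaningful only if this is a metric space, which holds for connected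
  graphs (\<open>Metric_space_graph\<close> below) and so for the Cayley graphs of a group with respect to a
  generating set (\<open>cayley_graph_connected\<close>).\<close>

definition graph_metric :: "'v set \<Rightarrow> ('v \<Rightarrow> 'v \<Rightarrow> bool) \<Rightarrow> ('v \<Rightarrow> real) metric" where
  "graph_metric V E = metric (graph_points V E, graph_dist V E)"

definition cayley_graph :: "('a, 'b) monoid_scheme \<Rightarrow> 'a set \<Rightarrow> ('a \<Rightarrow> real) metric" where
  "cayley_graph K S = graph_metric (carrier K) (\<lambda>g h. inv\<^bsub>K\<^esub> g \<otimes>\<^bsub>K\<^esub> h \<in> S)"

definition nontrivial_commutators :: "('a, 'b) monoid_scheme \<Rightarrow> 'a set" where
  "nontrivial_commutators G = derived_set G (carrier G) - {\<one>\<^bsub>G\<^esub>}"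

definition commutator_subgroup :: "('a, 'b) monoid_scheme \<Rightarrow> ('a, 'b) monoid_scheme" where
  "commutator_subgroup G = G\<lparr>carrier := derived G (carrier G)\<rparr>"

lemma pl_path_points:
  "pl_path V E p q l \<Longrightarrow> p \<in> graph_points V E \<and> q \<in> graph_points V E"
  by (induction rule: pl_path.induct) (auto simp: graph_points_def)

lemma pl_path_nonneg: "pl_path V E p q l \<Longrightarrow> 0 \<le> l"
  by (induction rule: pl_path.induct) auto

lemma edge_point_diff: "\<bar>edge_point u v s x - edge_point u v t x\<bar> \<le> \<bar>s - t\<bar>"
  by (auto simp: edge_point_def)

lemma pl_path_lower: "pl_path V E p q l \<Longrightarrow> \<bar>p x - q x\<bar> \<le> l"
proof (induction rule: pl_path.induct)
  case (step p u v s l t)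
  then show ?case using edge_point_diff[of u v s x t] by linarith
qed simp

lemma pl_path_trans:
  assumes "pl_path V E q r m" "pl_path V E p q l"
  shows "pl_path V E p r (l + m)"
  using assms
proof (induction arbitrary: l rule: pl_path.induct)
  case (step q u v s m t)
  then have "pl_path V E p (edge_point u v t) ((l + m) + \<bar>s - t\<bar>)"
    by (blast intro: pl_path.step)
  then show ?case by (simp add: add.assoc)
qed simp

lemma pl_path_edge:
  assumes "u \<in> V" "v \<in> V" "E u v" "0 \<le> s" "s \<le> 1" "0 \<le> t" "t \<le> 1"
  shows "pl_path V E (edge_point u v s) (edge_point u v t) \<bar>s - t\<bar>"
proof -
  have "pl_path V E (edge_point u v s) (edge_point u v s) 0"
    using assms by (intro pl_path.refl) (auto simp: graph_points_def)
  from pl_path.step[OF this assms] show ?thesis by simp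
qed

lemma pl_path_sym: "pl_path V E p q l \<Longrightarrow> pl_path V E q p l"
proof (induction rule: pl_path.induct)
  case (step p u v s l t)
  have "pl_path V E (edge_point u v t) (edge_point u v s) \<bar>t - s\<bar>"
    using step by (intro pl_path_edge)
  from pl_path_trans[OF step.IH this] show ?case
    by (simp add: add.commute abs_minus_commute)
qed (auto intro: pl_path.refl)

lemma edge_point_0: "edge_point u v 0 = edge_point u u 0"
  and edge_point_1: "edge_point u v 1 = edge_point v v 0"
  by (auto simp: edge_point_def)

lemma graph_points_connected:
  assumes conn: "\<And>u v. u \<in> V \<Longrightarrow> v \<in> V \<Longrightarrow> (u, v) \<in> {(u, v). u \<in> V \<and> v \<in> V \<and> (E u v \<or> E v u)}\<^sup>*"
    and "p \<in> graph_points V E" "q \<in> graph_points V E"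
  shows "\<exists>l. pl_path V E p q l"
proof -
  have *: "\<exists>l. pl_path V E (edge_point u u 0) (edge_point v v 0) l" if "u \<in> V" "v \<in> V" for u v
    using conn[OF that]
  proof (induction rule: rtrancl_induct)
    case base
    then show ?case using \<open>u \<in> V\<close> by (auto intro!: exI pl_path.refl simp: graph_points_def)
  next
    case (step y z)
    have "pl_path V E (edge_point a a 0) (edge_point b b 0) 1" if "a \<in> V" "b \<in> V" "E a b" for a b
      using pl_path_edge[of a V b E 0 1] that by (simp add: edge_point_0[of a b] edge_point_1)
    then have "pl_path V E (edge_point y y 0) (edge_point z z 0) 1"
      using step.hyps(2) pl_path_sym by blast
    then show ?case using step.IH pl_path_trans by blast
  qed
  have **: "\<exists>u\<in>V. \<exists>l. pl_path V E r (edge_point u u 0) l" if "r \<in> graph_points V E" for r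
    using that unfolding graph_points_def
  proof (elim UnE CollectE exE conjE)
    fix u v t assume "r = edge_point u v t" "u \<in> V" "v \<in> V" "E u v" "0 \<le> t" "t \<le> 1"
    then show ?thesis
      using pl_path_edge[of u V v E t 0] by (auto simp: edge_point_0[of u v])
  qed (use that in \<open>auto intro: pl_path.refl\<close>)
  show ?thesis
    using *  **[OF assms(2)] **[OF assms(3)] by (meson pl_path_sym pl_path_trans)
qed

lemma Metric_space_graph:
  assumes conn: "\<And>u v. u \<in> V \<Longrightarrow> v \<in> V \<Longrightarrow> (u, v) \<in> {(u, v). u \<in> V \<and> v \<in> V \<and> (E u v \<or> E v u)}\<^sup>*"
  shows "Metric_space (graph_points V E) (graph_dist V E)"
proof -
  have bdd: "bdd_below {l. pl_path V E p q l}" for p q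
    by (intro bdd_belowI[of _ 0]) (auto dest: pl_path_nonneg)
  have ne: "{l. pl_path V E p q l} \<noteq> {}"
    if "p \<in> graph_points V E" "q \<in> graph_points V E" for p q
    using graph_points_connected[OF conn that] by auto
  have sets_sym: "{l. pl_path V E p q l} = {l. pl_path V E q p l}" for p q
    by (auto intro: pl_path_sym)
  show ?thesis
  proof
    fix p q :: "'a \<Rightarrow> real"
    show "0 \<le> graph_dist V E p q"
      using ne by (auto simp: graph_dist_def intro!: cInf_greatest dest: pl_path_nonneg)
    show "graph_dist V E p q = graph_dist V E q p"
      using sets_sym[of p q] by (simp add: graph_dist_def)
  next
    fix p q :: "'a \<Rightarrow> real"
    assume pq: "p \<in> graph_points V E" "q \<in> graph_points V E"
    have "\<bar>p x - q x\<bar> \<le> graph_dist V E p q" for x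
      using pq ne by (auto simp: graph_dist_def intro!: cInf_greatest dest: pl_path_lower)
    moreover have "graph_dist V E p p \<le> 0"
      using pq by (auto simp: graph_dist_def intro!: cInf_lower bdd pl_path.refl)
    moreover have "0 \<le> graph_dist V E p p"
      using pq ne by (auto simp: graph_dist_def intro!: cInf_greatest dest: pl_path_nonneg)
    ultimately show "graph_dist V E p q = 0 \<longleftrightarrow> p = q"
      by fastforce
  next
    fix p q r :: "'a \<Rightarrow> real"
    assume pqr: "p \<in> graph_points V E" "q \<in> graph_points V E" "r \<in> graph_points V E"
    have *: "graph_dist V E p r \<le> l + m" if "pl_path V E p q l" "pl_path V E q r m" for l m
      using pqr pl_path_trans[OF that(2,1)] by (auto simp: graph_dist_def intro!: cInf_lower bdd)
    have "graph_dist V E p r - m \<le> graph_dist V E p q" if "pl_path V E q r m" for m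
    proof -
      have "graph_dist V E p r - m \<le> Inf {l. pl_path V E p q l}"
        using *[OF _ that] ne[OF pqr(1,2)]
        by (intro cInf_greatest) (auto simp: algebra_simps)
      then show ?thesis using pqr by (simp add: graph_dist_def)
    qed
    then have "graph_dist V E p r - graph_dist V E p q \<le> Inf {m. pl_path V E q r m}"
      using ne[OF pqr(2,3)] by (intro cInf_greatest) (auto simp: algebra_simps)
    then show "graph_dist V E p r \<le> graph_dist V E p q + graph_dist V E q r"
      using pqr by (simp add: graph_dist_def)
  qed
qed

lemma cayley_graph_connected:
  assumes "group K" and S: "S \<subseteq> carrier K" and gen: "generate K S = carrier K"
  shows mspace_cayley_graph:
      "mspace (cayley_graph K S) = graph_points (carrier K) (\<lambda>g h. inv\<^bsub>K\<^esub> g \<otimes>\<^bsub>K\<^esub> h \<in> S)"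
    and mdist_cayley_graph:
      "mdist (cayley_graph K S) = graph_dist (carrier K) (\<lambda>g h. inv\<^bsub>K\<^esub> g \<otimes>\<^bsub>K\<^esub> h \<in> S)"
proof -
  interpret group K by fact
  let ?E = "\<lambda>g h. inv\<^bsub>K\<^esub> g \<otimes>\<^bsub>K\<^esub> h \<in> S"
  let ?R = "{(u, v). u \<in> carrier K \<and> v \<in> carrier K \<and> (?E u v \<or> ?E v u)}"
  have *: "(g, g \<otimes>\<^bsub>K\<^esub> h) \<in> ?R\<^sup>*" if "h \<in> generate K S" "g \<in> carrier K" for g h
    using that
  proof (induction arbitrary: g rule: generate.induct)
    case (incl h)
    have "h \<in> carrier K" using incl.hyps S by auto
    then have "(g, g \<otimes>\<^bsub>K\<^esub> h) \<in> ?R"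
      using incl by (simp add: m_assoc[symmetric])
    then show ?case by (rule r_into_rtrancl)
  next
    case (inv h)
    have h: "h \<in> carrier K" using inv.hyps S by auto
    have "inv\<^bsub>K\<^esub> (g \<otimes>\<^bsub>K\<^esub> inv\<^bsub>K\<^esub> h) \<otimes>\<^bsub>K\<^esub> g = h"
      using h inv.prems by (simp add: inv_mult_group m_assoc)
    then have "(g, g \<otimes>\<^bsub>K\<^esub> inv\<^bsub>K\<^esub> h) \<in> ?R"
      using h inv by simp
    then show ?case by (rule r_into_rtrancl)
  next
    case (eng h1 h2)
    have "h1 \<in> carrier K" "h2 \<in> carrier K" using eng.hyps gen by auto
    then show ?case
      using eng.IH(1)[of g] eng.IH(2)[of "g \<otimes>\<^bsub>K\<^esub> h1"] eng.prems
      by (simp add: m_assoc)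
  qed simp
  have "(u, v) \<in> ?R\<^sup>*" if "u \<in> carrier K" "v \<in> carrier K" for u v
    using *[of "inv\<^bsub>K\<^esub> u \<otimes>\<^bsub>K\<^esub> v" u] that gen by (simp add: m_assoc[symmetric])
  then interpret M: Metric_space "graph_points (carrier K) ?E" "graph_dist (carrier K) ?E"
    by (rule Metric_space_graph)
  show "mspace (cayley_graph K S) = graph_points (carrier K) ?E"
    "mdist (cayley_graph K S) = graph_dist (carrier K) ?E"
    by (simp_all add: cayley_graph_def graph_metric_def)
qed

lemma carrier_commutator_subgroup: "carrier (commutator_subgroup G) = derived G (carrier G)"
  by (simp add: commutator_subgroup_def)

lemma generate_nontrivial_commutators:
  assumes "group G"
  shows "group (commutator_subgroup G)"
    and "nontrivial_commutators G \<subseteq> carrier (commutator_subgroup G)"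
    and "generate (commutator_subgroup G) (nontrivial_commutators G) =
         carrier (commutator_subgroup G)"
proof -
  interpret group G by fact
  let ?D = "derived G (carrier G)"
  define C where "C = derived_set G (carrier G)"
  have D: "?D = generate G C" by (simp only: derived_def C_def)
  have N: "nontrivial_commutators G = C - {\<one>\<^bsub>G\<^esub>}"
    by (simp only: nontrivial_commutators_def C_def)
  have C: "C \<subseteq> carrier G"
    unfolding C_def by (rule derived_set_in_carrier[OF subset_refl])
  have sub: "subgroup ?D G" unfolding D by (rule generate_is_subgroup[OF C])
  show "group (commutator_subgroup G)"
    unfolding commutator_subgroup_def by (rule subgroup_imp_group[OF sub])
  have S: "nontrivial_commutators G \<subseteq> ?D"
    unfolding N D by (auto intro: generate.incl)
  then show "nontrivial_commutators G \<subseteq> carrier (commutator_subgroup G)"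
    unfolding carrier_commutator_subgroup .
  have "generate G C \<subseteq> generate G (C - {\<one>\<^bsub>G\<^esub>})"
  proof (rule generate_subgroup_incl)
    show "subgroup (generate G (C - {\<one>\<^bsub>G\<^esub>})) G"
      by (rule generate_is_subgroup) (use C in blast)
    show "C \<subseteq> generate G (C - {\<one>\<^bsub>G\<^esub>})"
    proof
      fix x assume "x \<in> C"
      then show "x \<in> generate G (C - {\<one>\<^bsub>G\<^esub>})"
        by (cases "x = \<one>\<^bsub>G\<^esub>") (simp_all add: generate.one generate.incl)
    qed
  qed
  moreover have "generate G (C - {\<one>\<^bsub>G\<^esub>}) \<subseteq> generate G C"
    by (rule mono_generate) blast
  ultimately have "generate G (nontrivial_commutators G) = ?D"
    unfolding N D by (rule equalityI[rotated])
  then show "generate (commutator_subgroup G) (nontrivial_commutators G) =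
         carrier (commutator_subgroup G)"
    unfolding carrier_commutator_subgroup
    unfolding commutator_subgroup_def generate_consistent[OF S sub] .
qed


section \<open>Large scale connectivity\<close>

text \<open>Homotopy groups as groups of maps from the cube \<open>[0,1]\<^sup>i\<close> that send the boundary to the base
  point, up to homotopy relative to the boundary. Only the underlying set is needed, since a group is
  trivial iff it has exactly one element.\<close>

definition unit_cube :: "nat \<Rightarrow> (nat \<Rightarrow> real) topology" where
  "unit_cube i = product_topology (\<lambda>_. top_of_set {0..1}) {..<i}"

definition cube_boundary :: "nat \<Rightarrow> (nat \<Rightarrow> real) set" where
  "cube_boundary i = {x \<in> topspace (unit_cube i). \<exists>j<i. x j = 0 \<or> x j = 1}"

definition cube_maps :: "nat \<Rightarrow> 'a topology \<Rightarrow> 'a \<Rightarrow> ((nat \<Rightarrow> real) \<Rightarrow> 'a) set" where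
  "cube_maps i Z z = {f. continuous_map (unit_cube i) Z f \<and> (\<forall>x\<in>cube_boundary i. f x = z)}"

definition homotopy_group_set :: "nat \<Rightarrow> 'a topology \<Rightarrow> 'a \<Rightarrow> ((nat \<Rightarrow> real) \<Rightarrow> 'a) set set" where
  "homotopy_group_set i Z z =
     cube_maps i Z z //
       {(f, g). f \<in> cube_maps i Z z \<and> g \<in> cube_maps i Z z \<and>
          homotopic_with (\<lambda>h. \<forall>x\<in>cube_boundary i. h x = z) (unit_cube i) Z f g}"

definition k_connected_space :: "nat \<Rightarrow> 'a topology \<Rightarrow> bool" where
  "k_connected_space k Z \<longleftrightarrow> path_connected_space Z \<and>
     (\<forall>i\<le>k. \<forall>z\<in>topspace Z. is_singleton (homotopy_group_set i Z z))"

definition thickening :: "'x metric \<Rightarrow> 'y metric \<Rightarrow> ('x \<Rightarrow> 'y) \<Rightarrow> bool" where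
  "thickening X Y f \<longleftrightarrow>
     f \<in> mspace X \<rightarrow> mspace Y \<and>
     (\<forall>x\<in>mspace X. \<forall>x'\<in>mspace X. mdist Y (f x) (f x') = mdist X x x') \<and>
     (\<exists>C. \<forall>y\<in>mspace Y. \<exists>x\<in>mspace X. mdist Y y (f x) \<le> C)"

text \<open>HOL cannot quantify over types inside a formula. The spaces \<open>Y\<close> range over the metrics on
  subsets of the type \<open>'y\<close>; leaving \<open>'y\<close> a type variable in a theorem quantifies over all \<open>Y\<close>.
  The spaces \<open>Z\<close> are taken on subsets of \<open>'y \<Rightarrow> real\<close>, which loses nothing: if \<open>Y\<close> is nonempty and
  some \<open>k\<close>-connected metric space \<open>Z\<close> of any cardinality is a thickening of \<open>Y\<close>, then starting from
  \<open>Y\<close> and, \<open>\<omega>\<^sub>1\<close> many times, adjoining paths and null-homotopies inside \<open>Z\<close> and closing up gives a \<open>k\<close>-connected thickening of \<open>Y\<close> of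
  cardinality at most that of \<open>nat \<Rightarrow> Y + real\<close>, and this embeds into \<open>'y \<Rightarrow> real\<close>.\<close>

definition large_scale_connected :: "'y itself \<Rightarrow> nat \<Rightarrow> 'x metric \<Rightarrow> bool" where
  "large_scale_connected (_ :: 'y itself) k X \<longleftrightarrow>
     (\<forall>(Y :: 'y metric) f. thickening X Y f \<longrightarrow>
        (\<exists>(Z :: ('y \<Rightarrow> real) metric) g. thickening Y Z g \<and> k_connected_space k (mtopology_of Z)))"

lemma equiv_cube_maps:
  "equiv (cube_maps i Z z)
     {(f, g). f \<in> cube_maps i Z z \<and> g \<in> cube_maps i Z z \<and>
        homotopic_with (\<lambda>h. \<forall>x\<in>cube_boundary i. h x = z) (unit_cube i) Z f g}"
proof (rule equivI)
  show "refl_on (cube_maps i Z z) {(f, g). f \<in> cube_maps i Z z \<and> g \<in> cube_maps i Z z \<and>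
        homotopic_with (\<lambda>h. \<forall>x\<in>cube_boundary i. h x = z) (unit_cube i) Z f g}"
    by (auto simp: refl_on_def cube_maps_def)
qed (auto intro!: symI transI intro: homotopic_with_symD homotopic_with_trans)

lemma is_singleton_quotient:
  assumes eq: "equiv A R" and c: "c \<in> A"
  shows "is_singleton (A // R) \<longleftrightarrow> (\<forall>a\<in>A. (a, c) \<in> R)"
proof
  assume "is_singleton (A // R)"
  then obtain B where B: "A // R = {B}" by (rule is_singletonE)
  show "\<forall>a\<in>A. (a, c) \<in> R"
  proof
    fix a assume "a \<in> A"
    then have "R `` {a} = B" "R `` {c} = B"
      using quotientI[of _ A R] c B by blast+
    then show "(a, c) \<in> R" using eq_equiv_class[OF _ eq c, of a] by simp
  qed
next
  assume *: "\<forall>a\<in>A. (a, c) \<in> R"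
  have "B = R `` {c}" if "B \<in> A // R" for B
    using that
  proof (rule quotientE)
    fix a assume "B = R `` {a}" "a \<in> A"
    then show ?thesis using * equiv_class_eq[OF eq, of a c] by simp
  qed
  then have "A // R = {R `` {c}}" using quotientI[OF c, of R] by blast
  then show "is_singleton (A // R)" by (simp add: is_singleton_def)
qed

lemma is_singleton_homotopy_group_set:
  assumes "z \<in> topspace Z"
  shows "is_singleton (homotopy_group_set i Z z) \<longleftrightarrow>
    (\<forall>f\<in>cube_maps i Z z.
       homotopic_with (\<lambda>h. \<forall>x\<in>cube_boundary i. h x = z) (unit_cube i) Z f (\<lambda>_. z))"
proof -
  have c: "(\<lambda>_. z) \<in> cube_maps i Z z"
    using assms by (simp add: cube_maps_def)
  show ?thesis
    unfolding homotopy_group_set_def is_singleton_quotient[OF equiv_cube_maps c]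
    using c by simp
qed

end

theory Submission
  imports Defs "HOL-Probability.Discrete_Topology"
begin

text \<open>Topology: embed a thickening \<open>Y\<close> of the Cayley graph into the bounded functions on \<open>Y\<close> with
  the supremum norm, and let \<open>Z\<close> be the union of the open balls of radius \<open>k + 1/2\<close> around the
  vertices. A loop in \<open>Z\<close> can be pushed to an edge loop of the Cayley graph, since segments of length
  at most \<open>2 k\<close> can be replaced by edge paths through a midpoint; and an edge loop of length at most
  \<open>k\<close> lies in a ball, so it is null-homotopic. Hence \<open>Z\<close> is simply connected for large \<open>k\<close> provided
  that \<open>G'\<close> is presented by the commutators subject to relations of bounded length.

  Algebra: this is Miller's theorem that commutators obey only the universal relations up to
  \<open>H\<^sub>2(G)\<close>, which is finitely generated by Hopf's formula \<open>H\<^sub>2(G) = (N \<inter> [F,F]) / [F,N]\<close> for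
  \<open>G = F / N\<close>. Let \<open>\<Gamma>\<close> be the group of commutator symbols modulo relations of length at most \<open>L\<close>. By
  adjoining the generators of \<open>F\<close> one at a time, each by a semidirect product with \<open>\<int>\<close>, \<open>\<Gamma>\<close> embeds
  in a group \<open>E\<close> over \<open>G\<close> in which the commutator of two elements is the symbol of the commutator of
  their images. The lift \<open>\<psi> : F \<rightarrow> E\<close> sends \<open>N\<close> to the center, so \<open>\<psi>\<close> on \<open>N \<inter> [F,F]\<close> is determined
  by exponent vectors of relators, and these form a finitely generated abelian group. If \<open>L\<close> bounds
  the commutator lengths of its generators, then \<open>\<psi>\<close> kills \<open>N \<inter> [F,F]\<close>, so every relation among
  commutators holds in \<open>\<Gamma>\<close>.\<close>

section \<open>Words, commutators and conjugates in a group\<close>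

definition wprod :: "('a, 'b) monoid_scheme \<Rightarrow> 'a list \<Rightarrow> 'a" where
  "wprod G w = foldr (mult G) w (one G)"

definition gcomm :: "('a, 'b) monoid_scheme \<Rightarrow> 'a \<Rightarrow> 'a \<Rightarrow> 'a" where
  "gcomm G a b = a \<otimes>\<^bsub>G\<^esub> b \<otimes>\<^bsub>G\<^esub> inv\<^bsub>G\<^esub> a \<otimes>\<^bsub>G\<^esub> inv\<^bsub>G\<^esub> b"

definition gconj :: "('a, 'b) monoid_scheme \<Rightarrow> 'a \<Rightarrow> 'a \<Rightarrow> 'a" where
  "gconj G a b = a \<otimes>\<^bsub>G\<^esub> b \<otimes>\<^bsub>G\<^esub> inv\<^bsub>G\<^esub> a"

definition commutators :: "('a, 'b) monoid_scheme \<Rightarrow> 'a set" where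
  "commutators G = {gcomm G a b | a b. a \<in> carrier G \<and> b \<in> carrier G}"

lemma derived_set_eq_commutators: "derived_set G (carrier G) = commutators G"
  by (auto simp: commutators_def gcomm_def)

lemma wprod_Nil [simp]: "wprod G [] = one G"
  by (simp add: wprod_def)

lemma wprod_Cons [simp]: "wprod G (x # w) = x \<otimes>\<^bsub>G\<^esub> wprod G w"
  by (simp add: wprod_def)

context group
begin

lemma cancel_inv_left [simp]:
  "x \<in> carrier G \<Longrightarrow> y \<in> carrier G \<Longrightarrow> x \<otimes> (inv x \<otimes> y) = y"
  "x \<in> carrier G \<Longrightarrow> y \<in> carrier G \<Longrightarrow> inv x \<otimes> (x \<otimes> y) = y"
  by (simp_all add: m_assoc[symmetric])

lemma wprod_closed [simp]: "set w \<subseteq> carrier G \<Longrightarrow> wprod G w \<in> carrier G"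
  by (induction w) auto

lemma wprod_append:
  "set u \<subseteq> carrier G \<Longrightarrow> set v \<subseteq> carrier G \<Longrightarrow> wprod G (u @ v) = wprod G u \<otimes> wprod G v"
  by (induction u) (auto simp: m_assoc)

lemma gcomm_closed [simp]: "a \<in> carrier G \<Longrightarrow> b \<in> carrier G \<Longrightarrow> gcomm G a b \<in> carrier G"
  by (simp add: gcomm_def)

lemma gconj_closed [simp]: "a \<in> carrier G \<Longrightarrow> b \<in> carrier G \<Longrightarrow> gconj G a b \<in> carrier G"
  by (simp add: gconj_def)

lemma commutators_iff: "x \<in> commutators G \<longleftrightarrow> (\<exists>a\<in>carrier G. \<exists>b\<in>carrier G. x = gcomm G a b)"
  by (auto simp: commutators_def)

lemma gcomm_in_commutators [simp]:
  "a \<in> carrier G \<Longrightarrow> b \<in> carrier G \<Longrightarrow> gcomm G a b \<in> commutators G"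
  unfolding commutators_iff by blast

lemma commutators_closed: "x \<in> commutators G \<Longrightarrow> x \<in> carrier G"
  unfolding commutators_iff by auto

lemma wprod_commutators_closed: "set w \<subseteq> commutators G \<Longrightarrow> wprod G w \<in> carrier G"
  by (intro wprod_closed) (auto dest: commutators_closed)

lemma gconj_gcomm:
  "c \<in> carrier G \<Longrightarrow> a \<in> carrier G \<Longrightarrow> b \<in> carrier G \<Longrightarrow>
    gconj G c (gcomm G a b) = gcomm G (gconj G c a) (gconj G c b)"
  by (simp add: gcomm_def gconj_def m_assoc inv_mult_group)

lemma gconj_in_commutators [simp]:
  "c \<in> carrier G \<Longrightarrow> s \<in> commutators G \<Longrightarrow> gconj G c s \<in> commutators G"
  by (auto simp: commutators_iff gconj_gcomm) (metis gconj_closed)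

lemma inv_gcomm: "a \<in> carrier G \<Longrightarrow> b \<in> carrier G \<Longrightarrow> inv (gcomm G a b) = gcomm G b a"
  by (simp add: gcomm_def m_assoc inv_mult_group)

lemma inv_in_commutators [simp]: "s \<in> commutators G \<Longrightarrow> inv s \<in> commutators G"
  by (auto simp: commutators_iff inv_gcomm) blast

lemma gcomm_one [simp]:
  "a \<in> carrier G \<Longrightarrow> gcomm G a \<one> = \<one>" "a \<in> carrier G \<Longrightarrow> gcomm G \<one> a = \<one>"
  by (simp_all add: gcomm_def)

lemma one_in_commutators [simp]: "\<one> \<in> commutators G"
  using gcomm_in_commutators[of \<one> \<one>] by simp

lemma gconj_one [simp]: "a \<in> carrier G \<Longrightarrow> gconj G \<one> a = a"
  by (simp add: gconj_def)

lemma gconj_mult: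
  "a \<in> carrier G \<Longrightarrow> b \<in> carrier G \<Longrightarrow> c \<in> carrier G \<Longrightarrow> gconj G (a \<otimes> b) c = gconj G a (gconj G b c)"
  by (simp add: gconj_def m_assoc inv_mult_group)

lemma gcomm_mult_right:
  "a \<in> carrier G \<Longrightarrow> b \<in> carrier G \<Longrightarrow> c \<in> carrier G \<Longrightarrow>
    gcomm G a (b \<otimes> c) = gcomm G a b \<otimes> gconj G b (gcomm G a c)"
  by (simp add: gcomm_def gconj_def m_assoc inv_mult_group)

lemma gcomm_mult_left:
  "a \<in> carrier G \<Longrightarrow> b \<in> carrier G \<Longrightarrow> c \<in> carrier G \<Longrightarrow>
    gcomm G (a \<otimes> b) c = gcomm G a (gconj G b c) \<otimes> gcomm G b c"
  by (simp add: gcomm_def gconj_def m_assoc inv_mult_group)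

lemma gcomm_mult_eq_gconj:
  "a \<in> carrier G \<Longrightarrow> b \<in> carrier G \<Longrightarrow> gcomm G a b \<otimes> b = gconj G a b"
  by (simp add: gcomm_def gconj_def m_assoc)

lemma gconj_mult_self: "a \<in> carrier G \<Longrightarrow> b \<in> carrier G \<Longrightarrow> gconj G a b \<otimes> a = a \<otimes> b"
  by (simp add: gconj_def m_assoc)

lemma gcomm_swap:
  "a \<in> carrier G \<Longrightarrow> b \<in> carrier G \<Longrightarrow> c \<in> carrier G \<Longrightarrow>
    gcomm G a b \<otimes> (b \<otimes> (a \<otimes> c)) = a \<otimes> (b \<otimes> c)"
  by (simp add: gcomm_def m_assoc)

text \<open>Both sides equal [x t, x']; on the right, [x t, t'] becomes [x, t'] because
  \<open>t\<close> and \<open>t'\<close> commute. Each side is a product of two commutators, so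
  \<open>sym_square\<close> carries the identity over to symbols, which is what
  \<open>mult_swap\<close> in the semidirect product comes down to.\<close>

lemma gcomm_twisted_identity:
  assumes "x \<in> carrier G" "x' \<in> carrier G" "t \<in> carrier G" "t' \<in> carrier G" "t \<otimes> t' = t' \<otimes> t"
  shows "gconj G x (gcomm G t x') \<otimes> gcomm G x x' =
    gcomm G (x \<otimes> t) (x' \<otimes> t') \<otimes> gconj G x' (gcomm G t' x)"
proof -
  have "t' \<otimes> inv t = inv t \<otimes> t'"
    using assms by (metis inv_closed inv_solve_left inv_solve_right m_assoc m_closed)
  then have "t' \<otimes> (inv t \<otimes> y) = inv t \<otimes> (t' \<otimes> y)" if "y \<in> carrier G" for y
    using assms that by (metis inv_closed m_assoc)
  then show ?thesis
    using assms by (simp add: gcomm_def gconj_def m_assoc inv_mult_group)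
qed

end

section \<open>Extensions by commutator symbols\<close>

text \<open>\<open>j\<close> sends a commutator of \<open>G\<close> to a symbol in \<open>E\<close>, so that commutators in \<open>E\<close> are the symbols
  of the commutators of their images in \<open>G\<close>.\<close>

locale symbol_extension = G: group G + E: group E
  for G :: "('a, 'b) monoid_scheme" and E :: "('e, 'd) monoid_scheme"
    and j :: "'a \<Rightarrow> 'e" and \<pi> :: "'e \<Rightarrow> 'a" +
  assumes proj_hom: "\<pi> \<in> hom E G"
    and sym_closed: "s \<in> commutators G \<Longrightarrow> j s \<in> carrier E"
    and proj_sym: "s \<in> commutators G \<Longrightarrow> \<pi> (j s) = s"
    and sym_one: "j \<one>\<^bsub>G\<^esub> = \<one>\<^bsub>E\<^esub>"
    and sym_square: "a \<in> commutators G \<Longrightarrow> b \<in> commutators G \<Longrightarrow> c \<in> commutators G \<Longrightarrow>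
      d \<in> commutators G \<Longrightarrow> a \<otimes>\<^bsub>G\<^esub> b = c \<otimes>\<^bsub>G\<^esub> d \<Longrightarrow> j a \<otimes>\<^bsub>E\<^esub> j b = j c \<otimes>\<^bsub>E\<^esub> j d"
    and mult_sym: "e \<in> carrier E \<Longrightarrow> s \<in> commutators G \<Longrightarrow>
      e \<otimes>\<^bsub>E\<^esub> j s = j (gconj G (\<pi> e) s) \<otimes>\<^bsub>E\<^esub> e"
    and mult_swap: "e \<in> carrier E \<Longrightarrow> e' \<in> carrier E \<Longrightarrow>
      e \<otimes>\<^bsub>E\<^esub> e' = j (gcomm G (\<pi> e) (\<pi> e')) \<otimes>\<^bsub>E\<^esub> (e' \<otimes>\<^bsub>E\<^esub> e)"
begin

lemma proj_closed [simp]: "e \<in> carrier E \<Longrightarrow> \<pi> e \<in> carrier G"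
  using proj_hom by (auto simp: hom_def)

lemma proj_mult [simp]:
  "e \<in> carrier E \<Longrightarrow> e' \<in> carrier E \<Longrightarrow> \<pi> (e \<otimes>\<^bsub>E\<^esub> e') = \<pi> e \<otimes>\<^bsub>G\<^esub> \<pi> e'"
  using proj_hom by (auto simp: hom_def)

lemma proj_one [simp]: "\<pi> \<one>\<^bsub>E\<^esub> = \<one>\<^bsub>G\<^esub>"
  using hom_one[OF proj_hom E.is_group G.is_group] .

text \<open>A product with only one factor is padded by the trivial symbol to fit
  \<open>sym_square\<close>.\<close>

lemma sym_triangle:
  assumes "a \<in> commutators G" "b \<in> commutators G" "a \<otimes>\<^bsub>G\<^esub> b \<in> commutators G"
  shows "j (a \<otimes>\<^bsub>G\<^esub> b) = j a \<otimes>\<^bsub>E\<^esub> j b"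
  using sym_square[of a b "a \<otimes>\<^bsub>G\<^esub> b" "\<one>\<^bsub>G\<^esub>"] assms
  by (simp add: sym_one sym_closed G.commutators_closed G.one_in_commutators)

text \<open>By [t, y x] = [t, y] (y [t, x] y^-1), the twist of \<open>e\<close> to j [t, \<pi> e] e
  is multiplicative: take \<pi> e' for \<open>x\<close> and multiply by e' on the right.\<close>

lemma mult_gcomm_mult:
  assumes t: "t \<in> carrier G" and e: "e \<in> carrier E" and x: "x \<in> carrier G"
  shows "j (gcomm G t (\<pi> e \<otimes>\<^bsub>G\<^esub> x)) \<otimes>\<^bsub>E\<^esub> e =
    j (gcomm G t (\<pi> e)) \<otimes>\<^bsub>E\<^esub> (e \<otimes>\<^bsub>E\<^esub> j (gcomm G t x))"
proof -
  have "j (gcomm G t (\<pi> e \<otimes>\<^bsub>G\<^esub> x)) =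
      j (gcomm G t (\<pi> e)) \<otimes>\<^bsub>E\<^esub> j (gconj G (\<pi> e) (gcomm G t x))"
    using t e x sym_triangle[of "gcomm G t (\<pi> e)" "gconj G (\<pi> e) (gcomm G t x)"]
    by (simp add: G.gcomm_mult_right[symmetric])
  then show ?thesis
    using t e x mult_sym[of e "gcomm G t x"]
    by (simp add: E.m_assoc sym_closed)
qed

lemma proj_wprod:
  assumes "set w \<subseteq> commutators G"
  shows "wprod E (map j w) \<in> carrier E" "\<pi> (wprod E (map j w)) = wprod G w"
  using assms by (induction w) (auto simp: sym_closed proj_sym)

end

text \<open>The semidirect product of \<open>E\<close> with \<open>\<int>\<close>, whose generator maps to \<open>t\<close> and acts on \<open>E\<close> by
  \<open>e \<mapsto> j [t, \<pi> e] e\<close>. The functions \<open>mk\<close>, \<open>p\<close>, \<open>h\<close> are a pairing and its projections; a type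
  closed under pairing with integers makes the construction repeatable.\<close>

locale adjoin_generator = symbol_extension G E j \<pi>
  for G :: "('a, 'b) monoid_scheme" (structure) and E :: "'c monoid" and j \<pi> +
  fixes t :: 'a and mk :: "'c \<Rightarrow> int \<Rightarrow> 'c" and p :: "'c \<Rightarrow> 'c" and h :: "'c \<Rightarrow> int"
  assumes t [simp]: "t \<in> carrier G" and mk [simp]: "p (mk e k) = e" "h (mk e k) = k"
begin

text \<open>\<open>mk e k\<close> stands for \<open>e\<close> times the \<open>k\<close>-th power of
  the new generator. The action of this power is written out as the twist by t^k, so no automorphism
  has to be iterated; that exponents add is part of \<open>semidirect_assoc\<close>.\<close>

definition semidirect :: "'c monoid" where
  "semidirect = \<lparr>carrier = {mk e k | e k. e \<in> carrier E},
    monoid.mult = (\<lambda>x y. mk (p x \<otimes>\<^bsub>E\<^esub> (j (gcomm G (t [^]\<^bsub>G\<^esub> h x) (\<pi> (p y))) \<otimes>\<^bsub>E\<^esub> p y)) (h x + h y)),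
    one = mk \<one>\<^bsub>E\<^esub> 0\<rparr>"

lemma semidirect_mult: "mk e k \<otimes>\<^bsub>semidirect\<^esub> mk e' k' =
    mk (e \<otimes>\<^bsub>E\<^esub> (j (gcomm G (t [^]\<^bsub>G\<^esub> k) (\<pi> e')) \<otimes>\<^bsub>E\<^esub> e')) (k + k')"
  by (simp add: semidirect_def)

lemma semidirect_one: "\<one>\<^bsub>semidirect\<^esub> = mk \<one>\<^bsub>E\<^esub> 0"
  by (simp add: semidirect_def)

lemma mk_eq_iff [simp]: "mk e k = mk e' k' \<longleftrightarrow> e = e' \<and> k = k'"
  by (metis mk)

lemma mk_in_semidirect [simp]: "mk e k \<in> carrier semidirect \<longleftrightarrow> e \<in> carrier E"
  by (auto simp: semidirect_def)

lemma semidirect_cases: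
  assumes "x \<in> carrier semidirect"
  obtains e k where "x = mk e k" "e \<in> carrier E"
  using assms by (auto simp: semidirect_def)

text \<open>The twist by each power of \<open>t\<close> is multiplicative, by
  \<open>mult_gcomm_mult\<close>, and the twists by t^k1 and t^k2 compose to the twist by t^(k1 +
  k2), since [a b, c] = [a, b c b^-1] [b, c].\<close>

lemma semidirect_assoc:
  assumes "e1 \<in> carrier E" "e2 \<in> carrier E" "e3 \<in> carrier E"
  shows "mk e1 k1 \<otimes>\<^bsub>semidirect\<^esub> mk e2 k2 \<otimes>\<^bsub>semidirect\<^esub> mk e3 k3 = mk e1 k1 \<otimes>\<^bsub>semidirect\<^esub> (mk e2 k2 \<otimes>\<^bsub>semidirect\<^esub> mk e3 k3)"
proof -
  let ?T = "\<lambda>k::int. t [^]\<^bsub>G\<^esub> k"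
  let ?y = "gconj G (?T k2) (\<pi> e3)"
  \<comment> \<open>After projection to \<open>G\<close>, the twist by t^k2 is conjugation by
    t^k2.\<close>
  have pi: "\<pi> (e2 \<otimes>\<^bsub>E\<^esub> (j (gcomm G (?T k2) (\<pi> e3)) \<otimes>\<^bsub>E\<^esub> e3)) = \<pi> e2 \<otimes>\<^bsub>G\<^esub> ?y"
    using assms by (simp add: sym_closed proj_sym G.gcomm_mult_eq_gconj)
  have "j (gcomm G (?T k1) ?y) \<otimes>\<^bsub>E\<^esub> j (gcomm G (?T k2) (\<pi> e3)) = j (gcomm G (?T (k1 + k2)) (\<pi> e3))"
    using assms sym_triangle[of "gcomm G (?T k1) ?y" "gcomm G (?T k2) (\<pi> e3)"]
    by (simp add: G.gcomm_mult_left[symmetric] G.int_pow_mult)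
  then have "j (gcomm G (?T k1) ?y) \<otimes>\<^bsub>E\<^esub> (j (gcomm G (?T k2) (\<pi> e3)) \<otimes>\<^bsub>E\<^esub> e3) =
      j (gcomm G (?T (k1 + k2)) (\<pi> e3)) \<otimes>\<^bsub>E\<^esub> e3"
    using assms by (simp add: E.m_assoc[symmetric] sym_closed)
  moreover have "j (gcomm G (?T k1) (\<pi> e2 \<otimes>\<^bsub>G\<^esub> ?y)) \<otimes>\<^bsub>E\<^esub> (e2 \<otimes>\<^bsub>E\<^esub> z) =
      j (gcomm G (?T k1) (\<pi> e2)) \<otimes>\<^bsub>E\<^esub> (e2 \<otimes>\<^bsub>E\<^esub> (j (gcomm G (?T k1) ?y) \<otimes>\<^bsub>E\<^esub> z))"
    if "z \<in> carrier E" for z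
    using assms that mult_gcomm_mult[of "?T k1" e2 ?y]
    by (simp add: E.m_assoc[symmetric] sym_closed)
  ultimately show ?thesis
    using assms by (simp add: semidirect_mult pi sym_closed E.m_assoc add.assoc)
qed

lemma group_semidirect: "group semidirect"
proof (rule groupI)
  show "\<one>\<^bsub>semidirect\<^esub> \<in> carrier semidirect" by (simp add: semidirect_one)
next
  fix x y assume "x \<in> carrier semidirect" "y \<in> carrier semidirect"
  then show "x \<otimes>\<^bsub>semidirect\<^esub> y \<in> carrier semidirect"
    by (auto elim!: semidirect_cases simp: semidirect_mult sym_closed)
next
  fix x y z assume "x \<in> carrier semidirect" "y \<in> carrier semidirect" "z \<in> carrier semidirect"
  then show "x \<otimes>\<^bsub>semidirect\<^esub> y \<otimes>\<^bsub>semidirect\<^esub> z = x \<otimes>\<^bsub>semidirect\<^esub> (y \<otimes>\<^bsub>semidirect\<^esub> z)"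
    by (elim semidirect_cases) (simp add: semidirect_assoc)
next
  fix x assume "x \<in> carrier semidirect"
  then show "\<one>\<^bsub>semidirect\<^esub> \<otimes>\<^bsub>semidirect\<^esub> x = x"
    by (auto elim!: semidirect_cases simp: semidirect_mult semidirect_one sym_closed sym_one)
next
  fix x assume "x \<in> carrier semidirect"
  then obtain e k where x: "x = mk e k" and e: "e \<in> carrier E" by (rule semidirect_cases)
  \<comment> \<open>A left inverse suffices. Multiplication by exponent -k twists \<open>e\<close>
    into \<open>?f\<close>, so the inverse of \<open>?f\<close> is the first component to
    take.\<close>
  let ?f = "j (gcomm G (t [^]\<^bsub>G\<^esub> (- k)) (\<pi> e)) \<otimes>\<^bsub>E\<^esub> e"
  have "mk (inv\<^bsub>E\<^esub> ?f) (- k) \<otimes>\<^bsub>semidirect\<^esub> x = \<one>\<^bsub>semidirect\<^esub>"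
    using e by (simp add: x semidirect_mult semidirect_one sym_closed del: E.inv_mult_group)
  then show "\<exists>y\<in>carrier semidirect. y \<otimes>\<^bsub>semidirect\<^esub> x = \<one>\<^bsub>semidirect\<^esub>"
    using e by (intro bexI[of _ "mk (inv\<^bsub>E\<^esub> ?f) (- k)"]) (auto simp: sym_closed)
qed

lemma pow_commute: "t [^]\<^bsub>G\<^esub> (k::int) \<otimes>\<^bsub>G\<^esub> t [^]\<^bsub>G\<^esub> (k'::int) = t [^]\<^bsub>G\<^esub> k' \<otimes>\<^bsub>G\<^esub> t [^]\<^bsub>G\<^esub> k"
  by (simp add: G.int_pow_mult[symmetric] add.commute)

lemma semidirect_swap:
  assumes e: "e \<in> carrier E" and e': "e' \<in> carrier E"
  shows "mk e k \<otimes>\<^bsub>semidirect\<^esub> mk e' k' =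
    mk (j (gcomm G (\<pi> e \<otimes>\<^bsub>G\<^esub> t [^]\<^bsub>G\<^esub> k) (\<pi> e' \<otimes>\<^bsub>G\<^esub> t [^]\<^bsub>G\<^esub> k'))) 0 \<otimes>\<^bsub>semidirect\<^esub> (mk e' k' \<otimes>\<^bsub>semidirect\<^esub> mk e k)"
proof -
  let ?T = "t [^]\<^bsub>G\<^esub> k" and ?T' = "t [^]\<^bsub>G\<^esub> k'"
  let ?J = "j (gcomm G (\<pi> e \<otimes>\<^bsub>G\<^esub> ?T) (\<pi> e' \<otimes>\<^bsub>G\<^esub> ?T'))"
  have "e \<otimes>\<^bsub>E\<^esub> (j (gcomm G ?T (\<pi> e')) \<otimes>\<^bsub>E\<^esub> e') = (e \<otimes>\<^bsub>E\<^esub> j (gcomm G ?T (\<pi> e'))) \<otimes>\<^bsub>E\<^esub> e'"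
    using e e' by (simp add: E.m_assoc sym_closed)
  also have "\<dots> = j (gconj G (\<pi> e) (gcomm G ?T (\<pi> e'))) \<otimes>\<^bsub>E\<^esub> (e \<otimes>\<^bsub>E\<^esub> e')"
    using e e' by (simp add: mult_sym E.m_assoc sym_closed)
  also have "\<dots> = j (gconj G (\<pi> e) (gcomm G ?T (\<pi> e'))) \<otimes>\<^bsub>E\<^esub> (j (gcomm G (\<pi> e) (\<pi> e')) \<otimes>\<^bsub>E\<^esub> (e' \<otimes>\<^bsub>E\<^esub> e))"
    using mult_swap[OF e e'] by simp
  also have "\<dots> = (j (gconj G (\<pi> e) (gcomm G ?T (\<pi> e'))) \<otimes>\<^bsub>E\<^esub> j (gcomm G (\<pi> e) (\<pi> e'))) \<otimes>\<^bsub>E\<^esub> (e' \<otimes>\<^bsub>E\<^esub> e)"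
    using e e' by (simp add: E.m_assoc sym_closed)
  \<comment> \<open>\<open>gcomm_twisted_identity\<close> trades this pair of symbols for the
    desired symbol \<open>?J\<close> and one that is then absorbed as a twist of
    \<open>e\<close>.\<close>
  also have "j (gconj G (\<pi> e) (gcomm G ?T (\<pi> e'))) \<otimes>\<^bsub>E\<^esub> j (gcomm G (\<pi> e) (\<pi> e')) =
      ?J \<otimes>\<^bsub>E\<^esub> j (gconj G (\<pi> e') (gcomm G ?T' (\<pi> e)))"
    using e e' G.gcomm_twisted_identity[of "\<pi> e" "\<pi> e'" ?T ?T'] pow_commute
    by (intro sym_square) auto
  also have "(?J \<otimes>\<^bsub>E\<^esub> j (gconj G (\<pi> e') (gcomm G ?T' (\<pi> e)))) \<otimes>\<^bsub>E\<^esub> (e' \<otimes>\<^bsub>E\<^esub> e) =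
      ?J \<otimes>\<^bsub>E\<^esub> ((j (gconj G (\<pi> e') (gcomm G ?T' (\<pi> e))) \<otimes>\<^bsub>E\<^esub> e') \<otimes>\<^bsub>E\<^esub> e)"
    using e e' by (simp add: E.m_assoc sym_closed)
  also have "\<dots> = ?J \<otimes>\<^bsub>E\<^esub> (e' \<otimes>\<^bsub>E\<^esub> (j (gcomm G ?T' (\<pi> e)) \<otimes>\<^bsub>E\<^esub> e))"
    using e e' mult_sym[of e' "gcomm G ?T' (\<pi> e)", symmetric]
    by (simp add: E.m_assoc sym_closed)
  finally show ?thesis
    using e e' by (simp add: semidirect_mult sym_closed sym_one add.commute)
qed

text \<open>Adjoining a generator creates no new relation among symbols: a word in them keeps its
  value from \<open>E\<close>.\<close>

lemma wprod_semidirect: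
  assumes "set w \<subseteq> commutators G"
  shows "wprod semidirect (map (\<lambda>s. mk (j s) 0) w) = mk (wprod E (map j w)) 0"
  using assms
  by (induction w) (auto simp: semidirect_one semidirect_mult sym_closed sym_one proj_wprod G.wprod_commutators_closed)

lemma symbol_extension_semidirect:
  "symbol_extension G semidirect (\<lambda>s. mk (j s) 0) (\<lambda>x. \<pi> (p x) \<otimes>\<^bsub>G\<^esub> t [^]\<^bsub>G\<^esub> h x)"
proof -
  interpret S: group semidirect by (rule group_semidirect)
  show ?thesis
  proof unfold_locales
    show "(\<lambda>x. \<pi> (p x) \<otimes>\<^bsub>G\<^esub> t [^]\<^bsub>G\<^esub> h x) \<in> hom semidirect G"
    proof (rule homI)
      fix x y assume "x \<in> carrier semidirect" "y \<in> carrier semidirect"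
      then obtain e k e' k' where xy: "x = mk e k" "y = mk e' k'" and e: "e \<in> carrier E" "e' \<in> carrier E"
        by (metis semidirect_cases)
      let ?T = "t [^]\<^bsub>G\<^esub> k" and ?T' = "t [^]\<^bsub>G\<^esub> k'"
      have "\<pi> (p (x \<otimes>\<^bsub>semidirect\<^esub> y)) \<otimes>\<^bsub>G\<^esub> t [^]\<^bsub>G\<^esub> h (x \<otimes>\<^bsub>semidirect\<^esub> y) =
          \<pi> e \<otimes>\<^bsub>G\<^esub> (gcomm G ?T (\<pi> e') \<otimes>\<^bsub>G\<^esub> \<pi> e') \<otimes>\<^bsub>G\<^esub> (?T \<otimes>\<^bsub>G\<^esub> ?T')"
        using e by (simp add: xy semidirect_mult sym_closed proj_sym G.int_pow_mult)
      also have "\<dots> = \<pi> e \<otimes>\<^bsub>G\<^esub> (gcomm G ?T (\<pi> e') \<otimes>\<^bsub>G\<^esub> (\<pi> e' \<otimes>\<^bsub>G\<^esub> (?T \<otimes>\<^bsub>G\<^esub> ?T')))"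
        using e by (simp add: G.m_assoc)
      also have "\<dots> = \<pi> e \<otimes>\<^bsub>G\<^esub> (?T \<otimes>\<^bsub>G\<^esub> (\<pi> e' \<otimes>\<^bsub>G\<^esub> ?T'))"
        using e by (subst G.gcomm_swap) auto
      finally show "\<pi> (p (x \<otimes>\<^bsub>semidirect\<^esub> y)) \<otimes>\<^bsub>G\<^esub> t [^]\<^bsub>G\<^esub> h (x \<otimes>\<^bsub>semidirect\<^esub> y) =
          \<pi> (p x) \<otimes>\<^bsub>G\<^esub> t [^]\<^bsub>G\<^esub> h x \<otimes>\<^bsub>G\<^esub> (\<pi> (p y) \<otimes>\<^bsub>G\<^esub> t [^]\<^bsub>G\<^esub> h y)"
        using e by (simp add: xy G.m_assoc)
    qed (auto elim: semidirect_cases)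
  next
    fix e s assume "e \<in> carrier semidirect" and s: "s \<in> commutators G"
    then obtain e1 k where e: "e = mk e1 k" "e1 \<in> carrier E" by (metis semidirect_cases)
    have sG: "s \<in> carrier G" using s by (rule G.commutators_closed)
    \<comment> \<open>On a symbol, the twist by t^k is conjugation by t^k.\<close>
    have "j (gcomm G (t [^]\<^bsub>G\<^esub> k) s) \<otimes>\<^bsub>E\<^esub> j s = j (gconj G (t [^]\<^bsub>G\<^esub> k) s)"
      using s sG sym_triangle[of "gcomm G (t [^]\<^bsub>G\<^esub> k) s" s] by (simp add: G.gcomm_mult_eq_gconj)
    then show "e \<otimes>\<^bsub>semidirect\<^esub> mk (j s) 0 =
        mk (j (gconj G (\<pi> (p e) \<otimes>\<^bsub>G\<^esub> t [^]\<^bsub>G\<^esub> h e) s)) 0 \<otimes>\<^bsub>semidirect\<^esub> e"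
      using e s sG mult_sym[of e1 "gconj G (t [^]\<^bsub>G\<^esub> k) s"]
      by (simp add: semidirect_mult proj_sym sym_closed sym_one G.gconj_mult)
  next
    fix e e' assume "e \<in> carrier semidirect" "e' \<in> carrier semidirect"
    then show "e \<otimes>\<^bsub>semidirect\<^esub> e' = mk (j (gcomm G (\<pi> (p e) \<otimes>\<^bsub>G\<^esub> t [^]\<^bsub>G\<^esub> h e)
        (\<pi> (p e') \<otimes>\<^bsub>G\<^esub> t [^]\<^bsub>G\<^esub> h e'))) 0 \<otimes>\<^bsub>semidirect\<^esub> (e' \<otimes>\<^bsub>semidirect\<^esub> e)"
      by (elim semidirect_cases) (simp only: mk, rule semidirect_swap)
  next
    fix a b c d assume "a \<in> commutators G" "b \<in> commutators G" "c \<in> commutators G"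
      "d \<in> commutators G" "a \<otimes>\<^bsub>G\<^esub> b = c \<otimes>\<^bsub>G\<^esub> d"
    then show "mk (j a) 0 \<otimes>\<^bsub>semidirect\<^esub> mk (j b) 0 = mk (j c) 0 \<otimes>\<^bsub>semidirect\<^esub> mk (j d) 0"
      using sym_square[of a b c d] G.commutators_closed
      by (simp add: semidirect_mult proj_sym sym_closed sym_one)
  qed (auto simp: sym_closed proj_sym G.commutators_closed sym_one semidirect_one)
qed

end

section \<open>Words in commutators modulo short relations\<close>

definition short_moves :: "('a, 'b) monoid_scheme \<Rightarrow> nat \<Rightarrow> ('a list \<times> 'a list) set" where
  "short_moves G L = {(a @ u @ b, a @ v @ b) | a b u v.
     set (a @ b @ u @ v) \<subseteq> commutators G \<and> length u \<le> L \<and> length v \<le> L \<and> wprod G u = wprod G v}"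

definition move_eq :: "('a, 'b) monoid_scheme \<Rightarrow> nat \<Rightarrow> ('a list \<times> 'a list) set" where
  "move_eq G L = (short_moves G L)\<^sup>*"

lemma move_eqI:
  assumes "set (a @ b @ u @ v) \<subseteq> commutators G" "length u \<le> L" "length v \<le> L" "wprod G u = wprod G v"
  shows "(a @ u @ b, a @ v @ b) \<in> move_eq G L"
  unfolding move_eq_def using assms by (intro r_into_rtrancl) (auto simp: short_moves_def)

text \<open>Moves are reversible, so their reflexive transitive closure is already symmetric. A word
  with a letter outside the commutators is related only to itself, which permits an equivalence on
  the whole type.\<close>

lemma equiv_move_eq: "equiv UNIV (move_eq G L)"
proof (rule equivI)
  have "sym (short_moves G L)"
    unfolding short_moves_def by (rule symI) fastforce
  then show "sym (move_eq G L)" unfolding move_eq_def by (rule sym_rtrancl)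
qed (auto simp: move_eq_def refl_rtrancl trans_rtrancl)

lemma move_eq_refl: "(u, u) \<in> move_eq G L"
  by (simp add: move_eq_def)

lemma move_eq_trans [trans]: "(u, v) \<in> move_eq G L \<Longrightarrow> (v, w) \<in> move_eq G L \<Longrightarrow> (u, w) \<in> move_eq G L"
  by (simp add: move_eq_def)

lemma move_eq_sym: "(u, v) \<in> move_eq G L \<Longrightarrow> (v, u) \<in> move_eq G L"
  using equiv_move_eq[of G L] by (auto simp: equiv_def dest: symD)

lemma move_eq_in_context:
  assumes "(u, v) \<in> move_eq G L" "set a \<subseteq> commutators G" "set b \<subseteq> commutators G"
  shows "(a @ u @ b, a @ v @ b) \<in> move_eq G L"
  using assms(1) unfolding move_eq_def
proof (induction rule: rtrancl_induct)
  case (step y z)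
  then obtain a' b' u' v' where "y = a' @ u' @ b'" "z = a' @ v' @ b'"
    "set (a' @ b' @ u' @ v') \<subseteq> commutators G" "length u' \<le> L" "length v' \<le> L" "wprod G u' = wprod G v'"
    by (auto simp: short_moves_def)
  then have "(a @ y @ b, a @ z @ b) \<in> move_eq G L"
    using move_eqI[of "a @ a'" "b' @ b" u' v' G L] assms by simp
  then show ?case using step.IH unfolding move_eq_def by simp
qed simp

lemma move_eq_append:
  assumes "(u, u') \<in> move_eq G L" "(v, v') \<in> move_eq G L"
    and "set u' \<subseteq> commutators G" "set v \<subseteq> commutators G"
  shows "(u @ v, u' @ v') \<in> move_eq G L"
  using move_eq_in_context[OF assms(1), of "[]" v] move_eq_in_context[OF assms(2), of u' "[]"] assms
  by (auto intro: move_eq_trans)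

lemma (in group) move_eq_wprod:
  assumes "(u, v) \<in> move_eq G L"
  shows "wprod G u = wprod G v"
  using assms unfolding move_eq_def
proof (induction rule: rtrancl_induct)
  case (step y z)
  then obtain a b u' v' where *: "y = a @ u' @ b" "z = a @ v' @ b"
    "set (a @ b @ u' @ v') \<subseteq> commutators G" "wprod G u' = wprod G v'"
    by (auto simp: short_moves_def)
  then have "set (a @ b @ u' @ v') \<subseteq> carrier G" using commutators_closed by blast
  then show ?case using * step.IH by (simp add: wprod_append)
qed simp

text \<open>The second component leaves room for the exponents added by \<open>adjoin_generator\<close>.\<close>

definition word_class :: "('a, 'b) monoid_scheme \<Rightarrow> nat \<Rightarrow> 'a list \<Rightarrow> 'a list set \<times> int list" where
  "word_class G L w = (move_eq G L `` {w}, [])"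

definition word_rep :: "('a, 'b) monoid_scheme \<Rightarrow> nat \<Rightarrow> 'a list set \<times> int list \<Rightarrow> 'a list" where
  "word_rep G L A = (SOME w. set w \<subseteq> commutators G \<and> A = word_class G L w)"

text \<open>This is the group \<Gamma> of symbols modulo short relations. Classes are multiplied
  through chosen representatives; by \<open>word_group_mult\<close> the choice does not
  matter.\<close>

definition word_group :: "('a, 'b) monoid_scheme \<Rightarrow> nat \<Rightarrow> ('a list set \<times> int list) monoid" where
  "word_group G L = \<lparr>carrier = word_class G L ` {w. set w \<subseteq> commutators G},
     monoid.mult = (\<lambda>A B. word_class G L (word_rep G L A @ word_rep G L B)),
     one = word_class G L []\<rparr>"

lemma word_class_eq_iff: "word_class G L u = word_class G L v \<longleftrightarrow> (u, v) \<in> move_eq G L"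
  by (simp add: word_class_def eq_equiv_class_iff[OF equiv_move_eq])

lemma word_rep:
  assumes "set w \<subseteq> commutators G"
  shows "set (word_rep G L (word_class G L w)) \<subseteq> commutators G"
    "(word_rep G L (word_class G L w), w) \<in> move_eq G L"
proof -
  let ?P = "\<lambda>u. set u \<subseteq> commutators G \<and> word_class G L w = word_class G L u"
  have "?P (word_rep G L (word_class G L w))"
    unfolding word_rep_def by (rule someI[of ?P w]) (use assms in simp)
  then show "set (word_rep G L (word_class G L w)) \<subseteq> commutators G"
    "(word_rep G L (word_class G L w), w) \<in> move_eq G L"
    by (auto simp: word_class_eq_iff intro: move_eq_sym)
qed

lemma word_group_mult:
  assumes "set u \<subseteq> commutators G" "set v \<subseteq> commutators G"
  shows "word_class G L u \<otimes>\<^bsub>word_group G L\<^esub> word_class G L v = word_class G L (u @ v)"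
  using word_rep[OF assms(1), of L] word_rep[OF assms(2), of L] assms
  by (simp add: word_group_def word_class_eq_iff move_eq_append)

lemma word_group_carrierE:
  assumes "x \<in> carrier (word_group G L)"
  obtains w where "x = word_class G L w" "set w \<subseteq> commutators G"
  using assms by (auto simp: word_group_def)

lemma word_class_in_word_group: "set w \<subseteq> commutators G \<Longrightarrow> word_class G L w \<in> carrier (word_group G L)"
  by (simp add: word_group_def)

lemma word_group_one: "\<one>\<^bsub>word_group G L\<^esub> = word_class G L []"
  by (simp add: word_group_def)

context group
begin

lemma move_eq_inverse:
  assumes "set w \<subseteq> commutators G" "2 \<le> L"
  shows "(rev (map (m_inv G) w) @ w, []) \<in> move_eq G L"
  using assms(1)
proof (induction w)
  case (Cons x w)
  have "(rev (map (m_inv G) w) @ [inv x, x] @ w, rev (map (m_inv G) w) @ [] @ w) \<in> move_eq G L"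
    using Cons.prems assms(2) by (intro move_eqI) (auto dest: commutators_closed)
  then show ?case using Cons by (auto intro: move_eq_trans)
qed (simp add: move_eq_refl)

lemma group_word_group:
  assumes "2 \<le> L"
  shows "group (word_group G L)"
proof (rule groupI)
  fix x assume "x \<in> carrier (word_group G L)"
  then obtain w where x: "x = word_class G L w" and w: "set w \<subseteq> commutators G"
    by (rule word_group_carrierE)
  have "set (rev (map (m_inv G) w)) \<subseteq> commutators G" using w by auto
  then show "\<exists>y\<in>carrier (word_group G L). y \<otimes>\<^bsub>word_group G L\<^esub> x = \<one>\<^bsub>word_group G L\<^esub>"
    using w move_eq_inverse[OF w assms] unfolding x
    by (intro bexI[of _ "word_class G L (rev (map (m_inv G) w))"])
      (auto simp: word_group_mult word_group_one word_class_eq_iff word_class_in_word_group)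
qed (auto elim!: word_group_carrierE simp: word_group_mult word_group_one word_class_in_word_group)

text \<open>The letter \<open>s\<close> travels left through \<open>w\<close> by x s = (x s x^-1) x,
  a relation with two letters on each side.\<close>

lemma move_eq_conj:
  assumes "set w \<subseteq> commutators G" "s \<in> commutators G" "2 \<le> L"
  shows "(w @ [s], gconj G (wprod G w) s # w) \<in> move_eq G L"
  using assms(1)
proof (induction w)
  case Nil
  then show ?case using assms commutators_closed by (simp add: move_eq_refl)
next
  case (Cons x w)
  have c: "x \<in> carrier G" "s \<in> carrier G" "wprod G w \<in> carrier G"
    using Cons.prems assms by (auto simp: wprod_commutators_closed commutators_closed)
  have "(x # w @ [s], x # gconj G (wprod G w) s # w) \<in> move_eq G L"
    using move_eq_in_context[OF Cons.IH, of "[x]" "[]"] Cons.prems by simp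
  also have "(x # gconj G (wprod G w) s # w, gconj G (x \<otimes> wprod G w) s # x # w) \<in> move_eq G L"
    using move_eqI[of "[]" w "[x, gconj G (wprod G w) s]" "[gconj G (x \<otimes> wprod G w) s, x]" G L]
      Cons.prems assms c by (simp add: gconj_mult gconj_mult_self)
  finally show ?case by simp
qed

text \<open>Induction along \<open>v\<close> with [u, s v] = [u, s] (s [u, v] s^-1). Relations with
  at most two letters on each side thus already force \<open>mult_swap\<close> for words of any
  length.\<close>

lemma move_eq_swap:
  assumes "set u \<subseteq> commutators G" "set v \<subseteq> commutators G" "2 \<le> L"
  shows "(u @ v, gcomm G (wprod G u) (wprod G v) # v @ u) \<in> move_eq G L"
  using assms(2)
proof (induction v)
  case Nil
  have "([] @ [] @ u, [] @ [\<one>] @ u) \<in> move_eq G L"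
    using assms by (intro move_eqI) auto
  then show ?case using assms(1) by (simp add: wprod_commutators_closed)
next
  case (Cons s v)
  let ?u = "wprod G u" and ?v = "wprod G v"
  have s: "s \<in> commutators G" and v: "set v \<subseteq> commutators G" using Cons.prems by auto
  have c: "s \<in> carrier G" "?u \<in> carrier G" "?v \<in> carrier G"
    using s v assms by (auto simp: wprod_commutators_closed commutators_closed)
  have "(u @ s # v, gconj G ?u s # u @ v) \<in> move_eq G L"
    using move_eq_in_context[OF move_eq_conj[OF assms(1) s assms(3)], of "[]" v] v by simp
  also have "(gconj G ?u s # u @ v, gconj G ?u s # gcomm G ?u ?v # v @ u) \<in> move_eq G L"
    using move_eq_in_context[OF Cons.IH[OF v], of "[gconj G ?u s]" "[]"] s c by simp
  also have "(gconj G ?u s # gcomm G ?u ?v # v @ u, gcomm G ?u s # s # gcomm G ?u ?v # v @ u) \<in> move_eq G L"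
    using move_eqI[of "[]" "gcomm G ?u ?v # v @ u" "[gconj G ?u s]" "[gcomm G ?u s, s]" G L] s v c assms
    by (simp add: gcomm_mult_eq_gconj)
  also have "(gcomm G ?u s # s # gcomm G ?u ?v # v @ u,
      gcomm G ?u s # gconj G s (gcomm G ?u ?v) # s # v @ u) \<in> move_eq G L"
    using move_eqI[of "[gcomm G ?u s]" "v @ u" "[s, gcomm G ?u ?v]" "[gconj G s (gcomm G ?u ?v), s]" G L]
      s v c assms by (simp add: gconj_mult_self)
  also have "(gcomm G ?u s # gconj G s (gcomm G ?u ?v) # s # v @ u,
      gcomm G ?u (s \<otimes> ?v) # s # v @ u) \<in> move_eq G L"
    using move_eqI[of "[]" "s # v @ u" "[gcomm G ?u s, gconj G s (gcomm G ?u ?v)]" "[gcomm G ?u (s \<otimes> ?v)]" G L]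
      s v c assms by (simp add: gcomm_mult_right[symmetric])
  finally show ?case by simp
qed

text \<open>The start of the iterated extension; its two commutation rules are
  \<open>move_eq_conj\<close> and \<open>move_eq_swap\<close>.\<close>

lemma symbol_extension_word_group:
  assumes L: "2 \<le> L"
  shows "symbol_extension G (word_group G L) (\<lambda>s. word_class G L [s]) (\<lambda>A. wprod G (word_rep G L A))"
proof -
  interpret W: group "word_group G L" using L by (rule group_word_group)
  have proj: "wprod G (word_rep G L (word_class G L w)) = wprod G w"
    if "set w \<subseteq> commutators G" for w
    using move_eq_wprod[OF word_rep(2)[OF that]] .
  show ?thesis
  proof unfold_locales
    show "(\<lambda>A. wprod G (word_rep G L A)) \<in> hom (word_group G L) G"
    proof (rule homI)
      fix x y assume "x \<in> carrier (word_group G L)" "y \<in> carrier (word_group G L)"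
      then obtain u v where "x = word_class G L u" "y = word_class G L v"
        "set u \<subseteq> commutators G" "set v \<subseteq> commutators G" by (metis word_group_carrierE)
      moreover from this have "set u \<subseteq> carrier G" "set v \<subseteq> carrier G"
        using commutators_closed by blast+
      ultimately show "wprod G (word_rep G L (x \<otimes>\<^bsub>word_group G L\<^esub> y)) =
          wprod G (word_rep G L x) \<otimes> wprod G (word_rep G L y)"
        by (simp add: word_group_mult proj wprod_append)
    qed (auto elim!: word_group_carrierE simp: proj wprod_commutators_closed)
  next
    fix a b c d assume "a \<in> commutators G" "b \<in> commutators G" "c \<in> commutators G"
      "d \<in> commutators G" "a \<otimes> b = c \<otimes> d"
    then show "word_class G L [a] \<otimes>\<^bsub>word_group G L\<^esub> word_class G L [b] =
        word_class G L [c] \<otimes>\<^bsub>word_group G L\<^esub> word_class G L [d]"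
      using move_eqI[of "[]" "[]" "[a, b]" "[c, d]" G L] L
      by (simp add: word_group_mult word_class_eq_iff commutators_closed)
  next
    show "word_class G L [\<one>] = \<one>\<^bsub>word_group G L\<^esub>"
      using move_eqI[of "[]" "[]" "[\<one>]" "[]" G L] L
      by (simp add: word_group_one word_class_eq_iff)
  next
    fix e s assume "e \<in> carrier (word_group G L)" and s: "s \<in> commutators G"
    then show "e \<otimes>\<^bsub>word_group G L\<^esub> word_class G L [s] =
        word_class G L [gconj G (wprod G (word_rep G L e)) s] \<otimes>\<^bsub>word_group G L\<^esub> e"
      using move_eq_conj[OF _ s L] s
      by (auto elim!: word_group_carrierE simp: proj word_group_mult word_class_eq_iff
          wprod_commutators_closed)
  next
    fix e e' assume "e \<in> carrier (word_group G L)" "e' \<in> carrier (word_group G L)"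
    then show "e \<otimes>\<^bsub>word_group G L\<^esub> e' =
        word_class G L [gcomm G (wprod G (word_rep G L e)) (wprod G (word_rep G L e'))]
          \<otimes>\<^bsub>word_group G L\<^esub> (e' \<otimes>\<^bsub>word_group G L\<^esub> e)"
      using move_eq_swap[OF _ _ L]
      by (auto elim!: word_group_carrierE simp: proj word_group_mult word_class_eq_iff
          wprod_commutators_closed)
  qed (auto simp: proj commutators_closed word_class_in_word_group)
qed

lemma wprod_word_group:
  "set w \<subseteq> commutators G \<Longrightarrow> wprod (word_group G L) (map (\<lambda>s. word_class G L [s]) w) = word_class G L w"
  by (induction w) (auto simp: word_group_one word_group_mult)

text \<open>In such an \<open>E\<close> the triviality of a word modulo moves can be tested, and the
  generators of a free group over \<open>G\<close> have somewhere to go.\<close>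

definition faithful_lifts ::
    "nat \<Rightarrow> nat \<Rightarrow> (nat \<Rightarrow> 'a) \<Rightarrow> 'e monoid \<Rightarrow> ('a \<Rightarrow> 'e) \<Rightarrow> ('e \<Rightarrow> 'a) \<Rightarrow> (nat \<Rightarrow> 'e) \<Rightarrow> bool" where
  "faithful_lifts L n t E j \<pi> \<epsilon> \<longleftrightarrow> symbol_extension G E j \<pi> \<and>
    (\<forall>w. set w \<subseteq> commutators G \<longrightarrow> (wprod E (map j w) = \<one>\<^bsub>E\<^esub> \<longleftrightarrow> (w, []) \<in> move_eq G L)) \<and>
    (\<forall>i<n. \<epsilon> i \<in> carrier E \<and> \<pi> (\<epsilon> i) = t i)"

text \<open>One semidirect product per generator, starting from \<Gamma>. The new exponent is put in
  front of the integer list, so the type stays the same throughout the induction.\<close>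

lemma exists_faithful_lifts:
  assumes L: "2 \<le> L" and t: "\<And>i. i < n \<Longrightarrow> t i \<in> carrier G"
  shows "\<exists>(E :: ('a list set \<times> int list) monoid) j \<pi> \<epsilon>. faithful_lifts L n t E j \<pi> \<epsilon>"
  using t
proof (induction n)
  case 0
  have "faithful_lifts L 0 t (word_group G L) (\<lambda>s. word_class G L [s])
      (\<lambda>A. wprod G (word_rep G L A)) \<epsilon>" for \<epsilon>
    using symbol_extension_word_group[OF L]
    by (auto simp: faithful_lifts_def wprod_word_group word_group_one word_class_eq_iff)
  then show ?case by blast
next
  case (Suc n)
  then obtain E :: "('a list set \<times> int list) monoid" and j \<pi> \<epsilon>
    where E: "faithful_lifts L n t E j \<pi> \<epsilon>"
    by (meson less_SucI)
  interpret symbol_extension G E j \<pi> using E by (simp add: faithful_lifts_def)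
  interpret adjoin_generator G E j \<pi> "t n" "\<lambda>e k. (fst e, k # snd e)"
    "\<lambda>e. (fst e, tl (snd e))" "\<lambda>e. hd (snd e)"
    by unfold_locales (auto simp: Suc.prems)
  let ?mk = "\<lambda>(e :: 'a list set \<times> int list) k. (fst e, k # snd e)"
  \<comment> \<open>Old lifts get exponent 0; the new generator has trivial
    \<open>E\<close>-component and exponent 1, so it projects to \<open>t n\<close>.\<close>
  let ?\<epsilon> = "\<lambda>i. if i < n then ?mk (\<epsilon> i) 0 else ?mk \<one>\<^bsub>E\<^esub> 1"
  have mk: "?mk e k \<in> carrier semidirect" if "e \<in> carrier E" for e k
    using that by (simp only: mk_in_semidirect)
  have "wprod semidirect (map (\<lambda>s. ?mk (j s) 0) w) = \<one>\<^bsub>semidirect\<^esub> \<longleftrightarrow> (w, []) \<in> move_eq G L"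
    if "set w \<subseteq> commutators G" for w
    using E that unfolding faithful_lifts_def wprod_semidirect[OF that] semidirect_one mk_eq_iff by simp
  moreover have "?\<epsilon> i \<in> carrier semidirect \<and> \<pi> (fst (?\<epsilon> i), tl (snd (?\<epsilon> i))) \<otimes> t n [^] hd (snd (?\<epsilon> i)) = t i"
    if "i < Suc n" for i
  proof (cases "i < n")
    case True
    then have "\<epsilon> i \<in> carrier E" "\<pi> (\<epsilon> i) = t i" using E by (auto simp: faithful_lifts_def)
    then show ?thesis using True Suc.prems[OF that] mk by simp
  next
    case False
    then have "i = n" using that by simp
    then show ?thesis using Suc.prems[OF that] mk by simp
  qed
  ultimately have "faithful_lifts L (Suc n) t semidirect (\<lambda>s. ?mk (j s) 0)
      (\<lambda>x. \<pi> (fst x, tl (snd x)) \<otimes> t n [^] hd (snd x)) ?\<epsilon>"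
    unfolding faithful_lifts_def using symbol_extension_semidirect by simp
  then show ?case by blast
qed

end

section \<open>Subgroups of free abelian groups\<close>

definition int_subgroup :: "(nat \<Rightarrow> int) set \<Rightarrow> bool" where
  "int_subgroup H \<longleftrightarrow> (\<lambda>_. 0) \<in> H \<and> (\<forall>f\<in>H. \<forall>g\<in>H. (\<lambda>i. f i - g i) \<in> H)"

lemma int_subgroup_add:
  assumes "int_subgroup H" "f \<in> H" "g \<in> H"
  shows "(\<lambda>i. f i + g i) \<in> H"
proof -
  have *: "(\<lambda>i. u i - v i) \<in> H" if "u \<in> H" "v \<in> H" for u v
    using assms(1) that by (simp add: int_subgroup_def)
  have "(\<lambda>i. f i - (0 - g i)) \<in> H"
    using *[OF assms(2) *[OF _ assms(3), of "\<lambda>_. 0"]] assms(1) by (simp add: int_subgroup_def)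
  then show ?thesis by simp
qed

lemma int_subgroup_mult:
  assumes H: "int_subgroup H" "f \<in> H"
  shows "(\<lambda>i. q * f i) \<in> H"
proof -
  have *: "(\<lambda>i. int n * f i) \<in> H" for n
  proof (induction n)
    case 0
    then show ?case using H by (simp add: int_subgroup_def)
  next
    case (Suc n)
    then show ?case using int_subgroup_add[OF H(1) H(2) Suc] by (simp add: algebra_simps)
  qed
  show ?thesis
  proof (cases "0 \<le> q")
    case True
    then show ?thesis using *[of "nat q"] by simp
  next
    case False
    have "(\<lambda>i. 0 - int (nat (- q)) * f i) \<in> H"
      using H *[of "nat (- q)"] unfolding int_subgroup_def by fast
    then show ?thesis using False by simp
  qed
qed

text \<open>Induction on the number of coordinates: an element with least nonzero last coordinate
  reduces every other one, by division with remainder, to the subgroup where this coordinate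
  vanishes. Generation is expressed through all subgroups containing \<open>B\<close>, ready to be
  applied to the kernel of a homomorphism.\<close>

lemma int_subgroup_finitely_generated:
  assumes "int_subgroup H" "\<And>f i. f \<in> H \<Longrightarrow> m \<le> i \<Longrightarrow> f i = 0"
  shows "\<exists>B. finite B \<and> B \<subseteq> H \<and> (\<forall>K. int_subgroup K \<longrightarrow> B \<subseteq> K \<longrightarrow> H \<subseteq> K)"
  using assms
proof (induction m arbitrary: H)
  case 0
  have "f = (\<lambda>_. 0)" if "f \<in> H" for f using 0(2)[OF that] by auto
  then show ?case by (intro exI[of _ "{}"]) (auto simp: int_subgroup_def)
next
  case (Suc m)
  define H0 where "H0 = {f \<in> H. f m = 0}"
  have "int_subgroup H0" using Suc.prems by (auto simp: H0_def int_subgroup_def)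
  moreover have "f i = 0" if "f \<in> H0" "m \<le> i" for f i
    using Suc.prems(2)[of f i] that by (cases "i = m") (auto simp: H0_def)
  ultimately obtain B where B: "finite B" "B \<subseteq> H0"
    "\<And>K. int_subgroup K \<Longrightarrow> B \<subseteq> K \<Longrightarrow> H0 \<subseteq> K"
    using Suc.IH by meson
  show ?case
  proof (cases "H0 = H")
    case True
    then show ?thesis using B by blast
  next
    case False
    then obtain g where "g \<in> H" "g m \<noteq> 0" by (auto simp: H0_def)
    then obtain b where b: "b \<in> H" "b m \<noteq> 0"
      and min: "\<And>f. f \<in> H \<Longrightarrow> f m \<noteq> 0 \<Longrightarrow> nat \<bar>b m\<bar> \<le> nat \<bar>f m\<bar>"
      using ex_has_least_nat[of "\<lambda>g. g \<in> H \<and> g m \<noteq> 0" g "\<lambda>g. nat \<bar>g m\<bar>"] by auto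
    have "H \<subseteq> K" if K: "int_subgroup K" "insert b B \<subseteq> K" for K
    proof
      fix f assume f: "f \<in> H"
      define q where "q = f m div b m"
      let ?r = "\<lambda>i. f i - q * b i"
      have r: "?r \<in> H"
        using f int_subgroup_mult[OF Suc.prems(1) b(1), of q] Suc.prems(1)
        by (simp add: int_subgroup_def)
      have "?r m = f m mod b m" by (simp add: q_def minus_div_mult_eq_mod)
      then have "\<bar>?r m\<bar> < \<bar>b m\<bar>" using b(2) by (simp add: abs_mod_less)
      then have "?r m = 0" using min[OF r] by (cases "?r m = 0") auto
      then have "?r \<in> K" using B(3)[OF K(1)] K(2) r by (auto simp: H0_def)
      then have "(\<lambda>i. ?r i + q * b i) \<in> K"
        using K(2) by (intro int_subgroup_add[OF K(1)] int_subgroup_mult[OF K(1)]) auto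
      then show "f \<in> K" by simp
    qed
    then show ?thesis using B(1,2) b(1)
      by (intro exI[of _ "insert b B"]) (auto simp: H0_def)
  qed
qed

section \<open>Power products of central elements\<close>

primrec power_product :: "('a, 'b) monoid_scheme \<Rightarrow> (nat \<Rightarrow> 'a) \<Rightarrow> nat \<Rightarrow> (nat \<Rightarrow> int) \<Rightarrow> 'a" where
  "power_product G z 0 h = \<one>\<^bsub>G\<^esub>"
| "power_product G z (Suc m) h = power_product G z m h \<otimes>\<^bsub>G\<^esub> z m [^]\<^bsub>G\<^esub> h m"

definition center :: "('a, 'b) monoid_scheme \<Rightarrow> 'a set" where
  "center G = {z \<in> carrier G. \<forall>x\<in>carrier G. z \<otimes>\<^bsub>G\<^esub> x = x \<otimes>\<^bsub>G\<^esub> z}"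

context group
begin

lemma power_product_closed [simp]:
  "(\<And>i. i < m \<Longrightarrow> z i \<in> carrier G) \<Longrightarrow> power_product G z m h \<in> carrier G"
  by (induction m) auto

lemma subgroup_center: "subgroup (center G) G"
proof (rule subgroupI)
  fix a b assume "a \<in> center G" "b \<in> center G"
  then have c: "a \<in> carrier G" "b \<in> carrier G"
    and a: "\<And>x. x \<in> carrier G \<Longrightarrow> a \<otimes> x = x \<otimes> a"
    and b: "\<And>x. x \<in> carrier G \<Longrightarrow> b \<otimes> x = x \<otimes> b"
    by (auto simp: center_def)
  have "a \<otimes> b \<otimes> x = x \<otimes> (a \<otimes> b)" if x: "x \<in> carrier G" for x
    by (simp only: m_assoc[OF c x] b[OF x] m_assoc[OF c(1) x c(2), symmetric] a[OF x] m_assoc[OF x c])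
  then show "a \<otimes> b \<in> center G"
    using c by (simp add: center_def)
next
  fix a assume "a \<in> center G"
  then have a: "a \<in> carrier G" and comm: "\<And>x. x \<in> carrier G \<Longrightarrow> a \<otimes> x = x \<otimes> a"
    by (auto simp: center_def)
  have "inv a \<otimes> x = x \<otimes> inv a" if x: "x \<in> carrier G" for x
  proof -
    have "inv a \<otimes> x = inv a \<otimes> (x \<otimes> a) \<otimes> inv a" using a x by (simp add: m_assoc)
    also have "\<dots> = inv a \<otimes> (a \<otimes> x) \<otimes> inv a" using comm[OF x] by simp
    also have "\<dots> = x \<otimes> inv a" using a x by (simp add: m_assoc)
    finally show ?thesis .
  qed
  then show "inv a \<in> center G" using a by (simp add: center_def)
qed (auto simp: center_def)

lemma int_pow_center: "z \<in> center G \<Longrightarrow> z [^] (k::int) \<in> center G"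
  using subgroup_center by (rule subgroup_int_pow_closed)

lemma power_product_add:
  assumes "\<And>i. i < m \<Longrightarrow> z i \<in> center G"
  shows "power_product G z m (\<lambda>i. h i + h' i) = power_product G z m h \<otimes> power_product G z m h'"
  using assms
proof (induction m)
  case (Suc m)
  have z: "z m \<in> carrier G" "\<And>i. i < m \<Longrightarrow> z i \<in> carrier G"
    using Suc.prems by (auto simp: center_def)
  have "z m [^] h m \<otimes> power_product G z m h' = power_product G z m h' \<otimes> z m [^] h m"
    using int_pow_center[of "z m" "h m"] Suc.prems[of m] z by (auto simp: center_def)
  then have "z m [^] h m \<otimes> (power_product G z m h' \<otimes> z m [^] h' m) =
      power_product G z m h' \<otimes> (z m [^] h m \<otimes> z m [^] h' m)"
    using z by (simp add: m_assoc[symmetric])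
  then show ?case using Suc z by (simp add: int_pow_mult m_assoc)
qed simp

lemma power_product_zero [simp]:
  "(\<And>i. i < m \<Longrightarrow> z i \<in> carrier G) \<Longrightarrow> power_product G z m (\<lambda>_. 0) = \<one>"
  by (induction m) auto

lemma power_product_uminus:
  assumes "\<And>i. i < m \<Longrightarrow> z i \<in> center G"
  shows "power_product G z m (\<lambda>i. - h i) = inv (power_product G z m h)"
proof -
  have z: "z i \<in> carrier G" if "i < m" for i using assms that by (auto simp: center_def)
  have "power_product G z m (\<lambda>i. - h i) \<otimes> power_product G z m h = \<one>"
    using power_product_add[of m z "\<lambda>i. - h i" h] assms z by simp
  then show ?thesis using z by (metis inv_equality power_product_closed)
qed

lemma power_product_diff:
  assumes "\<And>i. i < m \<Longrightarrow> z i \<in> center G"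
  shows "power_product G z m (\<lambda>i. h i - h' i) = power_product G z m h \<otimes> inv (power_product G z m h')"
  using power_product_add[of m z h "\<lambda>i. - h' i"] power_product_uminus[of m z h'] assms by simp

lemma power_product_unit:
  assumes "\<And>i. i < m \<Longrightarrow> z i \<in> carrier G" "i < m"
  shows "power_product G z m (\<lambda>k. if k = i then 1 else 0) = z i"
  using assms
proof (induction m)
  case (Suc m)
  show ?case
  proof (cases "i = m")
    case True
    have "power_product G z n (\<lambda>k. if k = m then 1 else 0) = \<one>" if "n \<le> m" for n
      using that Suc.prems(1) by (induction n) auto
    then show ?thesis using True Suc.prems by simp
  qed (use Suc in auto)
qed simp

end

lemma power_product_hom:
  assumes f: "f \<in> hom G H" "group G" "group H" and z: "\<And>i. i < m \<Longrightarrow> z i \<in> carrier G"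
  shows "f (power_product G z m h) = power_product H (\<lambda>i. f (z i)) m h"
  using z
proof (induction m)
  case 0
  then show ?case using hom_one[OF f] by simp
next
  case (Suc m)
  have "power_product G z m h \<in> carrier G"
    using group.power_product_closed[OF f(2)] Suc.prems by simp
  then show ?case
    using Suc hom_mult[OF f(1)] hom_int_pow[OF f(1) _ f(2,3)] group.int_pow_closed[OF f(2)]
    by simp
qed

section \<open>Homomorphisms from free groups\<close>

definition letter_value :: "('a, 'b) monoid_scheme \<Rightarrow> ('g \<Rightarrow> 'a) \<Rightarrow> bool \<times> 'g \<Rightarrow> 'a" where
  "letter_value G \<epsilon> a = (if fst a then \<epsilon> (snd a) else inv\<^bsub>G\<^esub> \<epsilon> (snd a))"

definition free_lift :: "('a, 'b) monoid_scheme \<Rightarrow> ('g \<Rightarrow> 'a) \<Rightarrow> 'g word \<Rightarrow> 'a" where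
  "free_lift G \<epsilon> w = wprod G (map (letter_value G \<epsilon>) w)"

context group
begin

lemma letter_value_closed: "\<epsilon> (snd a) \<in> carrier G \<Longrightarrow> letter_value G \<epsilon> a \<in> carrier G"
  by (simp add: letter_value_def)

lemma free_lift_closed:
  "(\<And>x. x \<in> X \<Longrightarrow> \<epsilon> x \<in> carrier G) \<Longrightarrow> snd ` set w \<subseteq> X \<Longrightarrow> free_lift G \<epsilon> w \<in> carrier G"
  unfolding free_lift_def by (rule wprod_closed) (auto intro!: letter_value_closed)

lemma free_lift_push_letter:
  assumes \<epsilon>: "\<And>x. x \<in> X \<Longrightarrow> \<epsilon> x \<in> carrier G" and "snd a \<in> X" "snd ` set w \<subseteq> X"
  shows "free_lift G \<epsilon> (push_letter a w) = letter_value G \<epsilon> a \<otimes> free_lift G \<epsilon> w"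
proof (cases w)
  case (Cons b w')
  have "free_lift G \<epsilon> w' \<in> carrier G"
    using assms by (intro free_lift_closed[OF \<epsilon>]) (auto simp: Cons)
  moreover have "\<epsilon> (snd a) \<in> carrier G" using assms by simp
  ultimately show ?thesis
    by (auto simp: Cons free_lift_def letter_value_def inv_letter_def)
qed (simp add: free_lift_def)

lemma free_lift_foldr_push:
  assumes \<epsilon>: "\<And>x. x \<in> X \<Longrightarrow> \<epsilon> x \<in> carrier G" and "snd ` set u \<subseteq> X" "snd ` set v \<subseteq> X"
  shows "free_lift G \<epsilon> (foldr push_letter u v) = free_lift G \<epsilon> u \<otimes> free_lift G \<epsilon> v"
  using assms(2)
proof (induction u)
  case Nil
  then show ?case using free_lift_closed[OF \<epsilon> assms(3)] by (simp add: free_lift_def)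
next
  case (Cons a u)
  have c: "free_lift G \<epsilon> u \<in> carrier G" "free_lift G \<epsilon> v \<in> carrier G" "letter_value G \<epsilon> a \<in> carrier G"
    using Cons.prems assms(3)
    by (auto intro!: free_lift_closed[OF \<epsilon>] letter_value_closed \<epsilon>)
  have "snd ` set (foldr push_letter u v) \<subseteq> X"
    using set_foldr_push[of u v] Cons.prems assms(3) by (auto dest!: subsetD)
  then show ?case
    using Cons c free_lift_push_letter[of X \<epsilon> a "foldr push_letter u v"] \<epsilon>
    by (simp add: m_assoc) (simp add: free_lift_def m_assoc)
qed

lemma free_lift_hom:
  assumes "\<And>x. x \<in> X \<Longrightarrow> \<epsilon> x \<in> carrier G"
  shows "free_lift G \<epsilon> \<in> hom (free_group X) G"
  using free_lift_closed[OF assms] free_lift_foldr_push[OF assms]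
  by (intro homI) (auto simp: free_group_def)

end

text \<open>A reduced word is its first letter times the rest, so the images of the generators
  decide everything. This serves to compare the projected lift with the presentation map.\<close>

lemma hom_eq_free_lift:
  assumes G: "group G" and \<phi>: "\<phi> \<in> hom (free_group X) G" and w: "w \<in> carrier (free_group X)"
  shows "\<phi> w = free_lift G (\<lambda>x. \<phi> [(True, x)]) w"
proof -
  interpret G: group G by fact
  interpret F: group "free_group X" by (rule group_free_group)
  have letter: "[(b, x)] \<in> carrier (free_group X)" if "x \<in> X" for b x
    using that by (simp add: free_group_def reduced_Cons)
  have inv: "\<phi> [(False, x)] = inv\<^bsub>G\<^esub> \<phi> [(True, x)]" if "x \<in> X" for x
  proof -
    have "[(False, x)] \<otimes>\<^bsub>free_group X\<^esub> [(True, x)] = \<one>\<^bsub>free_group X\<^esub>"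
      by (simp add: free_group_def inv_letter_def)
    then have "\<phi> [(False, x)] \<otimes>\<^bsub>G\<^esub> \<phi> [(True, x)] = \<one>\<^bsub>G\<^esub>"
      using hom_mult[OF \<phi> letter letter] hom_one[OF \<phi> F.is_group G] that by metis
    then show ?thesis
      using hom_in_carrier[OF \<phi> letter] that by (metis G.inv_equality)
  qed
  show ?thesis using w
  proof (induction w)
    case Nil
    then show ?case using hom_one[OF \<phi> F.is_group G] by (simp add: free_group_def free_lift_def)
  next
    case (Cons a w)
    then have a: "snd a \<in> X" and w: "w \<in> carrier (free_group X)" and r: "reduced_word (a # w)"
      by (auto simp: free_group_def reduced_Cons)
    have "[a] \<otimes>\<^bsub>free_group X\<^esub> w = a # w"
      using r by (cases w) (auto simp: free_group_def reduced_Cons)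
    then have "\<phi> (a # w) = \<phi> [a] \<otimes>\<^bsub>G\<^esub> \<phi> w"
      using hom_mult[OF \<phi> letter[OF a, of "fst a"] w] by simp
    moreover have "\<phi> [a] = letter_value G (\<lambda>x. \<phi> [(True, x)]) a"
      using inv[OF a] by (cases a) (auto simp: letter_value_def)
    ultimately show ?case using Cons.IH[OF w] by (simp add: free_lift_def)
  qed
qed

section \<open>Normal closures and the epimorphism of a presentation\<close>

lemma normal_normal_closure:
  assumes "group F" "R \<subseteq> carrier F"
  shows "normal_closure F R \<lhd> F" "R \<subseteq> normal_closure F R"
proof -
  interpret group F by fact
  show "normal_closure F R \<lhd> F"
    unfolding normal_inv_iff
  proof (intro conjI ballI)
    show "subgroup (normal_closure F R) F"
      unfolding normal_closure_def using normal_self assms(2)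
      by (intro subgroups_Inter) (auto dest: normal_imp_subgroup)
  next
    fix x h assume "x \<in> carrier F" "h \<in> normal_closure F R"
    then show "x \<otimes>\<^bsub>F\<^esub> h \<otimes>\<^bsub>F\<^esub> inv\<^bsub>F\<^esub> x \<in> normal_closure F R"
      by (auto simp: normal_closure_def normal_inv_iff)
  qed
qed (auto simp: normal_closure_def)

text \<open>The map \<phi> is the quotient map followed by the inverse of the given isomorphism; its
  kernel is found by comparing cosets with \<open>N\<close>.\<close>

lemma finitely_presented_epimorphism:
  assumes "finitely_presented G"
  obtains n R \<phi> where "finite R" "R \<subseteq> carrier (free_group {..<n::nat})"
    "\<phi> \<in> hom (free_group {..<n}) G" "\<phi> ` carrier (free_group {..<n}) = carrier G"
    "\<And>x. x \<in> R \<Longrightarrow> \<phi> x = \<one>\<^bsub>G\<^esub>"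
    "\<And>x. x \<in> carrier (free_group {..<n}) \<Longrightarrow> \<phi> x = \<one>\<^bsub>G\<^esub> \<Longrightarrow> x \<in> normal_closure (free_group {..<n}) R"
proof -
  obtain n R where G: "group G" and R: "finite R" "R \<subseteq> carrier (free_group {..<n::nat})"
    and iso: "G \<cong> free_group {..<n} Mod normal_closure (free_group {..<n}) R"
    using assms by (auto simp: finitely_presented_def)
  define F where "F = free_group {..<n}"
  define N where "N = normal_closure F R"
  interpret G: group G by fact
  interpret F: group F unfolding F_def by (rule group_free_group)
  interpret N: normal N F
    unfolding N_def by (rule normal_normal_closure) (use R F.is_group in \<open>auto simp: F_def\<close>)
  obtain g where g: "g \<in> iso (F Mod N) G"
    using G.iso_sym iso by (auto simp: is_iso_def F_def N_def)
  then have gh: "g \<in> hom (F Mod N) G" and bij: "bij_betw g (carrier (F Mod N)) (carrier G)"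
    by (auto simp: iso_def)
  define \<phi> where "\<phi> x = g (N #>\<^bsub>F\<^esub> x)" for x
  have \<phi>: "\<phi> \<in> hom F G"
    using hom_compose[OF N.r_coset_hom_Mod gh] by (simp add: comp_def \<phi>_def[abs_def])
  have Q: "group (F Mod N)" by (rule N.factorgroup_is_group)
  have cos: "N #>\<^bsub>F\<^esub> x \<in> carrier (F Mod N)" if "x \<in> carrier F" for x
    using that by (auto simp: FactGroup_def RCOSETS_def)
  have one: "\<phi> x = \<one>\<^bsub>G\<^esub> \<longleftrightarrow> N #>\<^bsub>F\<^esub> x = N" if "x \<in> carrier F" for x
  proof -
    have "g N = \<one>\<^bsub>G\<^esub>" "N \<in> carrier (F Mod N)"
      using hom_one[OF gh Q G] group.is_monoid[OF Q, THEN monoid.one_closed] by (simp_all add: FactGroup_def)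
    then show ?thesis
      using bij cos[OF that] unfolding \<phi>_def bij_betw_def inj_on_def by metis
  qed
  have "\<phi> ` carrier F = carrier G"
    using bij by (auto simp: \<phi>_def bij_betw_def FactGroup_def RCOSETS_def image_iff)
  moreover have "\<phi> x = \<one>\<^bsub>G\<^esub>" if "x \<in> R" for x
  proof -
    have "x \<in> N" "x \<in> carrier F"
      using that normal_normal_closure(2)[OF F.is_group] R(2) by (auto simp: N_def F_def)
    then show ?thesis using one F.coset_join2[OF _ N.subgroup_axioms] by simp
  qed
  moreover have "x \<in> N" if "x \<in> carrier F" "\<phi> x = \<one>\<^bsub>G\<^esub>" for x
    using that one F.coset_join1[OF _ _ N.subgroup_axioms] by blast
  ultimately show ?thesis
    using that[of R n \<phi>] R \<phi> unfolding F_def N_def by blast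
qed

text \<open>Inverses of commutators are commutators, so words need no inverse letters.\<close>

lemma (in group) derived_imp_wprod:
  assumes "x \<in> derived G (carrier G)"
  shows "\<exists>w. set w \<subseteq> commutators G \<and> x = wprod G w"
proof -
  have sub: "set w \<subseteq> carrier G" if "set w \<subseteq> commutators G" for w
    using that commutators_closed by blast
  have "x \<in> generate G (commutators G)"
    using assms by (simp only: derived_def derived_set_eq_commutators)
  then show ?thesis
  proof (induction rule: generate.induct)
    case one
    show ?case by (intro exI[of _ "[]"]) simp
  next
    case (incl h)
    then show ?case by (intro exI[of _ "[h]"]) (simp add: commutators_closed)
  next
    case (inv h)
    then show ?case by (intro exI[of _ "[inv h]"]) (simp add: commutators_closed)
  next
    case (eng h1 h2)
    then obtain u v where "set u \<subseteq> commutators G" "h1 = wprod G u"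
      "set v \<subseteq> commutators G" "h2 = wprod G v" by blast
    then show ?case using sub by (intro exI[of _ "u @ v"]) (auto simp: wprod_append)
  qed
qed

lemma (in group) wprod_in_derived:
  "set w \<subseteq> commutators G \<Longrightarrow> wprod G w \<in> derived G (carrier G)"
  unfolding derived_def derived_set_eq_commutators
  by (induction w) (auto intro: generate.intros)


text \<open>A rearrangement of \<open>mult_swap\<close>. Commutators in \<open>E\<close> thus depend
  only on the images of the two elements in \<open>G\<close>.\<close>

lemma (in symbol_extension) gcomm_eq_sym:
  assumes "e \<in> carrier E" "e' \<in> carrier E"
  shows "gcomm E e e' = j (gcomm G (\<pi> e) (\<pi> e'))"
proof -
  have J: "j (gcomm G (\<pi> e) (\<pi> e')) \<in> carrier E" using assms by (simp add: sym_closed)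
  have "gcomm E e e' = (e \<otimes>\<^bsub>E\<^esub> e') \<otimes>\<^bsub>E\<^esub> inv\<^bsub>E\<^esub> (e' \<otimes>\<^bsub>E\<^esub> e)"
    using assms by (simp add: gcomm_def E.m_assoc E.inv_mult_group)
  also have "\<dots> = (j (gcomm G (\<pi> e) (\<pi> e')) \<otimes>\<^bsub>E\<^esub> (e' \<otimes>\<^bsub>E\<^esub> e)) \<otimes>\<^bsub>E\<^esub> inv\<^bsub>E\<^esub> (e' \<otimes>\<^bsub>E\<^esub> e)"
    using mult_swap[OF assms] by simp
  also have "\<dots> = j (gcomm G (\<pi> e) (\<pi> e'))"
    using assms J by (simp only: E.m_assoc[OF J] E.m_closed E.inv_closed E.r_inv E.r_one)
  finally show ?thesis .
qed

text \<open>For \<open>e\<close> over \<one>, the symbol in \<open>mult_swap\<close> is that of a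
  commutator with \<one>, hence trivial.\<close>

lemma (in symbol_extension) kernel_in_center:
  assumes "e \<in> carrier E" "\<pi> e = \<one>\<^bsub>G\<^esub>"
  shows "e \<in> center E"
  using assms mult_swap[OF assms(1)] by (auto simp: center_def sym_one)

lemma (in comm_group) center_eq_carrier: "center G = carrier G"
  by (auto simp: center_def m_comm)

lemma hom_m_inv:
  assumes "group G" "group H" "f \<in> hom G H" "a \<in> carrier G"
  shows "f (inv\<^bsub>G\<^esub> a) = inv\<^bsub>H\<^esub> f a"
  using group_hom.hom_inv[of G H f a] assms by (simp add: group_hom_def group_hom_axioms_def)

lemma hom_conj_center:
  assumes "group G" "group H" "f \<in> hom G H" "a \<in> carrier G" "b \<in> carrier G" "f b \<in> center H"
  shows "f (a \<otimes>\<^bsub>G\<^esub> b \<otimes>\<^bsub>G\<^esub> inv\<^bsub>G\<^esub> a) = f b"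
proof -
  interpret group_hom G H f
    using assms by (simp add: group_hom_def group_hom_axioms_def)
  have "f a \<otimes>\<^bsub>H\<^esub> f b = f b \<otimes>\<^bsub>H\<^esub> f a" using assms(4,6) by (simp add: center_def)
  then show ?thesis using assms(4,5) by (simp add: H.m_assoc)
qed

lemma hom_gcomm:
  assumes "group G" "group H" "f \<in> hom G H" "a \<in> carrier G" "b \<in> carrier G"
  shows "f (gcomm G a b) = gcomm H (f a) (f b)"
proof -
  interpret group_hom G H f
    using assms by (simp add: group_hom_def group_hom_axioms_def)
  show ?thesis using assms(4,5) by (simp add: gcomm_def)
qed

section \<open>The commutator group has a presentation with short relations\<close>

lemma lift_commutators:
  assumes "group F" "group G" "\<phi> \<in> hom F G" "\<phi> ` carrier F = carrier G" "set w \<subseteq> commutators G"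
  shows "\<exists>W. set W \<subseteq> commutators F \<and> map \<phi> W = w"
  using assms(5)
proof (induction w)
  case (Cons s w)
  then obtain W where W: "set W \<subseteq> commutators F" "map \<phi> W = w" by auto
  obtain a b where "a \<in> carrier G" "b \<in> carrier G" "s = gcomm G a b"
    using Cons.prems by (auto simp: commutators_def)
  then obtain a' b' where ab: "a' \<in> carrier F" "b' \<in> carrier F" "s = gcomm G (\<phi> a') (\<phi> b')"
    unfolding assms(4)[symmetric] by blast
  then have "s = \<phi> (gcomm F a' b')" using hom_gcomm[OF assms(1-3)] by simp
  then show ?case
    using W ab(1,2) group.gcomm_in_commutators[OF assms(1)]
    by (intro exI[of _ "gcomm F a' b' # W"]) simp
qed simp

text \<open>A concrete form of Hopf's formula. As far as the lift \<psi> and the abelianization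
  \<open>q\<close> can see, an element of the kernel of \<phi> is a product of powers of relators.
  The exponent vectors of those products that lie in [F, F] form a finitely generated group, so
  finitely many words have to be killed.\<close>

theorem short_relations:
  assumes "finitely_presented G"
  shows "\<exists>L. \<forall>w. set w \<subseteq> commutators G \<longrightarrow> wprod G w = \<one>\<^bsub>G\<^esub> \<longrightarrow> (w, []) \<in> move_eq G L"
proof -
  obtain n R \<phi> where R: "finite R" "R \<subseteq> carrier (free_group {..<n::nat})"
    and \<phi>: "\<phi> \<in> hom (free_group {..<n}) G" "\<phi> ` carrier (free_group {..<n}) = carrier G"
    and \<phi>R: "\<And>x. x \<in> R \<Longrightarrow> \<phi> x = \<one>\<^bsub>G\<^esub>"
    and ker: "\<And>x. x \<in> carrier (free_group {..<n}) \<Longrightarrow> \<phi> x = \<one>\<^bsub>G\<^esub> \<Longrightarrow> x \<in> normal_closure (free_group {..<n}) R"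
    using finitely_presented_epimorphism[OF assms] by metis
  have G: "group G" using assms by (simp add: finitely_presented_def)
  define F where "F = free_group {..<n}"
  note R = R[folded F_def] and \<phi> = \<phi>[folded F_def] and ker = ker[folded F_def]
  interpret G: group G by fact
  interpret F: group F unfolding F_def by (rule group_free_group)
  define F' where "F' = derived F (carrier F)"
  define Q where "Q = F Mod F'"
  define q where "q x = F' #>\<^bsub>F\<^esub> x" for x
  interpret F': normal F' F unfolding F'_def by (rule F.derived_self_is_normal)
  interpret Q: comm_group Q unfolding Q_def F'_def by (rule F.derived_quot_is_comm_group)
  have q: "q \<in> hom F Q" using F'.r_coset_hom_Mod by (simp add: q_def[abs_def] Q_def)
  have q1: "q x = \<one>\<^bsub>Q\<^esub> \<longleftrightarrow> x \<in> F'" if "x \<in> carrier F" for x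
    using that F.coset_join1[OF _ that F'.subgroup_axioms] F.coset_join2[OF that F'.subgroup_axioms]
    by (auto simp: q_def Q_def FactGroup_def)
  obtain m r where r: "R = r ` {i. i < (m::nat)}"
    using finite_imp_nat_seg_image_inj_on[OF R(1)] by blast
  have rF: "r i \<in> carrier F" and \<phi>r: "\<phi> (r i) = \<one>\<^bsub>G\<^esub>" if "i < m" for i
    using that R(2) \<phi>R by (auto simp: r)
  \<comment> \<open>Products of powers of relators in a fixed order, indexed by exponent vectors.
    Every element of the kernel agrees with such a product modulo [F, ker \<phi>].\<close>
  define P where "P h = power_product F r m h" for h
  define supp where "supp h \<longleftrightarrow> (\<forall>i\<ge>m. h i = (0::int))" for h
  have P: "P h \<in> carrier F" for h using rF by (simp add: P_def)
  have qP: "q (P h) = power_product Q (\<lambda>i. q (r i)) m h" for h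
    unfolding P_def by (rule power_product_hom[OF q F.is_group Q.is_group rF])
  have qr: "q (r i) \<in> center Q" if "i < m" for i
    using hom_in_carrier[OF q rF[OF that]] by (simp add: Q.center_eq_carrier)
  have qrc: "q (r i) \<in> carrier Q" if "i < m" for i
    using hom_in_carrier[OF q rF[OF that]] .
  have \<phi>P: "\<phi> (P h) = \<one>\<^bsub>G\<^esub>" for h
  proof -
    have "power_product G (\<lambda>i. \<phi> (r i)) k h = \<one>\<^bsub>G\<^esub>" if "k \<le> m" for k
      using that by (induction k) (auto simp: \<phi>r)
    then show ?thesis
      unfolding P_def using power_product_hom[OF \<phi>(1) F.is_group G rF] by simp
  qed
  \<comment> \<open>These vectors stand for the kernel intersected with [F, F], the numerator in
    Hopf's formula. The condition \<open>supp\<close> makes them vectors with \<open>m\<close>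
    coordinates.\<close>
  define H where "H = {h. supp h \<and> P h \<in> F'}"
  have "int_subgroup H"
    using qr qrc
    by (auto simp: int_subgroup_def H_def supp_def q1[OF P, symmetric] qP Q.power_product_diff)
  moreover have "f i = 0" if "f \<in> H" "m \<le> i" for f i using that by (simp add: H_def supp_def)
  ultimately have "\<exists>B. finite B \<and> B \<subseteq> H \<and> (\<forall>K. int_subgroup K \<longrightarrow> B \<subseteq> K \<longrightarrow> H \<subseteq> K)"
    by (rule int_subgroup_finitely_generated)
  then obtain B where B: "finite B" "B \<subseteq> H"
    and span: "\<And>K. int_subgroup K \<Longrightarrow> B \<subseteq> K \<Longrightarrow> H \<subseteq> K"
    by meson
  have "\<forall>b\<in>B. \<exists>w. set w \<subseteq> commutators F \<and> P b = wprod F w"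
    using B(2) F.derived_imp_wprod by (auto simp: H_def F'_def)
  then obtain W where W: "\<And>b. b \<in> B \<Longrightarrow> set (W b) \<subseteq> commutators F"
    "\<And>b. b \<in> B \<Longrightarrow> P b = wprod F (W b)"
    by metis
  \<comment> \<open>The summand 2 is what the construction of \<open>E\<close> requires; the sum
    bounds the commutator length of every generator \<open>P b\<close>.\<close>
  define L where "L = 2 + (\<Sum>b\<in>B. length (W b))"
  have LB: "length (W b) \<le> L" if "b \<in> B" for b
    using member_le_sum[of b B "\<lambda>b. length (W b)"] that B(1) by (simp add: L_def)
  define t where "t i = \<phi> [(True, i)]" for i
  have t: "t i \<in> carrier G" if "i < n" for i
    using hom_in_carrier[OF \<phi>(1), of "[(True, i)]"] that
    by (simp add: t_def F_def free_group_def reduced_Cons)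
  have "\<exists>(E :: ('a list set \<times> int list) monoid) j \<pi> \<epsilon>. G.faithful_lifts L n t E j \<pi> \<epsilon>"
    by (rule G.exists_faithful_lifts) (use t in \<open>simp_all add: L_def\<close>)
  then obtain E :: "('a list set \<times> int list) monoid" and j \<pi> \<epsilon>
    where E: "G.faithful_lifts L n t E j \<pi> \<epsilon>"
    by blast
  interpret E: symbol_extension G E j \<pi> using E by (simp add: G.faithful_lifts_def)
  have \<epsilon>: "\<epsilon> i \<in> carrier E" "\<pi> (\<epsilon> i) = t i" if "i < n" for i
    using E that by (auto simp: G.faithful_lifts_def)
  \<comment> \<open>\<open>E\<close> is the target of the free group, not of \<open>G\<close>:
    relators need not die in \<open>E\<close>, they only become central.\<close>
  define \<psi> where "\<psi> = free_lift E \<epsilon>"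
  have \<psi>: "\<psi> \<in> hom F E"
    unfolding \<psi>_def F_def by (rule E.E.free_lift_hom) (simp add: \<epsilon>)
  have \<psi>c: "\<psi> x \<in> carrier E" if "x \<in> carrier F" for x
    using hom_in_carrier[OF \<psi> that] .
  have \<pi>\<psi>: "\<pi> (\<psi> x) = \<phi> x" if x: "x \<in> carrier F" for x
  proof -
    have letter: "[(True, i)] \<in> carrier F" if "i < n" for i
      using that by (simp add: F_def free_group_def reduced_Cons)
    have "\<psi> [(True, i)] = \<epsilon> i" if "i < n" for i
      using \<epsilon> that by (simp add: \<psi>_def free_lift_def letter_value_def)
    have "\<pi> \<circ> \<psi> \<in> hom F G" using \<psi> E.proj_hom by (rule hom_compose)
    then have "(\<pi> \<circ> \<psi>) x = free_lift G (\<lambda>i. \<pi> (\<psi> [(True, i)])) x"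
      using hom_eq_free_lift[OF G, of "\<pi> \<circ> \<psi>" "{..<n}" x] x by (simp add: F_def)
    also have "\<dots> = free_lift G (\<lambda>i. \<phi> [(True, i)]) x"
      unfolding free_lift_def
    proof (rule arg_cong[of _ _ "wprod G"], rule map_cong)
      fix a assume "a \<in> set x"
      then have "snd a < n" using x by (auto simp: F_def free_group_def)
      then show "letter_value G (\<lambda>i. \<pi> (\<psi> [(True, i)])) a = letter_value G (\<lambda>i. \<phi> [(True, i)]) a"
        using \<epsilon>[of "snd a"] \<open>\<And>i. i < n \<Longrightarrow> \<psi> [(True, i)] = \<epsilon> i\<close>[of "snd a"]
        by (simp add: letter_value_def t_def)
    qed simp
    also have "\<dots> = \<phi> x"
      using hom_eq_free_lift[OF G, of \<phi> "{..<n}" x] x \<phi>(1) by (simp add: F_def)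
    finally show ?thesis by simp
  qed
  \<comment> \<open>Commutators of \<open>F\<close> are sent to symbols by
    \<open>gcomm_eq_sym\<close>, so a product of commutators becomes the word of symbols read off in
    \<open>G\<close>.\<close>
  have \<psi>W: "\<psi> (wprod F w) = wprod E (map j (map \<phi> w)) \<and> set (map \<phi> w) \<subseteq> commutators G
      \<and> \<phi> (wprod F w) = wprod G (map \<phi> w)"
    if "set w \<subseteq> commutators F" for w
    using that
  proof (induction w)
    case Nil
    then show ?case using hom_one[OF \<psi> F.is_group E.E.is_group] hom_one[OF \<phi>(1) F.is_group G] by simp
  next
    case (Cons s w)
    then obtain a b where s: "a \<in> carrier F" "b \<in> carrier F" "s = gcomm F a b"
      by (auto simp: commutators_def)
    have "\<psi> s = j (\<phi> s)" "\<phi> s \<in> commutators G"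
      using s hom_gcomm[OF F.is_group E.E.is_group \<psi>] hom_gcomm[OF F.is_group G \<phi>(1)]
        E.gcomm_eq_sym \<psi>c \<pi>\<psi> hom_in_carrier[OF \<phi>(1)] by simp_all
    then show ?case
      using Cons s F.wprod_commutators_closed[of w] hom_mult[OF \<psi>] hom_mult[OF \<phi>(1)] by simp
  qed
  have \<psi>P: "\<psi> (P h) = power_product E (\<lambda>i. \<psi> (r i)) m h" for h
    unfolding P_def by (rule power_product_hom[OF \<psi> F.is_group E.E.is_group rF])
  have \<psi>r: "\<psi> (r i) \<in> center E" if "i < m" for i
    using rF[OF that] \<phi>r[OF that] \<pi>\<psi> \<psi>c by (intro E.kernel_in_center) auto
  have \<psi>rc: "\<psi> (r i) \<in> carrier E" if "i < m" for i using rF[OF that] \<psi>c by simp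
  define K where "K = {h. \<psi> (P h) = \<one>\<^bsub>E\<^esub>}"
  have "int_subgroup K"
    using \<psi>r \<psi>rc by (auto simp: int_subgroup_def K_def \<psi>P E.E.power_product_diff)
  moreover have "B \<subseteq> K"
  \<comment> \<open>The word for \<open>P b\<close> has at most \<open>L\<close> letters and product
    \<one> in \<open>G\<close>, so a single move deletes it.\<close>
  proof
    fix b assume b: "b \<in> B"
    let ?u = "map \<phi> (W b)"
    have u: "set ?u \<subseteq> commutators G" "wprod G ?u = \<one>\<^bsub>G\<^esub>" "\<psi> (P b) = wprod E (map j ?u)"
      using \<psi>W[OF W(1)[OF b]] W(2)[OF b] \<phi>P[of b] by auto
    then have "(?u, []) \<in> move_eq G L"
      using move_eqI[of "[]" "[]" ?u "[]" G L] LB[OF b] by simp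
    then show "b \<in> K" using E u by (simp add: G.faithful_lifts_def K_def del: map_map set_map)
  qed
  ultimately have HK: "H \<subseteq> K" by (rule span)
  \<comment> \<open>Instead of working modulo [F, ker \<phi>], only \<psi> and \<open>q\<close> are
    recorded. On the kernel both are unchanged by conjugation, since their values are central, so
    these elements form a normal subgroup; it contains the relators and hence the whole
    kernel.\<close>
  define N where "N = {x \<in> carrier F. \<phi> x = \<one>\<^bsub>G\<^esub> \<and> (\<exists>h. supp h \<and> \<psi> x = \<psi> (P h) \<and> q x = q (P h))}"
  have "N \<lhd> F"
    unfolding F.normal_inv_iff
  proof (intro conjI ballI F.subgroupI)
    have "supp (\<lambda>_. 0)" "P (\<lambda>_. 0) = \<one>\<^bsub>F\<^esub>" using rF by (auto simp: supp_def P_def)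
    then show "N \<noteq> {}" using hom_one[OF \<phi>(1) F.is_group G] by (force simp: N_def)
  next
    fix x assume "x \<in> N"
    then obtain h where h: "x \<in> carrier F" "\<phi> x = \<one>\<^bsub>G\<^esub>" "supp h" "\<psi> x = \<psi> (P h)" "q x = q (P h)"
      by (auto simp: N_def)
    have "\<psi> (P (\<lambda>i. - h i)) = inv\<^bsub>E\<^esub> \<psi> (P h)" "q (P (\<lambda>i. - h i)) = inv\<^bsub>Q\<^esub> q (P h)"
      using \<psi>r qr by (simp_all add: \<psi>P qP E.E.power_product_uminus Q.power_product_uminus)
    moreover have "supp (\<lambda>i. - h i)" using h(3) by (simp add: supp_def)
    ultimately show "inv\<^bsub>F\<^esub> x \<in> N"
      using h hom_m_inv[OF F.is_group E.E.is_group \<psi>] hom_m_inv[OF F.is_group Q.is_group q]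
        hom_m_inv[OF F.is_group G \<phi>(1)]
      by (auto simp: N_def intro!: exI[of _ "\<lambda>i. - h i"])
  next
    fix x y assume "x \<in> N" "y \<in> N"
    then obtain h h' where h: "x \<in> carrier F" "\<phi> x = \<one>\<^bsub>G\<^esub>" "supp h" "\<psi> x = \<psi> (P h)" "q x = q (P h)"
      and h': "y \<in> carrier F" "\<phi> y = \<one>\<^bsub>G\<^esub>" "supp h'" "\<psi> y = \<psi> (P h')" "q y = q (P h')"
      by (auto simp: N_def)
    have "\<psi> (P (\<lambda>i. h i + h' i)) = \<psi> (x \<otimes>\<^bsub>F\<^esub> y)" "q (P (\<lambda>i. h i + h' i)) = q (x \<otimes>\<^bsub>F\<^esub> y)"
      using \<psi>r qr h h' hom_mult[OF \<psi>] hom_mult[OF q]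
      by (simp_all add: \<psi>P qP E.E.power_product_add Q.power_product_add)
    moreover have "supp (\<lambda>i. h i + h' i)" using h(3) h'(3) by (simp add: supp_def)
    ultimately show "x \<otimes>\<^bsub>F\<^esub> y \<in> N"
      using h h' hom_mult[OF \<phi>(1)] by (auto simp: N_def intro!: exI[of _ "\<lambda>i. h i + h' i"])
  next
    fix x y assume x: "x \<in> carrier F" and "y \<in> N"
    then obtain h where h: "y \<in> carrier F" "\<phi> y = \<one>\<^bsub>G\<^esub>" "supp h" "\<psi> y = \<psi> (P h)" "q y = q (P h)"
      by (auto simp: N_def)
    have "\<psi> y \<in> center E" using \<pi>\<psi>[OF h(1)] \<psi>c[OF h(1)] h(2) by (intro E.kernel_in_center) simp_all
    moreover have "q y \<in> center Q" using hom_in_carrier[OF q h(1)] by (simp add: Q.center_eq_carrier)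
    moreover have "\<phi> y \<in> center G" using h(2) by (simp add: center_def)
    ultimately show "x \<otimes>\<^bsub>F\<^esub> y \<otimes>\<^bsub>F\<^esub> inv\<^bsub>F\<^esub> x \<in> N"
      using h x hom_conj_center[OF F.is_group E.E.is_group \<psi> x h(1)]
        hom_conj_center[OF F.is_group Q.is_group q x h(1)]
        hom_conj_center[OF F.is_group G \<phi>(1) x h(1)]
      by (auto simp: N_def intro!: exI[of _ h])
  qed (auto simp: N_def)
  moreover have "R \<subseteq> N"
  proof
    fix x assume "x \<in> R"
    then obtain i where i: "i < m" "x = r i" by (auto simp: r)
    then have "P (\<lambda>k. if k = i then 1 else 0) = x" "supp (\<lambda>k. if k = i then 1 else 0)"
      using F.power_product_unit[of m r i] rF by (auto simp: P_def supp_def)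
    then show "x \<in> N" using i rF \<phi>r by (force simp: N_def)
  qed
  ultimately have NN: "normal_closure F R \<subseteq> N" by (auto simp: normal_closure_def)
  have "(w, []) \<in> move_eq G L" if w: "set w \<subseteq> commutators G" "wprod G w = \<one>\<^bsub>G\<^esub>" for w
  proof -
    \<comment> \<open>Lifting letter by letter to commutators of \<open>F\<close> puts the product
      into [F, F] as well as into the kernel.\<close>
    obtain V where V: "set V \<subseteq> commutators F" "map \<phi> V = w"
      using lift_commutators[OF F.is_group G \<phi> w(1)] by auto
    let ?x = "wprod F V"
    have x: "?x \<in> carrier F" "?x \<in> F'" "\<phi> ?x = \<one>\<^bsub>G\<^esub>" "\<psi> ?x = wprod E (map j w)"
      using V w \<psi>W[OF V(1)] F.wprod_in_derived F.wprod_commutators_closed by (auto simp: F'_def)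
    then have "?x \<in> N" using ker NN by blast
    then obtain h where h: "supp h" "\<psi> ?x = \<psi> (P h)" "q ?x = q (P h)" by (auto simp: N_def)
    \<comment> \<open>The product \<open>?x\<close> dies under \<open>q\<close>, hence so does
      \<open>P h\<close>.\<close>
    then have "h \<in> H" using q1[OF x(1)] q1[OF P] x(2) by (simp add: H_def)
    then have "wprod E (map j w) = \<one>\<^bsub>E\<^esub>" using HK h(2) x(4) by (auto simp: K_def)
    then show ?thesis using E w(1) by (simp add: G.faithful_lifts_def)
  qed
  then show ?thesis by blast
qed

section \<open>Unions of balls in normed spaces\<close>

lemma homotopic_paths_in_convex:
  fixes C :: "'b::real_normed_vector set"
  assumes "convex C" "C \<subseteq> S" "path p" "path q" "path_image p \<subseteq> C" "path_image q \<subseteq> C"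
    "pathstart p = pathstart q" "pathfinish p = pathfinish q"
  shows "homotopic_paths S p q"
proof -
  have "homotopic_paths C p q"
    using convex_imp_simply_connected[OF assms(1)] assms
    unfolding simply_connected_eq_homotopic_paths by auto
  then show ?thesis using assms(2) by (rule homotopic_paths_subset)
qed

lemma homotopic_paths_triangle:
  fixes a b c :: "'b::real_normed_vector"
  assumes "convex hull {a, b, c} \<subseteq> S"
  shows "homotopic_paths S (linepath a b +++ linepath b c) (linepath a c)"
proof (rule homotopic_paths_in_convex[OF _ assms])
  have "closed_segment x y \<subseteq> convex hull {a, b, c}" if "x \<in> {a, b, c}" "y \<in> {a, b, c}" for x y
    using that unfolding segment_convex_hull by (intro hull_mono) auto
  then show "path_image (linepath a b +++ linepath b c) \<subseteq> convex hull {a, b, c}"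
    "path_image (linepath a c) \<subseteq> convex hull {a, b, c}"
    by (auto simp: path_image_join)
qed auto

text \<open>A convex combination of \<open>a\<close>, \<open>b\<close>, \<open>c\<close> is close to whichever of \<open>a\<close> and \<open>c\<close> has the larger
  weight.\<close>

lemma triangle_subset_balls:
  fixes a b c :: "'b::real_normed_vector"
  assumes "dist b a < R" "dist b c < R" "dist a c \<le> 2 * r" "r < R"
  shows "convex hull {a, b, c} \<subseteq> ball a R \<union> ball c R"
proof
  have *: "dist a (u *\<^sub>R a + v *\<^sub>R b + w *\<^sub>R c) < R"
    if "0 \<le> u" "0 \<le> v" "0 \<le> w" "u + v + w = 1" "w \<le> u" "dist b a < R" "dist a c \<le> 2 * r" for u v w a c
  proof -
    have "u *\<^sub>R a + v *\<^sub>R b + w *\<^sub>R c - a = v *\<^sub>R (b - a) + w *\<^sub>R (c - a)"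
    proof -
      have u: "u = 1 - v - w" using that(4) by simp
      show ?thesis unfolding u by (simp add: algebra_simps)
    qed
    then have "dist a (u *\<^sub>R a + v *\<^sub>R b + w *\<^sub>R c) = norm (v *\<^sub>R (b - a) + w *\<^sub>R (c - a))"
      by (metis dist_commute dist_norm)
    also have "\<dots> \<le> v * dist b a + w * dist a c"
      using norm_triangle_ineq[of "v *\<^sub>R (b - a)" "w *\<^sub>R (c - a)"] that(2,3)
      by (simp add: dist_norm norm_minus_commute)
    also have "w * dist a c \<le> (1 - v) * r"
    proof -
      have "0 \<le> r" using that(7) zero_le_dist[of a c] by linarith
      have "w * dist a c \<le> w * (2 * r)" using that by (intro mult_left_mono) auto
      also have "\<dots> = (2 * w) * r" by simp
      also have "\<dots> \<le> (1 - v) * r" using that \<open>0 \<le> r\<close> by (intro mult_right_mono) auto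
      finally show ?thesis .
    qed
    finally have "dist a (u *\<^sub>R a + v *\<^sub>R b + w *\<^sub>R c) \<le> v * dist b a + (1 - v) * r" by simp
    also have "\<dots> < R"
      using convex_bound_lt[of "dist b a" R r v "1 - v"] that assms(4) by auto
    finally show ?thesis .
  qed
  fix x assume "x \<in> convex hull {a, b, c}"
  then obtain u v w where x: "0 \<le> u" "0 \<le> v" "0 \<le> w" "u + v + w = 1" "x = u *\<^sub>R a + v *\<^sub>R b + w *\<^sub>R c"
    by (auto simp: convex_hull_3)
  show "x \<in> ball a R \<union> ball c R"
  proof (cases "w \<le> u")
    case True
    then show ?thesis using *[of u v w a c] x assms by simp
  next
    case False
    then have "dist c (w *\<^sub>R c + v *\<^sub>R b + u *\<^sub>R a) < R"
      using *[of w v u c a] x assms by (simp add: dist_commute)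
    then show ?thesis using x(5) by (simp add: algebra_simps)
  qed
qed

section \<open>The commutator subgroup as vertex set of balls\<close>

context group
begin

abbreviation "V \<equiv> derived G (carrier G)"

lemma V_subgroup: "subgroup V G"
  using derived_is_subgroup[OF subset_refl] .

lemma V_closed: "g \<in> V \<Longrightarrow> g \<in> carrier G"
  using V_subgroup by (rule subgroup.mem_carrier)

lemma V_mult: "g \<in> V \<Longrightarrow> h \<in> V \<Longrightarrow> g \<otimes> h \<in> V"
  using V_subgroup by (rule subgroup.m_closed)

lemma V_step: "g \<in> V \<Longrightarrow> s \<in> commutators G \<Longrightarrow> g \<otimes> s \<in> V"
  using V_mult wprod_in_derived[of "[s]"] commutators_closed by simp

lemma V_word: "g \<in> V \<Longrightarrow> set u \<subseteq> commutators G \<Longrightarrow> g \<otimes> wprod G u \<in> V"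
  by (intro V_mult wprod_in_derived)

end

text \<open>What the topology needs to know: \<kappa> places the vertices in a normed space without
  stretching edges, and \<open>chain\<close> recovers short words from distances. Its bound rounds
  down from below 2k + 1 to 2k, because word lengths are integers.\<close>

locale commutator_nerve = group G for G :: "('a, 'c) monoid_scheme" (structure) +
  fixes \<kappa> :: "'a \<Rightarrow> 'b::real_normed_vector" and k L :: nat
  assumes step: "g \<in> V \<Longrightarrow> s \<in> commutators G \<Longrightarrow> dist (\<kappa> g) (\<kappa> (g \<otimes> s)) \<le> 1"
    and chain: "g \<in> V \<Longrightarrow> h \<in> V \<Longrightarrow>
      dist (\<kappa> g) (\<kappa> h) < 2 * real k + 1 \<Longrightarrow>
      \<exists>u. set u \<subseteq> commutators G \<and> length u \<le> 2 * k \<and> h = g \<otimes> wprod G u"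
    and relations: "set w \<subseteq> commutators G \<Longrightarrow> wprod G w = \<one> \<Longrightarrow> (w, []) \<in> move_eq G L"
    and k: "L \<le> k" "1 \<le> k"
begin

text \<open>Two balls that meet have centers at distance below 2 R = 2k + 1, thus at most 2k by
  \<open>chain\<close>. Since k < R, this leaves the room that \<open>triangle_subset_balls\<close>
  asks for.\<close>

definition R :: real where "R = real k + 1/2"

definition S :: "'b set" where "S = (\<Union>g\<in>V. ball (\<kappa> g) R)"

lemma ball_subset_S: "g \<in> V \<Longrightarrow> ball (\<kappa> g) R \<subseteq> S"
  by (auto simp: S_def)

lemma R: "real k < R" "1 < R" "0 < R"
  using k(2) by (auto simp: R_def)

lemma triangle_in_S:
  assumes "g \<in> V" "h \<in> V" "dist b (\<kappa> g) < R" "dist b (\<kappa> h) < R" "dist (\<kappa> g) (\<kappa> h) \<le> 2 * real k"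
  shows "convex hull {\<kappa> g, b, \<kappa> h} \<subseteq> S"
  using triangle_subset_balls[OF assms(3-5)] R(1) ball_subset_S[OF assms(1)] ball_subset_S[OF assms(2)]
  by blast

section \<open>Edge paths and their homotopies\<close>

lemma dist_word:
  assumes "set u \<subseteq> commutators G" "g \<in> V"
  shows "dist (\<kappa> g) (\<kappa> (g \<otimes> wprod G u)) \<le> real (length u)"
  using assms
proof (induction u arbitrary: g)
  case (Cons s u)
  have "dist (\<kappa> g) (\<kappa> (g \<otimes> s)) \<le> 1" using Cons.prems by (intro step) auto
  moreover have "dist (\<kappa> (g \<otimes> s)) (\<kappa> (g \<otimes> s \<otimes> wprod G u)) \<le> real (length u)"
    using Cons.prems by (intro Cons.IH V_step) auto
  moreover have "g \<otimes> s \<otimes> wprod G u = g \<otimes> (s \<otimes> wprod G u)"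
    using Cons.prems V_closed commutators_closed wprod_commutators_closed by (intro m_assoc) auto
  ultimately show ?case
    using dist_triangle[of "\<kappa> g" "\<kappa> (g \<otimes> (s \<otimes> wprod G u))" "\<kappa> (g \<otimes> s)"] by simp
qed (simp add: V_closed)

text \<open>The edge path that reads a word from \<open>g\<close>, with straight segments of the
  normed space in place of the edges of the graph.\<close>

primrec epath :: "'a \<Rightarrow> 'a list \<Rightarrow> real \<Rightarrow> 'b" where
  "epath g [] = linepath (\<kappa> g) (\<kappa> g)"
| "epath g (s # u) = linepath (\<kappa> g) (\<kappa> (g \<otimes> s)) +++ epath (g \<otimes> s) u"

lemma pathstart_epath [simp]: "pathstart (epath g u) = \<kappa> g"
  by (cases u) auto

lemma path_epath [simp]: "path (epath g u)"
  by (induction u arbitrary: g) auto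

lemma word_assoc:
  "g \<in> V \<Longrightarrow> s \<in> commutators G \<Longrightarrow> set u \<subseteq> commutators G \<Longrightarrow>
    g \<otimes> s \<otimes> wprod G u = g \<otimes> (s \<otimes> wprod G u)"
  using V_closed commutators_closed wprod_commutators_closed by (intro m_assoc) auto

lemma pathfinish_epath [simp]:
  "g \<in> V \<Longrightarrow> set u \<subseteq> commutators G \<Longrightarrow> pathfinish (epath g u) = \<kappa> (g \<otimes> wprod G u)"
  by (induction u arbitrary: g) (auto simp: V_closed V_step word_assoc)

lemma epath_image_convex:
  assumes "convex C" "g \<in> V" "set u \<subseteq> commutators G"
    "\<And>i. i \<le> length u \<Longrightarrow> \<kappa> (g \<otimes> wprod G (take i u)) \<in> C"
  shows "path_image (epath g u) \<subseteq> C"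
  using assms(2-4)
proof (induction u arbitrary: g)
  case Nil
  then show ?case using Nil.prems(3)[of 0] V_closed by simp
next
  case (Cons s u)
  have s: "s \<in> commutators G" "set u \<subseteq> commutators G" using Cons.prems by auto
  have "\<kappa> (g \<otimes> s \<otimes> wprod G (take i u)) \<in> C" if "i \<le> length u" for i
    using Cons.prems(3)[of "Suc i"] that word_assoc[of g s "take i u"] Cons.prems(1) s
      set_take_subset[of i u] by auto
  then have "path_image (epath (g \<otimes> s) u) \<subseteq> C"
    using Cons.prems by (intro Cons.IH V_step) auto
  moreover have "closed_segment (\<kappa> g) (\<kappa> (g \<otimes> s)) \<subseteq> C"
    using Cons.prems(3)[of 0] Cons.prems(3)[of 1] Cons.prems(1) s V_closed commutators_closed assms(1)
    by (intro closed_segment_subset) auto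
  ultimately show ?case by (simp add: path_image_join)
qed

lemma epath_image_S [simp]:
  assumes "g \<in> V" "set u \<subseteq> commutators G"
  shows "path_image (epath g u) \<subseteq> S"
  using assms
proof (induction u arbitrary: g)
  case Nil
  then show ?case using ball_subset_S[of g] R by (auto simp: subset_iff)
next
  case (Cons s u)
  have "closed_segment (\<kappa> g) (\<kappa> (g \<otimes> s)) \<subseteq> ball (\<kappa> g) R"
    using Cons.prems step[of g s] R by (intro closed_segment_subset) auto
  then have "closed_segment (\<kappa> g) (\<kappa> (g \<otimes> s)) \<subseteq> S"
    using ball_subset_S Cons.prems by blast
  then show ?case using Cons V_step by (simp add: path_image_join)
qed

lemma epath_short:
  assumes "g \<in> V" "set u \<subseteq> commutators G" "length u \<le> k"
  shows "path_image (epath g u) \<subseteq> ball (\<kappa> g) R"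
proof (rule epath_image_convex[OF _ assms(1,2)])
  fix i assume "i \<le> length u"
  then show "\<kappa> (g \<otimes> wprod G (take i u)) \<in> ball (\<kappa> g) R"
    using dist_word[OF order_trans[OF set_take_subset assms(2)] assms(1), of i] assms(3) R(1) by auto
qed simp

text \<open>Only a homotopy, since joining paths is not strictly associative and the empty word
  contributes a constant segment.\<close>

lemma epath_append:
  assumes "g \<in> V" "set u \<subseteq> commutators G" "set v \<subseteq> commutators G"
  shows "homotopic_paths S (epath g (u @ v)) (epath g u +++ epath (g \<otimes> wprod G u) v)"
  using assms
proof (induction u arbitrary: g)
  case Nil
  then show ?case
    using homotopic_paths_sym[OF homotopic_paths_lid[of "epath g v" S]]
    by (simp only: append_Nil epath.simps wprod_Nil pathstart_epath path_epath epath_image_S V_closed r_one)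
next
  case (Cons s u)
  have s: "s \<in> commutators G" "set u \<subseteq> commutators G" using Cons.prems by auto
  have gs: "g \<otimes> s \<in> V" using Cons.prems V_step by simp
  have seg: "path_image (linepath (\<kappa> g) (\<kappa> (g \<otimes> s))) \<subseteq> S"
    using epath_image_S[of g "[s]"] Cons.prems by (simp add: path_image_join)
  have "homotopic_paths S (epath g ((s # u) @ v))
      (linepath (\<kappa> g) (\<kappa> (g \<otimes> s)) +++ (epath (g \<otimes> s) u +++ epath (g \<otimes> s \<otimes> wprod G u) v))"
    using seg Cons.IH[OF gs s(2) Cons.prems(3)] by (auto intro!: homotopic_paths_join)
  also have "homotopic_paths S \<dots>
      ((linepath (\<kappa> g) (\<kappa> (g \<otimes> s)) +++ epath (g \<otimes> s) u) +++ epath (g \<otimes> s \<otimes> wprod G u) v)"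
    using seg gs s Cons.prems V_word by (intro homotopic_paths_assoc) auto
  finally show ?case using word_assoc Cons.prems(1) s by simp
qed

text \<open>The two sides of a move have at most L \<le> k letters and the same endpoints, so both
  edge paths run in the ball around their common start, which is convex.\<close>

lemma epath_move:
  assumes "(u, v) \<in> move_eq G L" "g \<in> V" "set u \<subseteq> commutators G"
  shows "homotopic_paths S (epath g u) (epath g v) \<and> set v \<subseteq> commutators G"
  using assms(1) unfolding move_eq_def
proof (induction rule: rtrancl_induct)
  case base
  then show ?case using assms by simp
next
  case (step y z)
  then obtain a b u v where yz: "y = a @ u @ b" "z = a @ v @ b"
    and sub: "set a \<subseteq> commutators G" "set b \<subseteq> commutators G" "set u \<subseteq> commutators G" "set v \<subseteq> commutators G"
    and len: "length u \<le> k" "length v \<le> k" and uv: "wprod G u = wprod G v"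
    using k(1) by (auto simp: short_moves_def)
  let ?h = "g \<otimes> wprod G a"
  have h: "?h \<in> V" "?h \<otimes> wprod G u \<in> V" using V_word assms(2) sub by auto
  have "homotopic_paths S (epath ?h u) (epath ?h v)"
    using epath_short[OF h(1)] sub len h(1) uv ball_subset_S[OF h(1)]
    by (intro homotopic_paths_in_convex[of "ball (\<kappa> ?h) R"]) auto
  then have mid: "homotopic_paths S (epath ?h u +++ epath (?h \<otimes> wprod G u) b)
      (epath ?h v +++ epath (?h \<otimes> wprod G v) b)"
    using h sub uv by (intro homotopic_paths_join) auto
  have split: "homotopic_paths S (epath g (a @ w @ b))
      (epath g a +++ (epath ?h w +++ epath (?h \<otimes> wprod G w) b))" if "set w \<subseteq> commutators G" for w
    using epath_append[of g a "w @ b"] epath_append[of ?h w b] assms(2) sub that h(1)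
    by (auto intro!: homotopic_paths_join elim!: homotopic_paths_trans)
  have "homotopic_paths S (epath g y) (epath g z)"
    unfolding yz using split[OF sub(3)] homotopic_paths_sym[OF split[OF sub(4)]]
      homotopic_paths_join[OF _ mid, of "epath g a" "epath g a"] assms(2) sub
    by (auto intro: homotopic_paths_trans)
  then show ?case using step.IH sub yz by (auto intro: homotopic_paths_trans)
qed

text \<open>Cut the word after \<open>k\<close> letters. Each part is straightened inside the ball
  around its start, and the remaining triangle lies in the balls around its two outer vertices,
  because the cut point is within \<open>k\<close> of both.\<close>

lemma epath_straighten:
  assumes "g \<in> V" "set u \<subseteq> commutators G" "length u \<le> 2 * k"
  shows "homotopic_paths S (epath g u) (linepath (\<kappa> g) (\<kappa> (g \<otimes> wprod G u)))"
proof -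
  define a b where "a = take k u" and "b = drop k u"
  have u: "u = a @ b" and len: "length a \<le> k" "length b \<le> k"
    using assms(3) by (auto simp: a_def b_def)
  have sub: "set a \<subseteq> commutators G" "set b \<subseteq> commutators G" using assms(2) u by auto
  let ?h = "g \<otimes> wprod G a"
  have h: "?h \<in> V" using V_word assms(1) sub by auto
  have gu: "g \<otimes> wprod G u = ?h \<otimes> wprod G b"
    using sub assms(1) V_closed commutators_closed wprod_commutators_closed
    by (simp add: u m_assoc wprod_append subset_iff)
  have short: "homotopic_paths S (epath x w) (linepath (\<kappa> x) (\<kappa> (x \<otimes> wprod G w)))"
    if "x \<in> V" "set w \<subseteq> commutators G" "length w \<le> k" for x w
  proof (rule homotopic_paths_in_convex[OF convex_ball ball_subset_S[OF that(1)]])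
    show "path_image (linepath (\<kappa> x) (\<kappa> (x \<otimes> wprod G w))) \<subseteq> ball (\<kappa> x) R"
      using dist_word[OF that(2,1)] that(3) R unfolding path_image_linepath
      by (intro closed_segment_subset) auto
  qed (use epath_short[OF that] that in auto)
  have "homotopic_paths S (epath g u) (epath g a +++ epath ?h b)"
    unfolding u using assms(1) sub by (rule epath_append)
  also have "homotopic_paths S \<dots> (linepath (\<kappa> g) (\<kappa> ?h) +++ linepath (\<kappa> ?h) (\<kappa> (?h \<otimes> wprod G b)))"
    using assms(1) sub len h by (intro homotopic_paths_join short) auto
  also have "homotopic_paths S \<dots> (linepath (\<kappa> g) (\<kappa> (?h \<otimes> wprod G b)))"
  proof (intro homotopic_paths_triangle triangle_in_S)
    have d: "dist (\<kappa> g) (\<kappa> ?h) \<le> k" "dist (\<kappa> ?h) (\<kappa> (?h \<otimes> wprod G b)) \<le> k"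
      using dist_word[of a g] dist_word[of b ?h] sub len assms(1) h by auto
    then show "dist (\<kappa> ?h) (\<kappa> g) < R" "dist (\<kappa> ?h) (\<kappa> (?h \<otimes> wprod G b)) < R"
      using R(1) by (auto simp: dist_commute)
    show "dist (\<kappa> g) (\<kappa> (?h \<otimes> wprod G b)) \<le> 2 * real k"
      using d dist_triangle[of "\<kappa> g" "\<kappa> (?h \<otimes> wprod G b)" "\<kappa> ?h"] by linarith
  qed (use assms(1) h V_word sub in auto)
  finally show ?thesis using gu by simp
qed

section \<open>Pushing paths to edge paths\<close>

lemma switch_center:
  assumes "g \<in> V" "h \<in> V" "f \<in> ball (\<kappa> g) R" "f \<in> ball (\<kappa> h) R"
  shows "\<exists>u. set u \<subseteq> commutators G \<and> h = g \<otimes> wprod G u \<and>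
    homotopic_paths S (epath g u +++ linepath (\<kappa> h) f) (linepath (\<kappa> g) f)"
proof -
  have "dist (\<kappa> g) (\<kappa> h) < 2 * real k + 1"
    using assms(3,4) dist_triangle2[of "\<kappa> g" "\<kappa> h" f] by (auto simp: R_def dist_commute)
  then obtain u where u: "set u \<subseteq> commutators G" "length u \<le> 2 * k" "h = g \<otimes> wprod G u"
    using chain assms(1,2) by blast
  have d: "dist (\<kappa> g) (\<kappa> h) \<le> 2 * real k"
    using dist_word[OF u(1) assms(1)] u(2,3) by simp
  have "homotopic_paths S (epath g u) (linepath (\<kappa> g) (\<kappa> h))"
    using epath_straighten[OF assms(1) u(1,2)] u(3) by simp
  moreover have "closed_segment (\<kappa> h) f \<subseteq> S"
    using assms(2,4) R ball_subset_S[OF assms(2)] closed_segment_subset[of "\<kappa> h" "ball (\<kappa> h) R" f] by auto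
  ultimately have "homotopic_paths S (epath g u +++ linepath (\<kappa> h) f)
      (linepath (\<kappa> g) (\<kappa> h) +++ linepath (\<kappa> h) f)"
    using assms(1) u by (intro homotopic_paths_join) auto
  \<comment> \<open>The point \<open>f\<close> lies within \<open>R\<close> of both centers, so the
    triangle is filled by the two balls.\<close>
  also have "homotopic_paths S \<dots> (linepath (\<kappa> g) f)"
  proof (rule homotopic_paths_triangle)
    have "convex hull {\<kappa> g, f, \<kappa> h} \<subseteq> S"
      using assms d by (intro triangle_in_S) (auto simp: dist_commute)
    then show "convex hull {\<kappa> g, \<kappa> h, f} \<subseteq> S" by (simp add: insert_commute)
  qed
  finally show ?thesis using u by blast
qed

text \<open>Lebesgue number of the cover by balls, combined with uniform continuity of the
  path.\<close>

lemma path_subdivision: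
  assumes "path \<gamma>" "path_image \<gamma> \<subseteq> S"
  obtains n :: nat where "0 < n"
    "\<And>i. i < n \<Longrightarrow> \<exists>g\<in>V. path_image (subpath (real i / n) (real (Suc i) / n) \<gamma>) \<subseteq> ball (\<kappa> g) R"
proof -
  have cover: "path_image \<gamma> \<subseteq> \<Union> ((\<lambda>g. ball (\<kappa> g) R) ` V)" using assms(2) by (simp add: S_def)
  have ne: "(\<lambda>g. ball (\<kappa> g) R) ` V \<noteq> {}" using wprod_in_derived[of "[]"] by auto
  obtain \<delta> where \<delta>: "0 < \<delta>"
    "\<And>T. T \<subseteq> path_image \<gamma> \<Longrightarrow> diameter T < \<delta> \<Longrightarrow> \<exists>B\<in>(\<lambda>g. ball (\<kappa> g) R) ` V. T \<subseteq> B"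
    by (rule Lebesgue_number_lemma[OF compact_path_image[OF assms(1)] ne cover]) auto
  have "uniformly_continuous_on {0..1} \<gamma>"
    using assms(1) by (intro compact_uniformly_continuous) (auto simp: path_def)
  \<comment> \<open>Half the Lebesgue number, because the strict bound on distances yields only a
    weak one on the diameter.\<close>
  then obtain d where d: "0 < d" "\<And>s t. s \<in> {0..1} \<Longrightarrow> t \<in> {0..1} \<Longrightarrow> dist s t < d \<Longrightarrow> dist (\<gamma> s) (\<gamma> t) < \<delta> / 2"
    using \<delta>(1) unfolding uniformly_continuous_on_def by (metis half_gt_zero)
  obtain n :: nat where n: "0 < n" "1 / real n < d"
    using d(1) by (metis reals_Archimedean inverse_eq_divide zero_less_Suc)
  show thesis
  proof (rule that[OF n(1)])
    fix i assume i: "i < n"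
    let ?a = "real i / n" and ?b = "real (Suc i) / n"
    have ab: "0 \<le> ?a" "?a \<le> ?b" "?b \<le> 1" "?b - ?a = 1 / n"
      using i n(1) by (auto simp: field_simps)
    have im: "path_image (subpath ?a ?b \<gamma>) = \<gamma> ` {?a..?b}"
      using ab by (simp add: path_image_subpath)
    have "diameter (\<gamma> ` {?a..?b}) \<le> \<delta> / 2"
    proof (rule diameter_le)
      fix x y assume "x \<in> \<gamma> ` {?a..?b}" "y \<in> \<gamma> ` {?a..?b}"
      then obtain s t where st: "s \<in> {?a..?b}" "t \<in> {?a..?b}" "x = \<gamma> s" "y = \<gamma> t" by blast
      then have "dist s t \<le> 1 / n" using ab by (auto simp: dist_real_def)
      moreover have "s \<in> {0..1}" "t \<in> {0..1}"
        using st(1,2) ab(1,3) unfolding atLeastAtMost_iff by linarith+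
      ultimately have "dist (\<gamma> s) (\<gamma> t) < \<delta> / 2" using n(2) by (intro d(2)) auto
      then show "norm (x - y) \<le> \<delta> / 2" by (simp add: st dist_norm)
    qed (use \<delta>(1) in simp)
    moreover have "\<gamma> ` {?a..?b} \<subseteq> path_image \<gamma>"
      unfolding path_image_def using ab by (intro image_mono) auto
    ultimately show "\<exists>g\<in>V. path_image (subpath ?a ?b \<gamma>) \<subseteq> ball (\<kappa> g) R"
      using \<delta>(2)[of "\<gamma> ` {?a..?b}"] \<delta>(1) unfolding im by auto
  qed
qed

lemma linepath_in_S: "g \<in> V \<Longrightarrow> f \<in> ball (\<kappa> g) R \<Longrightarrow> closed_segment (\<kappa> g) f \<subseteq> S"
  using R ball_subset_S[of g] closed_segment_subset[of "\<kappa> g" "ball (\<kappa> g) R" f] by auto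

lemma path_homotopic_epath:
  assumes \<gamma>: "path \<gamma>" "path_image \<gamma> \<subseteq> S" and g: "g \<in> V" "\<gamma> 0 \<in> ball (\<kappa> g) R"
    and h: "h \<in> V" "\<gamma> 1 \<in> ball (\<kappa> h) R"
  shows "\<exists>u. set u \<subseteq> commutators G \<and> h = g \<otimes> wprod G u \<and>
    homotopic_paths S \<gamma> (linepath (\<gamma> 0) (\<kappa> g) +++ (epath g u +++ linepath (\<kappa> h) (\<gamma> 1)))"
proof -
  obtain n :: nat where n: "0 < n" and sub:
    "\<And>i. i < n \<Longrightarrow> \<exists>g\<in>V. path_image (subpath (real i / n) (real (Suc i) / n) \<gamma>) \<subseteq> ball (\<kappa> g) R"
    using path_subdivision[OF \<gamma>] by metis
  have seg0: "closed_segment (\<gamma> 0) (\<kappa> g) \<subseteq> S"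
    using linepath_in_S[OF g] by (simp add: closed_segment_commute)
  \<comment> \<open>The initial piece up to i / n is treated for every center \<open>h\<close> whose
    ball contains its endpoint; this freedom lets the induction step pass through the center of the
    ball around the next piece.\<close>
  have "\<exists>u. set u \<subseteq> commutators G \<and> h = g \<otimes> wprod G u \<and> homotopic_paths S (subpath 0 (real i / n) \<gamma>)
      (linepath (\<gamma> 0) (\<kappa> g) +++ (epath g u +++ linepath (\<kappa> h) (\<gamma> (real i / n))))"
    if "i \<le> n" "h \<in> V" "\<gamma> (real i / n) \<in> ball (\<kappa> h) R" for i h
    using that
  proof (induction i arbitrary: h)
    case 0
    \<comment> \<open>The path is still constant, but \<open>h\<close> may differ from
      \<open>g\<close>; switching centers leaves a segment traversed to \<open>g\<close> and
      back.\<close>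
    then obtain u where u: "set u \<subseteq> commutators G" "h = g \<otimes> wprod G u"
      "homotopic_paths S (epath g u +++ linepath (\<kappa> h) (\<gamma> 0)) (linepath (\<kappa> g) (\<gamma> 0))"
      using switch_center[of g h "\<gamma> 0"] g by auto
    have "homotopic_paths S (linepath (\<gamma> 0) (\<kappa> g) +++ (epath g u +++ linepath (\<kappa> h) (\<gamma> 0)))
        (linepath (\<gamma> 0) (\<kappa> g) +++ linepath (\<kappa> g) (\<gamma> 0))"
      using seg0 u(3) by (intro homotopic_paths_join) auto
    also have "homotopic_paths S \<dots> (linepath (\<gamma> 0) (\<gamma> 0))"
      using homotopic_paths_rinv[of "linepath (\<gamma> 0) (\<kappa> g)" S] seg0 by simp
    finally have "homotopic_paths S (linepath (\<gamma> 0) (\<gamma> 0))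
        (linepath (\<gamma> 0) (\<kappa> g) +++ (epath g u +++ linepath (\<kappa> h) (\<gamma> 0)))"
      by (rule homotopic_paths_sym)
    moreover have "subpath 0 (real 0 / n) \<gamma> = linepath (\<gamma> 0) (\<gamma> 0)"
      by (simp add: subpath_def linepath_def scaleR_left_diff_distrib)
    moreover have "\<gamma> (real 0 / n) = \<gamma> 0" by simp
    ultimately show ?case using u(1,2) by metis
  next
    case (Suc i)
    let ?s = "real i / n" and ?t = "real (Suc i) / n"
    have st: "?s \<in> {0..1}" "?t \<in> {0..1}" "?s \<le> ?t" using Suc.prems(1) n by (auto simp: field_simps)
    obtain w where w: "w \<in> V" "path_image (subpath ?s ?t \<gamma>) \<subseteq> ball (\<kappa> w) R"
      using sub[of i] Suc.prems(1) by auto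
    have ends: "\<gamma> ?s \<in> ball (\<kappa> w) R" "\<gamma> ?t \<in> ball (\<kappa> w) R"
      using w(2) pathstart_in_path_image[of "subpath ?s ?t \<gamma>"] pathfinish_in_path_image[of "subpath ?s ?t \<gamma>"]
      by auto
    obtain u where u: "set u \<subseteq> commutators G" "w = g \<otimes> wprod G u" and hu:
      "homotopic_paths S (subpath 0 ?s \<gamma>) (linepath (\<gamma> 0) (\<kappa> g) +++ (epath g u +++ linepath (\<kappa> w) (\<gamma> ?s)))"
      using Suc.IH[of w] Suc.prems(1) w(1) ends(1) by auto
    obtain v where v: "set v \<subseteq> commutators G" "h = w \<otimes> wprod G v" and hv:
      "homotopic_paths S (epath w v +++ linepath (\<kappa> h) (\<gamma> ?t)) (linepath (\<kappa> w) (\<gamma> ?t))"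
      using switch_center[OF w(1) Suc.prems(2) ends(2) Suc.prems(3)] by blast
    have pst: "path (subpath ?s ?t \<gamma>)" using \<gamma>(1) st by simp
    have ws: "path_image (linepath (\<kappa> w) (\<gamma> ?s)) \<subseteq> ball (\<kappa> w) R" "path_image (linepath (\<kappa> w) (\<gamma> ?t)) \<subseteq> ball (\<kappa> w) R"
      unfolding path_image_linepath using ends R by (intro closed_segment_subset; simp)+
    have wS: "ball (\<kappa> w) R \<subseteq> S" using ball_subset_S w(1) by simp
    have imS: "path_image (subpath ?s ?t \<gamma>) \<subseteq> S" "closed_segment (\<kappa> w) (\<gamma> ?s) \<subseteq> S"
      "closed_segment (\<kappa> w) (\<gamma> ?t) \<subseteq> S" "closed_segment (\<kappa> h) (\<gamma> ?t) \<subseteq> S"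
      using w(2) ws wS linepath_in_S[OF Suc.prems(2,3)] by auto
    \<comment> \<open>The next piece and both segments from \<open>w\<close> lie in one ball, so the
      piece is exchanged for the change of segments.\<close>
    have fold: "homotopic_paths S (linepath (\<kappa> w) (\<gamma> ?s) +++ subpath ?s ?t \<gamma>) (linepath (\<kappa> w) (\<gamma> ?t))"
      using ws w(2) wS pst by (intro homotopic_paths_in_convex[of "ball (\<kappa> w) R"]) (auto simp: path_image_join)
    \<comment> \<open>The word grows by \<open>v\<close>, which leads from the center
      \<open>w\<close> to the prescribed center \<open>h\<close>.\<close>
    have "homotopic_paths S (epath g (u @ v) +++ linepath (\<kappa> h) (\<gamma> ?t))
        ((epath g u +++ epath w v) +++ linepath (\<kappa> h) (\<gamma> ?t))"
      using epath_append[OF g(1) u(1) v(1)] u(2) v g(1) u(1) imS w(1)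
      by (intro homotopic_paths_join) (auto simp: wprod_append V_closed m_assoc subset_iff
          commutators_closed wprod_commutators_closed)
    also have "homotopic_paths S \<dots> (epath g u +++ (epath w v +++ linepath (\<kappa> h) (\<gamma> ?t)))"
      using u v g(1) imS w(1) by (intro homotopic_paths_sym[OF homotopic_paths_assoc]) auto
    also have "homotopic_paths S \<dots> (epath g u +++ linepath (\<kappa> w) (\<gamma> ?t))"
      using u v g(1) hv by (intro homotopic_paths_join) auto
    also have "homotopic_paths S \<dots> (epath g u +++ (linepath (\<kappa> w) (\<gamma> ?s) +++ subpath ?s ?t \<gamma>))"
      using u g(1) by (intro homotopic_paths_join homotopic_paths_sym[OF fold]) auto
    also have "homotopic_paths S \<dots> ((epath g u +++ linepath (\<kappa> w) (\<gamma> ?s)) +++ subpath ?s ?t \<gamma>)"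
      using u g(1) imS pst by (intro homotopic_paths_assoc) auto
    finally have tail: "homotopic_paths S (epath g (u @ v) +++ linepath (\<kappa> h) (\<gamma> ?t))
        ((epath g u +++ linepath (\<kappa> w) (\<gamma> ?s)) +++ subpath ?s ?t \<gamma>)" .
    have "homotopic_paths S (subpath 0 ?t \<gamma>) (subpath 0 ?s \<gamma> +++ subpath ?s ?t \<gamma>)"
      using \<gamma> st by (intro homotopic_paths_sym[OF homotopic_join_subpaths]) auto
    also have "homotopic_paths S \<dots>
        ((linepath (\<gamma> 0) (\<kappa> g) +++ (epath g u +++ linepath (\<kappa> w) (\<gamma> ?s))) +++ subpath ?s ?t \<gamma>)"
      using hu pst imS(1) by (intro homotopic_paths_join) auto
    also have "homotopic_paths S \<dots>
        (linepath (\<gamma> 0) (\<kappa> g) +++ ((epath g u +++ linepath (\<kappa> w) (\<gamma> ?s)) +++ subpath ?s ?t \<gamma>))"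
      using u g(1) imS pst seg0
      by (intro homotopic_paths_sym[OF homotopic_paths_assoc]) (auto simp: path_image_join)
    also have "homotopic_paths S \<dots>
        (linepath (\<gamma> 0) (\<kappa> g) +++ (epath g (u @ v) +++ linepath (\<kappa> h) (\<gamma> ?t)))"
      using seg0 by (intro homotopic_paths_join homotopic_paths_sym[OF tail]) auto
    finally show ?case
      using u v g(1) by (intro exI[of _ "u @ v"]) (auto simp: wprod_append V_closed m_assoc subset_iff
          commutators_closed wprod_commutators_closed)
  qed
  from this[of n h] show ?thesis using h n by simp
qed

lemma path_connected_S: "path_connected S"
proof -
  have one: "\<one> \<in> V" using wprod_in_derived[of "[]"] by simp
  have "path_component S x (\<kappa> \<one>)" if x: "x \<in> S" for x
  proof -
    obtain g where g: "g \<in> V" "x \<in> ball (\<kappa> g) R" using x by (auto simp: S_def)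
    obtain u where u: "set u \<subseteq> commutators G" "g = wprod G u" using derived_imp_wprod[OF g(1)] by blast
    have "path_component S (\<kappa> \<one>) (\<kappa> g)"
      unfolding path_component_def using u one g(1)
      by (intro exI[of _ "epath \<one> u"]) (auto simp: V_closed)
    moreover have "path_component S (\<kappa> g) x"
      unfolding path_component_def using linepath_in_S[OF g]
      by (intro exI[of _ "linepath (\<kappa> g) x"]) auto
    ultimately show ?thesis by (meson path_component_sym path_component_trans)
  qed
  then show ?thesis
    unfolding path_connected_component by (meson path_component_sym path_component_trans)
qed

text \<open>A loop is pushed to an edge loop, whose word has product \<one>. By
  \<open>relations\<close> that word moves to the empty word, so the edge loop contracts.\<close>

theorem simply_connected_S: "simply_connected S"
  unfolding simply_connected_eq_contractible_path
proof (intro conjI allI impI path_connected_S)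
  fix \<gamma> assume \<gamma>: "path \<gamma> \<and> path_image \<gamma> \<subseteq> S \<and> pathfinish \<gamma> = pathstart \<gamma>"
  then have eq: "\<gamma> 1 = \<gamma> 0" by (simp add: pathstart_def pathfinish_def)
  have "\<gamma> 0 \<in> S" using \<gamma> pathstart_in_path_image[of \<gamma>] by (auto simp: pathstart_def)
  then obtain g where g: "g \<in> V" "\<gamma> 0 \<in> ball (\<kappa> g) R" by (auto simp: S_def)
  \<comment> \<open>The same center serves both ends, which closes up the edge path.\<close>
  obtain u where u: "set u \<subseteq> commutators G" "g = g \<otimes> wprod G u"
    "homotopic_paths S \<gamma> (linepath (\<gamma> 0) (\<kappa> g) +++ (epath g u +++ linepath (\<kappa> g) (\<gamma> 0)))"
    using path_homotopic_epath[of \<gamma> g g] \<gamma> g eq by auto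
  have seg: "closed_segment (\<kappa> g) (\<gamma> 0) \<subseteq> S" "closed_segment (\<gamma> 0) (\<kappa> g) \<subseteq> S"
    using linepath_in_S[OF g] by (simp_all add: closed_segment_commute)
  have "wprod G u = \<one>"
    using u(1,2) g(1) V_closed wprod_commutators_closed r_cancel_one' by (metis l_cancel_one')
  then have "homotopic_paths S (epath g u) (linepath (\<kappa> g) (\<kappa> g))"
    using epath_move[OF relations[OF u(1)] g(1) u(1)] by simp
  then have "homotopic_paths S (epath g u +++ linepath (\<kappa> g) (\<gamma> 0)) (linepath (\<kappa> g) (\<kappa> g) +++ linepath (\<kappa> g) (\<gamma> 0))"
    using seg u(1,2) g(1) by (intro homotopic_paths_join) auto
  also have "homotopic_paths S \<dots> (linepath (\<kappa> g) (\<gamma> 0))"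
    using seg by (intro homotopic_paths_lid') auto
  finally have "homotopic_paths S (linepath (\<gamma> 0) (\<kappa> g) +++ (epath g u +++ linepath (\<kappa> g) (\<gamma> 0)))
      (linepath (\<gamma> 0) (\<kappa> g) +++ linepath (\<kappa> g) (\<gamma> 0))"
    using seg by (intro homotopic_paths_join) auto
  also have "homotopic_paths S \<dots> (linepath (\<gamma> 0) (\<gamma> 0))"
    using homotopic_paths_rinv[of "linepath (\<gamma> 0) (\<kappa> g)" S] seg by simp
  finally have "homotopic_paths S \<gamma> (linepath (\<gamma> 0) (\<gamma> 0))"
    by (rule homotopic_paths_trans[OF u(3)])
  then show "homotopic_paths S \<gamma> (linepath (pathstart \<gamma>) (pathstart \<gamma>))"
    by (simp add: pathstart_def)
qed

end

section \<open>Distances in Cayley graphs\<close>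

lemma mdist_self: "x \<in> mspace m \<Longrightarrow> mdist m x x = 0"
  by (rule Metric_space.mdist_zero[OF Metric_space_mspace_mdist])

text \<open>Along the open edge from \<open>x\<close>, the point \<open>p\<close> has distance \<open>1 - p x\<close> from \<open>x\<close>.\<close>

lemma pl_path_combinatorial:
  assumes "pl_path V E (edge_point g g 0) p l" and "P g 0"
    and step: "\<And>x y n. x \<in> V \<Longrightarrow> y \<in> V \<Longrightarrow> E x y \<or> E y x \<Longrightarrow> P x n \<Longrightarrow> P y (Suc n)"
  shows "\<forall>x. p x > 0 \<longrightarrow> (\<exists>n. P x n \<and> real n \<le> l + 1 - p x)"
  using assms(1)
proof (induction "edge_point g g 0" p l rule: pl_path.induct)
  case refl
  then show ?case using assms(2) by (auto simp: edge_point_def intro!: exI[of _ 0])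
next
  case (step u v s l t)
  note IH = step.hyps(2)
  show ?case
  proof (cases "u = v")
    \<comment> \<open>All points of a loop edge coincide with its vertex, so the step only lengthens
      the path.\<close>
    case True
    then have "edge_point u v r = edge_point u u 0" for r by (auto simp: edge_point_def)
    then show ?thesis using IH by (metis abs_ge_zero add.commute add_left_mono diff_right_mono order_trans le_add_same_cancel1)
  next
    case False
    then have val: "edge_point u v r u = 1 - r" "edge_point u v r v = r" for r
      by (auto simp: edge_point_def)
    have u: "s < 1 \<Longrightarrow> \<exists>n. P u n \<and> real n \<le> l + s" and v: "0 < s \<Longrightarrow> \<exists>n. P v n \<and> real n \<le> l + 1 - s"
      using IH[rule_format, of u] IH[rule_format, of v] by (auto simp: val)
    \<comment> \<open>For s = 1 the previous point has weight 0 at \<open>u\<close> and nothing is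
      known there; \<open>u\<close> is then reached from \<open>v\<close> by one more edge. The same
      happens at \<open>v\<close> for s = 0.\<close>
    have "\<exists>n. P u n \<and> real n \<le> l + \<bar>s - t\<bar> + t"
    proof (cases "s < 1")
      case True
      then obtain n where "P u n" "real n \<le> l + s" using u by blast
      then show ?thesis by (intro exI[of _ n]) auto
    next
      case False
      then obtain n where "P v n" "real n \<le> l" "s = 1" using v \<open>s \<le> 1\<close> by auto
      then show ?thesis using assms(3)[of v u n] step.hyps by (intro exI[of _ "Suc n"]) auto
    qed
    moreover have "\<exists>n. P v n \<and> real n \<le> l + \<bar>s - t\<bar> + 1 - t"
    proof (cases "0 < s")
      case True
      then obtain n where "P v n" "real n \<le> l + 1 - s" using v by blast
      then show ?thesis by (intro exI[of _ n]) auto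
    next
      case False
      then obtain n where "P u n" "real n \<le> l" "s = 0" using u \<open>0 \<le> s\<close> by auto
      then show ?thesis using assms(3)[of u v n] step.hyps by (intro exI[of _ "Suc n"]) auto
    qed
    ultimately have "\<exists>n. P x n \<and> real n \<le> l + \<bar>s - t\<bar> + 1 - edge_point u v t x" if "x \<in> {u, v}" for x
      using that by (auto simp: val algebra_simps)
    moreover have "x \<in> {u, v}" if "edge_point u v t x > 0" for x
      using that by (rule_tac ccontr) (simp add: edge_point_def)
    ultimately show ?thesis by blast
  qed
qed

context group
begin

definition comm_edge :: "'a \<Rightarrow> 'a \<Rightarrow> bool" where
  "comm_edge g h \<longleftrightarrow> inv\<^bsub>commutator_subgroup G\<^esub> g \<otimes>\<^bsub>commutator_subgroup G\<^esub> h \<in> nontrivial_commutators G"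

abbreviation "comm_graph \<equiv> cayley_graph (commutator_subgroup G) (nontrivial_commutators G)"

lemma comm_edge_iff:
  assumes "g \<in> V" "h \<in> V"
  shows "comm_edge g h \<longleftrightarrow> (\<exists>s\<in>commutators G. s \<noteq> \<one> \<and> h = g \<otimes> s)"
proof -
  have "comm_edge g h \<longleftrightarrow> inv g \<otimes> h \<in> commutators G - {\<one>}"
    using m_inv_consistent[OF V_subgroup assms(1)]
    by (simp add: comm_edge_def commutator_subgroup_def nontrivial_commutators_def
        derived_set_eq_commutators del: UN_iff)
  also have "\<dots> \<longleftrightarrow> (\<exists>s\<in>commutators G. s \<noteq> \<one> \<and> h = g \<otimes> s)"
  proof
    assume "inv g \<otimes> h \<in> commutators G - {\<one>}"
    then show "\<exists>s\<in>commutators G. s \<noteq> \<one> \<and> h = g \<otimes> s"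
      using assms V_closed by (intro bexI[of _ "inv g \<otimes> h"]) auto
  next
    assume "\<exists>s\<in>commutators G. s \<noteq> \<one> \<and> h = g \<otimes> s"
    then obtain s where "s \<in> commutators G" "s \<noteq> \<one>" "h = g \<otimes> s" by blast
    then show "inv g \<otimes> h \<in> commutators G - {\<one>}"
      using V_closed[OF assms(1)] commutators_closed[of s] by simp
  qed
  finally show ?thesis .
qed

lemma
  shows mspace_comm_graph: "mspace comm_graph = graph_points V comm_edge"
    and mdist_comm_graph: "mdist comm_graph = graph_dist V comm_edge"
  using cayley_graph_connected[OF generate_nontrivial_commutators[OF is_group]]
  by (simp_all add: carrier_commutator_subgroup comm_edge_def[abs_def])

definition vertex :: "'a \<Rightarrow> 'a \<Rightarrow> real" where
  "vertex g = edge_point g g 0"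

lemma vertex_in_comm_graph [simp]: "g \<in> V \<Longrightarrow> vertex g \<in> mspace comm_graph"
  by (auto simp: mspace_comm_graph graph_points_def vertex_def)

lemma mdist_le_pl_path:
  assumes "pl_path V comm_edge p q l"
  shows "mdist comm_graph p q \<le> l"
proof -
  have "bdd_below {l. pl_path V comm_edge p q l}"
    by (intro bdd_belowI[of _ 0]) (auto dest: pl_path_nonneg)
  then show ?thesis
    using assms pl_path_points[OF assms]
    by (auto simp: mdist_comm_graph graph_dist_def intro!: cInf_lower)
qed

text \<open>Words may contain the trivial commutator, which is not an edge label; it costs length 0,
  hence an inequality for \<open>l\<close>.\<close>

lemma pl_path_vertex_step:
  assumes "g \<in> V" "s \<in> commutators G"
  shows "\<exists>l\<le>1. pl_path V comm_edge (vertex g) (vertex (g \<otimes> s)) l"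
proof (cases "s = \<one>")
  case True
  then show ?thesis
    using assms V_closed pl_path.refl[of "vertex g" V comm_edge]
    by (intro exI[of _ 0]) (auto simp: graph_points_def vertex_def)
next
  case False
  have gs: "g \<otimes> s \<in> V"
    using V_step assms by simp
  have "pl_path V comm_edge (edge_point g (g \<otimes> s) 0) (edge_point g (g \<otimes> s) 1) \<bar>0 - 1\<bar>"
    using assms gs False by (intro pl_path_edge) (auto simp: comm_edge_iff)
  then show ?thesis
    by (intro exI[of _ 1]) (simp add: vertex_def edge_point_0[of g "g \<otimes> s"] edge_point_1)
qed

lemma mdist_vertex_step:
  assumes "g \<in> V" "s \<in> commutators G"
  shows "mdist comm_graph (vertex g) (vertex (g \<otimes> s)) \<le> 1"
  using pl_path_vertex_step[OF assms] mdist_le_pl_path by force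

lemma near_vertex:
  assumes "p \<in> mspace comm_graph"
  shows "\<exists>g\<in>V. mdist comm_graph p (vertex g) \<le> 1"
proof -
  consider g where "g \<in> V" "p = vertex g"
    | g h t where "g \<in> V" "h \<in> V" "comm_edge g h" "0 \<le> t" "t \<le> 1" "p = edge_point g h t"
    using assms by (auto simp: mspace_comm_graph graph_points_def vertex_def)
  then show ?thesis
  proof cases
    case 1
    then show ?thesis by (intro bexI[of _ g]) (simp_all add: mdist_self)
  next
    case 2
    then have "pl_path V comm_edge p (vertex g) \<bar>t - 0\<bar>"
      using pl_path_edge[of g V h comm_edge t 0] by (simp add: vertex_def edge_point_0[of g h])
    then show ?thesis using mdist_le_pl_path 2 by (intro bexI[of _ g]) force+
  qed
qed

text \<open>The distance is an infimum, so the strict bound provides an actual path shorter than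
  \<open>r\<close>; \<open>pl_path_combinatorial\<close> then counts its edges, with
  \<open>P\<close> recording words of a given length.\<close>

lemma word_between_vertices:
  assumes g: "g \<in> V" and h: "h \<in> V" and d: "mdist comm_graph (vertex g) (vertex h) < r"
  shows "\<exists>u. set u \<subseteq> commutators G \<and> real (length u) < r \<and> h = g \<otimes> wprod G u"
proof -
  define P where "P x n \<longleftrightarrow> (\<exists>u. set u \<subseteq> commutators G \<and> length u = n \<and> x = g \<otimes> wprod G u)" for x n
  have P0: "P g 0" using V_closed[OF g] by (auto simp: P_def)
  have step: "P y (Suc n)" if x: "x \<in> V" and y: "y \<in> V" and e: "comm_edge x y \<or> comm_edge y x" and P: "P x n" for x y n
  proof -
    obtain s where s: "s \<in> commutators G" "y = x \<otimes> s"
    proof (cases "comm_edge x y")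
      case True
      then show ?thesis using that comm_edge_iff[OF x y] by blast
    next
      case False
      then obtain s where "s \<in> commutators G" "x = y \<otimes> s" using e comm_edge_iff[OF y x] by blast
      then show ?thesis using that[of "inv s"] V_closed[OF y] commutators_closed by (simp add: m_assoc)
    qed
    obtain u where u: "set u \<subseteq> commutators G" "length u = n" "x = g \<otimes> wprod G u"
      using P by (auto simp: P_def)
    have "set u \<subseteq> carrier G" using u(1) commutators_closed by blast
    then have "y = g \<otimes> wprod G (u @ [s])"
      using u s V_closed[OF g] commutators_closed by (simp add: wprod_append m_assoc)
    then show ?thesis using u s unfolding P_def by (intro exI[of _ "u @ [s]"]) simp
  qed
  \<comment> \<open>Without a path, the infimum below would be taken over the empty set.\<close>
  have "\<exists>l. pl_path V comm_edge (vertex g) (vertex h) l"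
  proof -
    have ex: "\<exists>l. pl_path V comm_edge (vertex x) (vertex (x \<otimes> wprod G u)) l"
      if "set u \<subseteq> commutators G" "x \<in> V" for u x
      using that
    proof (induction u arbitrary: x)
      case Nil
      then show ?case using pl_path_vertex_step[of x \<one>] V_closed by auto
    next
      case (Cons s u)
      then have s: "s \<in> commutators G" "set u \<subseteq> commutators G" "x \<in> carrier G" using V_closed by auto
      have xs: "x \<otimes> s \<in> V"
        using V_step Cons.prems(2) s(1) by simp
      obtain l1 l2 where "pl_path V comm_edge (vertex x) (vertex (x \<otimes> s)) l1"
        "pl_path V comm_edge (vertex (x \<otimes> s)) (vertex (x \<otimes> s \<otimes> wprod G u)) l2"
        using Cons.IH[OF s(2) xs] pl_path_vertex_step[OF Cons.prems(2) s(1)] by blast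
      then have "pl_path V comm_edge (vertex x) (vertex (x \<otimes> s \<otimes> wprod G u)) (l1 + l2)"
        using pl_path_trans by blast
      then show ?case
        using s commutators_closed wprod_commutators_closed by (auto simp: m_assoc)
    qed
    have "inv g \<otimes> h \<in> V"
      using g h V_subgroup by (simp add: subgroup.m_closed subgroup.m_inv_closed)
    then obtain u where "set u \<subseteq> commutators G" "inv g \<otimes> h = wprod G u"
      using derived_imp_wprod by blast
    then show ?thesis using ex[of u g] g h V_closed by (metis cancel_inv_left(1))
  qed
  moreover have "mdist comm_graph (vertex g) (vertex h) = Inf {l. pl_path V comm_edge (vertex g) (vertex h) l}"
    using g h by (auto simp: mdist_comm_graph graph_dist_def graph_points_def vertex_def)
  ultimately obtain l where l: "pl_path V comm_edge (vertex g) (vertex h) l" "l < r"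
    using d cInf_lessD[of "{l. pl_path V comm_edge (vertex g) (vertex h) l}" r] by auto
  have "\<forall>x. vertex h x > 0 \<longrightarrow> (\<exists>n. P x n \<and> real n \<le> l + 1 - vertex h x)"
    using pl_path_combinatorial[of V comm_edge g "vertex h" l P] l(1) P0 step by (auto simp: vertex_def)
  then obtain n where "P h n" "real n \<le> l"
    by (force simp: vertex_def edge_point_def)
  then show ?thesis using l(2) by (auto simp: P_def)
qed

end

section \<open>The Kuratowski embedding\<close>

text \<open>On a discrete type every function is continuous, so bounded continuous functions are all
  bounded functions. Subtracting the distance from \<open>y0\<close> makes the function bounded;
  outside the space it is 0.\<close>

definition kuratowski :: "'y metric \<Rightarrow> 'y \<Rightarrow> 'y \<Rightarrow> ('y discrete \<Rightarrow>\<^sub>C real)" where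
  "kuratowski Y y0 y = Bcontfun (\<lambda>z. if of_discrete z \<in> mspace Y
     then mdist Y y (of_discrete z) - mdist Y y0 (of_discrete z) else 0)"

lemma mdist_reverse_triangle:
  "x \<in> mspace Y \<Longrightarrow> y \<in> mspace Y \<Longrightarrow> z \<in> mspace Y \<Longrightarrow> \<bar>mdist Y x z - mdist Y y z\<bar> \<le> mdist Y x y"
  using mdist_triangle[of x Y y z] mdist_triangle[of y Y x z] mdist_commute[of Y x y] by linarith

lemma apply_kuratowski:
  assumes "y0 \<in> mspace Y" "y \<in> mspace Y"
  shows "apply_bcontfun (kuratowski Y y0 y) z = (if of_discrete z \<in> mspace Y
     then mdist Y y (of_discrete z) - mdist Y y0 (of_discrete z) else 0)"
proof -
  let ?f = "\<lambda>z. if of_discrete z \<in> mspace Y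
     then mdist Y y (of_discrete z) - mdist Y y0 (of_discrete z) else 0"
  have "bounded (range ?f)"
    using mdist_reverse_triangle[OF assms(2,1)] by (intro boundedI[of _ "mdist Y y y0"]) auto
  moreover have "continuous_on UNIV ?f"
    by (simp add: continuous_on_open_invariant open_discrete)
  ultimately have "?f \<in> bcontfun" by (simp add: bcontfun_def)
  then show ?thesis by (simp add: kuratowski_def Bcontfun_inverse)
qed

text \<open>The reverse triangle inequality gives the upper bound, evaluation at \<open>y\<close>
  itself the lower one.\<close>

lemma dist_kuratowski:
  assumes "y0 \<in> mspace Y" "x \<in> mspace Y" "y \<in> mspace Y"
  shows "dist (kuratowski Y y0 x) (kuratowski Y y0 y) = mdist Y x y"
proof (rule antisym)
  show "dist (kuratowski Y y0 x) (kuratowski Y y0 y) \<le> mdist Y x y"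
    using mdist_reverse_triangle[OF assms(2,3)]
    by (intro dist_bound) (auto simp: apply_kuratowski assms dist_real_def)
  show "mdist Y x y \<le> dist (kuratowski Y y0 x) (kuratowski Y y0 y)"
    using dist_bounded[of "kuratowski Y y0 x" "discrete y" "kuratowski Y y0 y"] assms
      mdist_self[of y Y]
    by (simp add: apply_kuratowski discrete_inverse dist_real_def)
qed

section \<open>Connectivity of transported metrics\<close>

lemma k_connected_space_homeomorphic:
  assumes f: "continuous_map X Z f" and g: "continuous_map Z X g"
    and gf: "\<And>x. x \<in> topspace X \<Longrightarrow> g (f x) = x" and fg: "\<And>z. z \<in> topspace Z \<Longrightarrow> f (g z) = z"
    and X: "k_connected_space k X"
  shows "k_connected_space k Z"
  unfolding k_connected_space_def
proof (intro conjI allI impI ballI)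
  have "X homeomorphic_space Z"
    using f g gf fg by (auto simp: homeomorphic_space_def homeomorphic_maps_def)
  then show "path_connected_space Z"
    using X homeomorphic_path_connected_space by (auto simp: k_connected_space_def)
next
  fix i z assume i: "i \<le> k" and z: "z \<in> topspace Z"
  have gz: "g z \<in> topspace X" using g z by (auto simp: continuous_map_def)
  show "is_singleton (homotopy_group_set i Z z)"
    unfolding is_singleton_homotopy_group_set[OF z]
  proof
    fix c assume c: "c \<in> cube_maps i Z z"
    then have "g \<circ> c \<in> cube_maps i X (g z)"
      using g by (auto simp: cube_maps_def intro: continuous_map_compose)
    then have "homotopic_with (\<lambda>h. \<forall>x\<in>cube_boundary i. h x = g z) (unit_cube i) X (g \<circ> c) (\<lambda>_. g z)"
      using X i gz is_singleton_homotopy_group_set[OF gz, of i] by (auto simp: k_connected_space_def)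
    then have "homotopic_with (\<lambda>h. \<forall>x\<in>cube_boundary i. h x = z) (unit_cube i) Z (f \<circ> (g \<circ> c)) (f \<circ> (\<lambda>_. g z))"
      by (rule homotopic_with_compose_continuous_map_left[OF _ f]) (simp add: fg z)
    then show "homotopic_with (\<lambda>h. \<forall>x\<in>cube_boundary i. h x = z) (unit_cube i) Z c (\<lambda>_. z)"
    proof (rule homotopic_with_eq)
      fix x assume "x \<in> topspace (unit_cube i)"
      then have "c x \<in> topspace Z" using c by (auto simp: cube_maps_def continuous_map_def)
      then show "c x = (f \<circ> (g \<circ> c)) x" by (simp add: fg)
    qed (auto simp: fg z cube_boundary_def)
  qed
qed

lemma simply_connected_imp_k_connected_space:
  fixes S :: "'b::real_normed_vector set"
  assumes "simply_connected S"
  shows "k_connected_space 1 (top_of_set S)"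
  unfolding k_connected_space_def
proof (intro conjI allI impI ballI)
  have pc: "path_connected S" using assms by (rule simply_connected_imp_path_connected)
  then show pcs: "path_connected_space (top_of_set S)"
    by (simp add: path_connectedin_def[symmetric] path_connectedin_euclidean
        flip: path_connectedin_topspace)
  fix i :: nat and z assume i: "i \<le> 1" and z: "z \<in> topspace (top_of_set S)"
  show "is_singleton (homotopy_group_set i (top_of_set S) z)"
    unfolding is_singleton_homotopy_group_set[OF z]
  proof
    fix c assume c: "c \<in> cube_maps i (top_of_set S) z"
    consider "i = 0" | "i = 1" using i by linarith
    then show "homotopic_with (\<lambda>h. \<forall>x\<in>cube_boundary i. h x = z) (unit_cube i) (top_of_set S) c (\<lambda>_. z)"
    proof cases
      case 1
      \<comment> \<open>The 0-cube has one point, the everywhere undefined function, and empty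
        boundary, so its maps modulo homotopy are path components.\<close>
      let ?u = "\<lambda>_::nat. undefined :: real"
      have top: "topspace (unit_cube i) = {?u}" by (simp add: unit_cube_def 1)
      then have "c ?u \<in> S" using c by (auto simp: cube_maps_def continuous_map_def)
      then have "path_component_of (top_of_set S) (c ?u) z"
        using pcs z by (auto simp: path_connected_space_iff_path_component)
      then have "homotopic_with (\<lambda>h. True) (unit_cube i) (top_of_set S) (\<lambda>_. c ?u) (\<lambda>_. z)"
        unfolding homotopic_constant_maps by blast
      then have "homotopic_with (\<lambda>h. True) (unit_cube i) (top_of_set S) c (\<lambda>_. z)"
        by (rule homotopic_with_eq) (auto simp: top)
      then show ?thesis using 1 by (simp add: cube_boundary_def)
    next
      case 2
      \<comment> \<open>The identification of the interval with the 1-cube, whose points are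
        functions undefined away from 0.\<close>
      define e where "e t = (\<lambda>j\<in>{..<1::nat}. t)" for t :: real
      have e_inv: "e (x 0) = x" if "x \<in> topspace (unit_cube 1)" for x
        using that by (auto simp: unit_cube_def e_def PiE_def extensional_def restrict_def fun_eq_iff)
      have e: "continuous_map (top_of_set {0..1}) (unit_cube 1) e"
        unfolding unit_cube_def continuous_map_componentwise
        by (auto simp: e_def extensional_def)
      have bd: "e t \<in> cube_boundary 1 \<longleftrightarrow> t = 0 \<or> t = 1" for t
        by (auto simp: cube_boundary_def unit_cube_def e_def PiE_def)
      define \<gamma> where "\<gamma> = c \<circ> e"
      have "continuous_map (top_of_set {0..1}) (top_of_set S) \<gamma>"
        unfolding \<gamma>_def using e c 2 by (intro continuous_map_compose) (auto simp: cube_maps_def)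
      moreover have \<gamma>01: "\<gamma> 0 = z" "\<gamma> 1 = z"
        using c 2 bd by (auto simp: \<gamma>_def cube_maps_def)
      ultimately have "homotopic_paths S \<gamma> (linepath z z)"
        using assms unfolding simply_connected_eq_contractible_path
        by (auto simp: path_def path_image_def pathstart_def pathfinish_def)
      then have "homotopic_with (\<lambda>h. h 0 = z \<and> h 1 = z) (top_of_set {0..1}) (top_of_set S) \<gamma> (linepath z z)"
        by (simp add: homotopic_paths_def pathstart_def pathfinish_def \<gamma>01)
      then have "homotopic_with (\<lambda>h. \<forall>x\<in>cube_boundary 1. h x = z) (unit_cube 1) (top_of_set S)
          (\<gamma> \<circ> (\<lambda>x. x 0)) (linepath z z \<circ> (\<lambda>x. x 0))"
      proof (rule homotopic_with_compose_continuous_map_right)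
        show "continuous_map (unit_cube 1) (top_of_set {0..1}) (\<lambda>x. x 0)"
          unfolding unit_cube_def by (rule continuous_map_product_projection) simp
      qed (auto simp: cube_boundary_def less_one)
      then show ?thesis
        unfolding 2
        by (rule homotopic_with_eq) (auto simp: \<gamma>_def e_inv cube_boundary_def linepath_def scaleR_left_diff_distrib)
    qed
  qed
qed

text \<open>Carries a subset of the space of bounded functions into the type prescribed for the
  second thickening.\<close>

definition image_metric :: "('b::metric_space \<Rightarrow> 'c) \<Rightarrow> 'b set \<Rightarrow> 'c metric" where
  "image_metric J A = metric (J ` A, \<lambda>x y. dist (inv_into UNIV J x) (inv_into UNIV J y))"

lemma
  assumes "inj J"
  shows mspace_image_metric: "mspace (image_metric J A) = J ` A"
    and mdist_image_metric: "mdist (image_metric J A) = (\<lambda>x y. dist (inv_into UNIV J x) (inv_into UNIV J y))"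
proof -
  interpret Metric_space "J ` A" "\<lambda>x y. dist (inv_into UNIV J x) (inv_into UNIV J y)"
    by unfold_locales (auto simp: inv_f_f[OF assms] dist_commute dist_triangle)
  show "mspace (image_metric J A) = J ` A"
    "mdist (image_metric J A) = (\<lambda>x y. dist (inv_into UNIV J x) (inv_into UNIV J y))"
    by (simp_all add: image_metric_def)
qed

lemma k_connected_space_image_metric:
  assumes "inj J" "k_connected_space k (top_of_set A)"
  shows "k_connected_space k (mtopology_of (image_metric J A))"
proof (rule k_connected_space_homeomorphic[OF _ _ _ _ assms(2)])
  have top: "top_of_set A = mtopology_of (submetric euclidean_metric A)"
    by (simp add: mtopology_of_submetric)
  show "continuous_map (top_of_set A) (mtopology_of (image_metric J A)) J"
    unfolding top
    by (rule Lipschitz_continuous_imp_continuous_map)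
      (auto simp: Lipschitz_continuous_map_def mspace_image_metric mdist_image_metric assms(1)
        inv_f_f[OF assms(1)] intro!: exI[of _ 1])
  show "continuous_map (mtopology_of (image_metric J A)) (top_of_set A) (inv_into UNIV J)"
    unfolding top
    by (rule Lipschitz_continuous_imp_continuous_map)
      (auto simp: Lipschitz_continuous_map_def mspace_image_metric mdist_image_metric assms(1)
        inv_f_f[OF assms(1)] intro!: exI[of _ 1])
qed (auto simp: mspace_image_metric assms(1) inv_f_f)

section \<open>Large scale simple connectivity of the Cayley graph\<close>

theorem theoremA:
  fixes G :: "('a, 'b) monoid_scheme"
  assumes "finitely_presented G"
  shows "large_scale_connected TYPE('y) 1
           (cayley_graph (commutator_subgroup G) (nontrivial_commutators G))"
  unfolding large_scale_connected_def
proof (intro allI impI)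
  interpret group G using assms by (simp add: finitely_presented_def)
  obtain L where L: "\<And>w. set w \<subseteq> commutators G \<Longrightarrow> wprod G w = \<one>\<^bsub>G\<^esub> \<Longrightarrow> (w, []) \<in> move_eq G L"
    using short_relations[OF assms] by blast
  fix Y :: "'y metric" and f
  assume f: "thickening comm_graph Y f"
  then have fY: "f x \<in> mspace Y" if "x \<in> mspace comm_graph" for x
    using that by (auto simp: thickening_def)
  have iso: "mdist Y (f x) (f x') = mdist comm_graph x x'"
    if "x \<in> mspace comm_graph" "x' \<in> mspace comm_graph" for x x'
    using f that by (auto simp: thickening_def)
  obtain C where C: "\<And>y. y \<in> mspace Y \<Longrightarrow> \<exists>x\<in>mspace comm_graph. mdist Y y (f x) \<le> C"
    using f unfolding thickening_def by blast
  \<comment> \<open>At least \<open>L\<close> for the moves, and at least C + 1 because a point of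
    \<open>Y\<close> is within \<open>C\<close> of the graph and a point of the graph within 1 of a
    vertex.\<close>
  define k where "k = nat \<lceil>C\<rceil> + L + 1"
  have k: "L \<le> k" "1 \<le> k" "C + 1 \<le> real k" unfolding k_def by linarith+
  define y0 where "y0 = f (vertex \<one>\<^bsub>G\<^esub>)"
  have one: "\<one>\<^bsub>G\<^esub> \<in> V" using wprod_in_derived[of "[]"] by simp
  have y0: "y0 \<in> mspace Y" using fY one by (simp add: y0_def)
  define \<kappa> where "\<kappa> g = kuratowski Y y0 (f (vertex g))" for g
  have \<kappa>: "dist (\<kappa> g) (\<kappa> h) = mdist comm_graph (vertex g) (vertex h)" if "g \<in> V" "h \<in> V" for g h
    using that by (simp add: \<kappa>_def dist_kuratowski y0 fY iso)
  interpret N: commutator_nerve G \<kappa> k L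
  proof unfold_locales
    fix g s assume "g \<in> V" "s \<in> commutators G"
    then show "dist (\<kappa> g) (\<kappa> (g \<otimes>\<^bsub>G\<^esub> s)) \<le> 1"
      using mdist_vertex_step V_step by (simp add: \<kappa>)
  next
    \<comment> \<open>The length is an integer below 2k + 1, hence at most 2k.\<close>
    fix g h assume "g \<in> V" "h \<in> V" "dist (\<kappa> g) (\<kappa> h) < 2 * real k + 1"
    then obtain u where "set u \<subseteq> commutators G" "real (length u) < 2 * real k + 1" "h = g \<otimes>\<^bsub>G\<^esub> wprod G u"
      using word_between_vertices \<kappa> by metis
    then show "\<exists>u. set u \<subseteq> commutators G \<and> length u \<le> 2 * k \<and> h = g \<otimes>\<^bsub>G\<^esub> wprod G u"
      by (intro exI[of _ u]) linarith
  qed (use L k in auto)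
  \<comment> \<open>Forgets boundedness and the discrete copy of the type.\<close>
  define J :: "('y discrete \<Rightarrow>\<^sub>C real) \<Rightarrow> 'y \<Rightarrow> real" where "J b y = apply_bcontfun b (discrete y)" for b y
  have J: "inj J"
  proof (rule injI)
    fix b c assume "J b = J c"
    then have "apply_bcontfun b (discrete (of_discrete z)) = apply_bcontfun c (discrete (of_discrete z))" for z
      unfolding J_def by metis
    then show "b = c" by (intro bcontfun_eqI) (simp add: of_discrete_inverse)
  qed
  have in_S: "kuratowski Y y0 y \<in> N.S" if y: "y \<in> mspace Y" for y
  proof -
    obtain x where x: "x \<in> mspace comm_graph" "mdist Y y (f x) \<le> C" using C[OF y] by blast
    obtain g where g: "g \<in> V" "mdist comm_graph x (vertex g) \<le> 1" using near_vertex[OF x(1)] by blast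
    have "mdist Y y (f (vertex g)) \<le> mdist Y y (f x) + mdist Y (f x) (f (vertex g))"
      using y x g fY by (intro mdist_triangle) auto
    also have "\<dots> \<le> real k" using x g k(3) by (simp add: iso)
    also have "\<dots> < N.R" by (rule N.R(1))
    finally have "dist (\<kappa> g) (kuratowski Y y0 y) < N.R"
      using y y0 g fY by (simp add: \<kappa>_def dist_kuratowski mdist_commute)
    then show ?thesis using g(1) by (auto simp: N.S_def)
  qed
  let ?Z = "image_metric J N.S"
  have "thickening Y ?Z (\<lambda>y. J (kuratowski Y y0 y))"
    unfolding thickening_def mspace_image_metric[OF J] mdist_image_metric[OF J]
  \<comment> \<open>Points of \<open>N.S\<close> are within \<open>N.R\<close> of a vertex, and
    vertices already lie in the image of \<open>Y\<close>.\<close>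
  proof (intro conjI ballI exI[of _ "N.R"])
    fix z assume "z \<in> J ` N.S"
    then obtain b g where "z = J b" "g \<in> V" "b \<in> ball (\<kappa> g) N.R" by (auto simp: N.S_def)
    then show "\<exists>y\<in>mspace Y. dist (inv_into UNIV J z) (inv_into UNIV J (J (kuratowski Y y0 y))) \<le> N.R"
      using fY by (intro bexI[of _ "f (vertex g)"]) (auto simp: inv_f_f[OF J] \<kappa>_def dist_commute)
  qed (use in_S y0 in \<open>auto simp: inv_f_f[OF J] dist_kuratowski\<close>)
  moreover have "k_connected_space 1 (mtopology_of ?Z)"
    using k_connected_space_image_metric[OF J simply_connected_imp_k_connected_space[OF N.simply_connected_S]] .
  ultimately show "\<exists>(Z :: ('y \<Rightarrow> real) metric) g. thickening Y Z g \<and> k_connected_space 1 (mtopology_of Z)"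
    by blast
qed

end
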